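(* Let $(X,0)$ be a germ of a closed semialgebraic subset of $\mathbb{R}^n$ of dimension $k$. Let $f:(X,0)\to(\mathbb{R}^n,0)$ be a semialgebraic and bi-Lipschitz embedding. If $n\ge 2k+1$, then there exists a germ of a tame bi-Lipschitz and semialgebraic homeomorphism $F:(\mathbb{R}^n,0)\to(\mathbb{R}^n,0)$ such that $F|_X=f$. Moreover, there is a continuous and semialgebraic family of germs of tame bi-Lipschitz and semialgebraic homeomorphisms $F_t:(\mathbb{R}^n,0)\to(\mathbb{R}^n,0)$, $t\in\mathbb{R}$ (continuous and semialgebraic in $(x,t)$), such that $F_0$ is the identity and $F_1|_X=f$.
   Context: Sets carry the outer metric, i.e. the restriction of the Euclidean distance. A semialgebraic and bi-Lipschitz embedding $f:(X,0)\to(\mathbb{R}^n,0)$ is a germ at $0$ of a semialgebraic map such that $f((X,0))=(Y,0)$ is a germ of a closed semialgebraic subset of $\mathbb{R}^n$ and $f:(X,0)\to(Y,0)$ is a germ of a bijection with $f$ and $f^{-1}$ Lipschitz and semialgebraic. A germ of a bi-Lipschitz homeomorphism of $(\mathbb{R}^n,0)$ is called tame if it is a composition of germs of bi-Lipschitz homeomorphisms of the form $(x_1,\dots,x_n)\mapsto(x_1,\dots,x_{n-1},x_n+p(x_1,\dots,x_{n-1}))$ (fixing $0$) and linear mappings of $\mathbb{R}^n$ with determinant one. *)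

theory Defs
  imports "HOL-Analysis.Analysis"
begin

section \<open>Semialgebraic sets and maps\<close>

inductive semialgebraic :: "'a::euclidean_space set \<Rightarrow> bool" where
  pos: "real_polynomial_function p \<Longrightarrow> semialgebraic {x. 0 < p x}"
| Un: "semialgebraic A \<Longrightarrow> semialgebraic B \<Longrightarrow> semialgebraic (A \<union> B)"
| Int: "semialgebraic A \<Longrightarrow> semialgebraic B \<Longrightarrow> semialgebraic (A \<inter> B)"
| Compl: "semialgebraic A \<Longrightarrow> semialgebraic (- A)"

text \<open>A map is semialgebraic if its graph is. The domain \<open>S\<close> is then semialgebraic as well,
  being a projection of the graph.\<close>

definition semialgebraic_map ::
    "'a::euclidean_space set \<Rightarrow> ('a \<Rightarrow> 'b::euclidean_space) \<Rightarrow> bool" where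
  "semialgebraic_map S f \<longleftrightarrow> semialgebraic ((\<lambda>x. (x, f x)) ` S)"

section \<open>Dimension\<close>

text \<open>The open unit cube of dimension \<open>card I\<close>, placed in the coordinate subspace spanned by the
  coordinates in \<open>I\<close>. This encodes $(0,1)^d$ for varying $d$; a subset of \<open>real ^ 'n\<close> never needs
  $d >$ \<open>CARD('n)\<close>.\<close>

definition open_cube :: "'n::finite set \<Rightarrow> (real ^ 'n) set" where
  "open_cube I = {x. \<forall>i. if i \<in> I then 0 < x $ i \<and> x $ i < 1 else x $ i = 0}"

text \<open>The largest dimension of a cell, i.e. of a semialgebraically homeomorphic copy of an open
  cube, contained in \<open>X\<close>. Only used for nonempty \<open>X\<close>.\<close>

definition semialgebraic_dim :: "(real ^ 'n::finite) set \<Rightarrow> nat" where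
  "semialgebraic_dim X =
     Max {card I | I :: 'n set. \<exists>S h g. S \<subseteq> X \<and> homeomorphism (open_cube I) S h g \<and>
                                     semialgebraic_map (open_cube I) h \<and> semialgebraic_map S g}"

definition has_germ_dim :: "(real ^ 'n::finite) set \<Rightarrow> nat \<Rightarrow> bool" where
  "has_germ_dim X k \<longleftrightarrow> (\<forall>\<^sub>F r in at_right 0. semialgebraic_dim (X \<inter> ball 0 r) = k)"

section \<open>Germs at the origin\<close>

text \<open>A set or map germ at \<open>0\<close> is given by a representative; maps are total functions of which
  only the values near \<open>0\<close> (and on the set in question) matter.\<close>

definition semialgebraic_germ ::
    "'a::euclidean_space set \<Rightarrow> ('a \<Rightarrow> 'b::euclidean_space) \<Rightarrow> bool" where
  "semialgebraic_germ X f \<longleftrightarrow> (\<exists>U. open U \<and> 0 \<in> U \<and> semialgebraic_map (X \<inter> U) f)"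

text \<open>\<open>f : (X,0) \<rightarrow> (Y,0)\<close> and \<open>g : (Y,0) \<rightarrow> (X,0)\<close> are mutually inverse germs, both Lipschitz
  for the outer (Euclidean) metric.\<close>

definition bilipschitz_germs ::
    "'a::euclidean_space set \<Rightarrow> 'b::euclidean_space set \<Rightarrow> ('a \<Rightarrow> 'b) \<Rightarrow> ('b \<Rightarrow> 'a) \<Rightarrow> bool" where
  "bilipschitz_germs X Y f g \<longleftrightarrow> f 0 = 0 \<and>
     (\<exists>U V C D. open U \<and> 0 \<in> U \<and> open V \<and> 0 \<in> V \<and> homeomorphism (X \<inter> U) (Y \<inter> V) f g \<and>
                C-lipschitz_on (X \<inter> U) f \<and> D-lipschitz_on (Y \<inter> V) g)"

definition semialgebraic_bilipschitz_embedding ::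
    "'a::euclidean_space set \<Rightarrow> ('a \<Rightarrow> 'b::euclidean_space) \<Rightarrow> bool" where
  "semialgebraic_bilipschitz_embedding X f \<longleftrightarrow>
     (\<exists>Y g. closed Y \<and> semialgebraic Y \<and> bilipschitz_germs X Y f g \<and>
            semialgebraic_germ X f \<and> semialgebraic_germ Y g)"

definition bilipschitz_homeo_germ :: "('a::euclidean_space \<Rightarrow> 'a) \<Rightarrow> bool" where
  "bilipschitz_homeo_germ F \<longleftrightarrow> (\<exists>G. bilipschitz_germs UNIV UNIV F G)"

section \<open>Tame germs\<close>

text \<open>The coordinate \<open>l\<close> plays the role of the last coordinate $x_n$. A function \<open>p\<close> of the other
  coordinates is a function on \<open>real ^ 'n\<close> that does not depend on the coordinate \<open>l\<close>.\<close>

definition shear_germ :: "'n::finite \<Rightarrow> (real ^ 'n \<Rightarrow> real ^ 'n) \<Rightarrow> bool" where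
  "shear_germ l F \<longleftrightarrow> bilipschitz_homeo_germ F \<and>
     (\<exists>p. (\<forall>x y. (\<forall>i. i \<noteq> l \<longrightarrow> x $ i = y $ i) \<longrightarrow> p x = p y) \<and>
          (\<forall>\<^sub>F x in nhds 0. F x = (\<chi> i. if i = l then x $ l + p x else x $ i)))"

definition tame_germ :: "'n::finite \<Rightarrow> (real ^ 'n \<Rightarrow> real ^ 'n) \<Rightarrow> bool" where
  "tame_germ l F \<longleftrightarrow> bilipschitz_homeo_germ F \<and>
     (\<exists>Hs. (\<forall>H \<in> set Hs. shear_germ l H \<or> (linear H \<and> det (matrix H) = 1)) \<and>
           (\<forall>\<^sub>F x in nhds 0. F x = foldr (\<circ>) Hs id x))"

definition tame_semialgebraic_homeo_germ :: "'n::finite \<Rightarrow> (real ^ 'n \<Rightarrow> real ^ 'n) \<Rightarrow> bool" where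
  "tame_semialgebraic_homeo_germ l F \<longleftrightarrow> tame_germ l F \<and> semialgebraic_germ UNIV F"

text \<open>A family of map germs at \<open>0\<close>, continuous and semialgebraic in \<open>(x, t)\<close>: both hold on a
  neighbourhood of \<open>{0} \<times> \<real>\<close>, on whose slices the individual germs are represented.\<close>

definition continuous_semialgebraic_family ::
    "(real \<Rightarrow> 'a::euclidean_space \<Rightarrow> 'b::euclidean_space) \<Rightarrow> bool" where
  "continuous_semialgebraic_family F \<longleftrightarrow>
     (\<exists>W. open W \<and> {0} \<times> UNIV \<subseteq> W \<and> continuous_on W (\<lambda>(x, t). F t x) \<and>
          semialgebraic_map W (\<lambda>(x, t). F t x))"

end

theory Submission
  imports Defs "HOL-Computational_Algebra.Polynomial"
begin

text \<open>Replace the embedding \<open>x\<close> of \<open>X\<close> by \<open>f\<close> in steps \<open>x \<mapsto> A x \<mapsto> B f(x) \<mapsto> f(x)\<close> with \<open>A\<close> and \<open>B\<close>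
  triangular and unipotent, changing one coordinate at a time. If the coordinates that are kept form a
  bi-Lipschitz image of \<open>X\<close>, the change is a Lipschitz function of them, which extends to $\mathbb{R}^n$
  semialgebraically; it is thus induced by a shear, and multiplying all shears by \<open>t\<close> gives the family.

  The kept coordinates must not vanish simultaneously on a limit at \<open>0\<close> of secants of the graph of \<open>f\<close>.
  Pairs of points of the graph, together with the entries of \<open>A\<close> and \<open>B\<close> for which the \<open>n - 1\<close> kept
  coordinates of the secant vanish, form a set of dimension at most \<open>2k + N - (n - 1) \<le> N\<close>, where \<open>N\<close>
  counts the entries. Hence the entries and \<open>r = |p|\<^sup>2 + |q|\<^sup>2\<close> satisfy a polynomial relation, which after
  division by a power of \<open>r\<close> remains nontrivial for \<open>r = 0\<close>: the bad choices lie on a hypersurface.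
  Dimension is measured by the growth of the space of polynomial functions of degree \<open>D\<close>. For the graph
  it is at most \<open>k\<close>, as any projection with nonempty interior to \<open>k + 1\<close> coordinates has a continuous
  section over some box, whose image would be a cell of dimension \<open>k + 1\<close>.\<close>

section \<open>Quantifier elimination\<close>

text \<open>The extra coordinate \<open>r\<close> is what makes n \<ge> 2k + 1 sufficient. The pairs
  of points together with the entries have dimension at most 2k + N - (n - 1); a relation between
  the entries alone would need this to be less than N, that is n \<ge> 2k + 2. Against the N + 1
  coordinates formed by the entries and \<open>r\<close>, dimension N is small enough. Only limits
  at 0 matter because a germ may be shrunk: if the kept coordinates vanish on no limit of secants,
  compactness makes them bi-Lipschitz near 0.

  The triangular shape splits each linear change into shears, and it lets the n - 1 equations be
  solved for one entry in each row: if all kept coordinates of a limit secant (u, v) vanish, the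
  first nonzero coordinate of u comes no later than the one being changed and the last nonzero
  coordinate of v no earlier, so both serve as pivots. That v is nonzero is where the Lipschitz
  bound on the inverse of f enters.

  Semialgebraic sets are defined without quantifiers, while interiors, fibrewise minima and
  Lipschitz extensions are described with them; hence the quantifier elimination.\<close>

definition match :: "real set \<Rightarrow> (real \<Rightarrow> real) \<Rightarrow> real \<Rightarrow> real \<Rightarrow> bool" where
  "match Z \<sigma> t t' \<longleftrightarrow> (\<forall>z\<in>Z. sgn (t - z) = sgn (t' - \<sigma> z))"

text \<open>\<open>match Z \<sigma> t t'\<close> says that t and t' lie in corresponding cells of
  the subdivisions of the line by Z and by its image. Sign tables agree if corresponding cells carry
  equal signs. Z is left open, so it may contain points that are roots of nothing.\<close>

definition same_sign_diagram :: "'k set \<Rightarrow> ('k \<Rightarrow> real poly) \<Rightarrow> ('k \<Rightarrow> real poly) \<Rightarrow> bool" where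
  "same_sign_diagram K q q' \<longleftrightarrow>
     (\<exists>Z \<sigma>. finite Z \<and> strict_mono_on Z \<sigma> \<and>
       (\<forall>t t'. match Z \<sigma> t t' \<longrightarrow> (\<forall>k\<in>K. sgn (poly (q k) t) = sgn (poly (q' k) t'))))"

lemma sgn_real_eq_iff: "sgn (a::real) = sgn b \<longleftrightarrow> (a < 0 \<longleftrightarrow> b < 0) \<and> (0 < a \<longleftrightarrow> 0 < b)"
  by (cases a "0::real" rule: linorder_cases; cases b "0::real" rule: linorder_cases) simp_all

lemma match_iff:
  "match Z \<sigma> t t' \<longleftrightarrow> (\<forall>z\<in>Z. (t < z \<longleftrightarrow> t' < \<sigma> z) \<and> (z < t \<longleftrightarrow> \<sigma> z < t'))"
  unfolding match_def sgn_real_eq_iff by auto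

lemma match_point_iff: "match Z \<sigma> t t' \<Longrightarrow> z \<in> Z \<Longrightarrow> t = z \<longleftrightarrow> t' = \<sigma> z"
  unfolding match_iff by (meson less_irrefl linorder_neqE_linordered_idom)

lemma match_self: "strict_mono_on Z \<sigma> \<Longrightarrow> t \<in> Z \<Longrightarrow> match Z \<sigma> t (\<sigma> t)"
  unfolding match_iff by (simp add: strict_mono_on_less)

lemma match_subset: "match Z \<sigma> t t' \<Longrightarrow> Y \<subseteq> Z \<Longrightarrow> match Y \<sigma> t t'"
  unfolding match_def by blast

lemma match_cong: "(\<And>z. z \<in> Z \<Longrightarrow> \<sigma> z = \<tau> z) \<Longrightarrow> match Z \<sigma> t t' = match Z \<tau> t t'"
  unfolding match_def by simp

lemma strict_mono_on_inv_into:
  fixes \<sigma> :: "'a::linorder \<Rightarrow> 'b::linorder"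
  assumes "strict_mono_on Z \<sigma>"
  shows "strict_mono_on (\<sigma> ` Z) (inv_into Z \<sigma>)"
proof (rule strict_mono_onI)
  fix a b assume "a \<in> \<sigma> ` Z" "b \<in> \<sigma> ` Z" "a < b"
  then show "inv_into Z \<sigma> a < inv_into Z \<sigma> b"
    using strict_mono_on_imp_inj_on[OF assms] strict_mono_on_less[OF assms]
    by (metis f_inv_into_f inv_into_into)
qed

lemma match_inv_into:
  assumes "strict_mono_on Z \<sigma>"
  shows "match (\<sigma> ` Z) (inv_into Z \<sigma>) t' t \<longleftrightarrow> match Z \<sigma> t t'"
  using strict_mono_on_imp_inj_on[OF assms] unfolding match_def by (auto simp: inv_into_f_f)

lemma finite_sets_between:
  fixes L U :: "real set"
  assumes "finite L" "finite U" "\<And>l u. l \<in> L \<Longrightarrow> u \<in> U \<Longrightarrow> l < u"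
  obtains m where "\<And>l. l \<in> L \<Longrightarrow> l < m" "\<And>u. u \<in> U \<Longrightarrow> m < u"
proof (cases "L = {}")
  case True
  show ?thesis
  proof (cases "U = {}")
    case True
    with \<open>L = {}\<close> that show ?thesis by blast
  next
    case False
    show ?thesis
      by (rule that[of "Min U - 1"])
        (use \<open>L = {}\<close> False assms(2) Min_le[of U] in \<open>fastforce+\<close>)
  qed
next
  case L: False
  show ?thesis
  proof (cases "U = {}")
    case True
    show ?thesis
      by (rule that[of "Max L + 1"])
        (use True L assms(1) Max_ge[of L] in \<open>fastforce+\<close>)
  next
    case False
    then have "Max L < Min U" using assms L by simp
    then obtain m where "Max L < m" "m < Min U" using dense by blast
    show ?thesis
      by (rule that[of m]) (use \<open>Max L < m\<close> \<open>m < Min U\<close> assms(1,2) in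
        \<open>auto intro: le_less_trans[OF Max_ge] less_le_trans[OF _ Min_le]\<close>)
  qed
qed

text \<open>A point of Z goes to its image, and a point between neighbours in Z goes to a point
  between their images, which exists by density.\<close>

lemma match_ex:
  assumes "finite Z" "strict_mono_on Z \<sigma>"
  shows "\<exists>t'. match Z \<sigma> t t'"
proof (cases "t \<in> Z")
  case True
  then show ?thesis using match_self assms by blast
next
  case False
  let ?L = "\<sigma> ` {z\<in>Z. z < t}" and ?U = "\<sigma> ` {z\<in>Z. t < z}"
  obtain m where m: "\<And>l. l \<in> ?L \<Longrightarrow> l < m" "\<And>u. u \<in> ?U \<Longrightarrow> m < u"
  proof (rule finite_sets_between[of ?L ?U])
    fix l u assume "l \<in> ?L" "u \<in> ?U"
    then obtain y z where "l = \<sigma> y" "u = \<sigma> z" "y \<in> Z" "z \<in> Z" "y < t" "t < z" by blast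
    then show "l < u" using assms(2) by (simp add: strict_mono_on_less)
  qed (use assms(1) in auto)
  have "match Z \<sigma> t m" unfolding match_iff
  proof (intro ballI)
    fix z assume "z \<in> Z"
    with False consider "z < t" | "t < z" by (metis linorder_neqE)
    then show "(t < z \<longleftrightarrow> m < \<sigma> z) \<and> (z < t \<longleftrightarrow> \<sigma> z < m)"
    proof cases
      case 1
      then have "\<sigma> z < m" using m(1) \<open>z \<in> Z\<close> by blast
      with 1 show ?thesis by simp
    next
      case 2
      then have "m < \<sigma> z" using m(2) \<open>z \<in> Z\<close> by blast
      with 2 show ?thesis by simp
    qed
  qed
  then show ?thesis ..
qed

lemma match_ex':
  assumes "finite Z" "strict_mono_on Z \<sigma>"
  shows "\<exists>t. match Z \<sigma> t t'"
proof -
  obtain t where "match (\<sigma> ` Z) (inv_into Z \<sigma>) t' t"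
    using match_ex[of "\<sigma> ` Z" "inv_into Z \<sigma>" t'] strict_mono_on_inv_into[OF assms(2)] assms(1)
    by blast
  then show ?thesis using match_inv_into[OF assms(2)] by blast
qed

lemma same_sign_diagram_reindex:
  assumes "same_sign_diagram L r r'" and "\<And>k. k \<in> K \<Longrightarrow> \<exists>l\<in>L. q k = r l \<and> q' k = r' l"
  shows "same_sign_diagram K q q'"
  using assms unfolding same_sign_diagram_def by metis

lemma poly_sgn_const:
  fixes p :: "real poly"
  assumes "\<And>x. \<lbrakk>min a b \<le> x; x \<le> max a b\<rbrakk> \<Longrightarrow> poly p x \<noteq> 0"
  shows "sgn (poly p a) = sgn (poly p b)"
proof (rule ccontr)
  assume ne: "sgn (poly p a) \<noteq> sgn (poly p b)"
  then have "a \<noteq> b" by auto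
  have 0: "poly p a \<noteq> 0" "poly p b \<noteq> 0" using assms by auto
  have "poly p a * poly p b < 0"
    using ne 0 by (auto simp: sgn_if mult_less_0_iff split: if_splits)
  then have "poly p (min a b) * poly p (max a b) < 0"
    by (auto simp: min_def max_def mult.commute)
  moreover have "min a b < max a b" using \<open>a \<noteq> b\<close> by auto
  ultimately obtain x where "x > min a b" "x < max a b" "poly p x = 0"
    using poly_IVT by blast
  then show False using assms[of x] by auto
qed

lemma poly_eq_0_of_sgn:
  assumes "finite Z" "strict_mono_on Z \<sigma>"
    and "\<And>t t'. match Z \<sigma> t t' \<Longrightarrow> sgn (poly p t) = sgn (poly p' t')"
  shows "p = 0 \<longleftrightarrow> p' = (0::real poly)"
proof
  assume "p = 0"
  have "poly p' t' = 0" for t'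
    using match_ex'[OF assms(1,2), of t'] assms(3) \<open>p = 0\<close> by (metis poly_0 sgn_0 sgn_0_0)
  then show "p' = 0" using poly_all_0_iff_0 by blast
next
  assume "p' = 0"
  have "poly p t = 0" for t
    using match_ex[OF assms(1,2), of t] assms(3) \<open>p' = 0\<close> by (metis poly_0 sgn_0 sgn_0_0)
  then show "p = 0" using poly_all_0_iff_0 by blast
qed

text \<open>All points of an open cell are matched with the same t', so a root inside the cell would
  make p vanish on an interval.\<close>

lemma root_in_of_sgn:
  assumes "finite Z" "strict_mono_on Z \<sigma>"
    and s: "\<And>t t'. match Z \<sigma> t t' \<Longrightarrow> sgn (poly p t) = sgn (poly p' t')"
    and "p \<noteq> 0" "poly p t = (0::real)"
  shows "t \<in> Z"
proof (rule ccontr)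
  assume "t \<notin> Z"
  \<comment> \<open>The interval from t to m contains no point of Z.\<close>
  obtain m where m: "\<And>l. l \<in> {z\<in>Z. z < t} \<union> {t} \<Longrightarrow> l < m" "\<And>u. u \<in> {z\<in>Z. t < z} \<Longrightarrow> m < u"
    by (rule finite_sets_between[of "{z\<in>Z. z < t} \<union> {t}" "{z\<in>Z. t < z}"]) (use assms(1) in auto)
  have "t < m" using m by blast
  obtain t' where t': "match Z \<sigma> t t'" using match_ex assms by blast
  have "poly p u = 0" if "u \<in> {t..m}" for u
  proof -
    have "match Z \<sigma> u t'" unfolding match_iff
    proof (intro ballI)
      fix z assume z: "z \<in> Z"
      with \<open>t \<notin> Z\<close> consider "z < t" | "t < z" by (metis linorder_neqE)
      then show "(u < z \<longleftrightarrow> t' < \<sigma> z) \<and> (z < u \<longleftrightarrow> \<sigma> z < t')"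
      proof cases
        case 1 then show ?thesis using t' z that unfolding match_iff by force
      next
        case 2 then have "m < z" using m z by blast
        then show ?thesis using t' z that 2 unfolding match_iff by force
      qed
    qed
    then show ?thesis using s t' assms(5) by (metis sgn_0 sgn_0_0)
  qed
  then have "{t..m} \<subseteq> {x. poly p x = 0}" by blast
  then show False using poly_roots_finite[OF \<open>p \<noteq> 0\<close>] \<open>t < m\<close>
    by (meson finite_subset infinite_Icc)
qed

text \<open>Cells may be merged across points where no nonzero member of K vanishes, as no sign
  changes there. This is needed because a diagram that also covers the remainders has further
  points, at which the sign of a polynomial to be added is unknown.\<close>

lemma match_roots_only:
  assumes Z: "finite Z" "strict_mono_on Z \<sigma>"
    and s: "\<And>t t' k. match Z \<sigma> t t' \<Longrightarrow> k \<in> K \<Longrightarrow> sgn (poly (q k) t) = sgn (poly (q' k) t')"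
    and tt: "match {z\<in>Z. \<exists>k\<in>K. q k \<noteq> 0 \<and> poly (q k) z = 0} \<sigma> t t'" and k: "k \<in> K"
  shows "sgn (poly (q k) t) = sgn (poly (q' k) t')"
proof -
  define Y where "Y = {z\<in>Z. \<exists>k\<in>K. q k \<noteq> 0 \<and> poly (q k) z = 0}"
  note tt = tt[folded Y_def]
  show ?thesis
  proof (cases "t \<in> Y")
    case True
    then have "t' = \<sigma> t" "t \<in> Z" using match_point_iff[OF tt True] by (auto simp: Y_def)
    then show ?thesis using s[OF match_self[OF Z(2)] k] by blast
  next
    case False
    show ?thesis
    proof (cases "q k = 0")
      case True
      then have "q' k = 0" using poly_eq_0_of_sgn[OF Z, of "q k" "q' k"] s k by blast
      with True show ?thesis by simp
    next
      case ne: False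
      obtain t1 where t1: "match Z \<sigma> t t1" using match_ex[OF Z] by blast
      \<comment> \<open>A root in this interval would be the image of a point of Y, but t1 and t'
        lie in the same open cell of the image of Y.\<close>
      have "poly (q' k) x \<noteq> 0" if x: "min t1 t' \<le> x" "x \<le> max t1 t'" for x
      proof
        assume 0: "poly (q' k) x = 0"
        obtain z where z: "match Z \<sigma> z x" using match_ex'[OF Z] by blast
        have "poly (q k) z = 0" using s[OF z k] 0 by (metis sgn_0 sgn_0_0)
        then have "z \<in> Z" using root_in_of_sgn[OF Z, of "q k" "q' k" z] s k ne by blast
        then have "z \<in> Y" using ne k \<open>poly (q k) z = 0\<close> by (auto simp: Y_def)
        have "x = \<sigma> z" using match_point_iff[OF z \<open>z \<in> Z\<close>] by simp
        have "match Y \<sigma> t t1" using match_subset[OF t1] by (auto simp: Y_def)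
        with tt False \<open>z \<in> Y\<close> x \<open>x = \<sigma> z\<close> show False
          unfolding match_iff by (smt (verit))
      qed
      then have "sgn (poly (q' k) t1) = sgn (poly (q' k) t')" by (rule poly_sgn_const)
      with s[OF t1 k] show ?thesis by simp
    qed
  qed
qed

lemma neighbours:
  fixes Z :: "real set"
  assumes "finite Z" "t \<notin> Z" "z \<in> Z" "w \<in> Z" "z < t" "t < w"
  obtains a b where "a \<in> Z" "b \<in> Z" "a < t" "t < b" "\<And>x. x \<in> Z \<Longrightarrow> x \<le> a \<or> b \<le> x"
proof -
  let ?A = "{x\<in>Z. x < t}" and ?B = "{x\<in>Z. t < x}"
  have fin: "finite ?A" "finite ?B" using assms(1) by auto
  have "Max ?A \<in> ?A" "Min ?B \<in> ?B" using fin assms Max_in[of ?A] Min_in[of ?B] by blast+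
  moreover have "x \<le> Max ?A \<or> Min ?B \<le> x" if "x \<in> Z" for x
  proof (cases x t rule: linorder_cases)
    case less then show ?thesis using that fin Max_ge[of ?A x] by blast
  next
    case equal then show ?thesis using that assms by blast
  next
    case greater then show ?thesis using that fin Min_le[of ?B x] by blast
  qed
  ultimately show ?thesis using that[of "Max ?A" "Min ?B"] by blast
qed

lemma poly_Rolle:
  fixes p :: "real poly"
  assumes "a < b" "poly p a = 0" "poly p b = 0"
  shows "\<exists>x>a. x < b \<and> poly (pderiv p) x = 0"
  using poly_MVT[OF assms(1), of p] assms by auto

text \<open>Between neighbours a < r < b in Z the derivative keeps its sign, so p has opposite signs
  at a and b. This sign change is visible at points of Z and forces a root of the partner
  \<open>p'\<close> between \<sigma> a and \<sigma> b.\<close>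

lemma root_transfer:
  assumes Z: "finite Z" and mono: "strict_mono_on Z \<sigma>"
    and s: "\<And>z. z \<in> Z \<Longrightarrow> sgn (poly p z) = sgn (poly p' (\<sigma> z))"
    and d: "\<And>x. poly (pderiv p) x = 0 \<Longrightarrow> x \<in> Z"
    and ends: "m \<in> Z" "M \<in> Z" "m < r" "r < M"
    and r: "poly p r = (0::real)" "r \<notin> Z"
  shows "\<exists>r'. match Z \<sigma> r r' \<and> poly p' r' = 0"
proof -
  obtain a b where ab: "a \<in> Z" "b \<in> Z" "a < r" "r < b" and adj: "\<And>x. x \<in> Z \<Longrightarrow> x \<le> a \<or> b \<le> x"
    using neighbours[OF Z r(2) ends] by blast
  obtain x where x: "a < x" "x < r" "poly p r - poly p a = (r - a) * poly (pderiv p) x"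
    using poly_MVT[OF ab(3)] by blast
  obtain y where y: "r < y" "y < b" "poly p b - poly p r = (b - r) * poly (pderiv p) y"
    using poly_MVT[OF ab(4)] by blast
  have nz: "poly (pderiv p) w \<noteq> 0" if "a < w" "w < b" for w
    using d adj that by (meson not_le)
  have "sgn (poly (pderiv p) x) = sgn (poly (pderiv p) y)"
    by (rule poly_sgn_const) (use nz x y ab in auto)
  moreover have "poly (pderiv p) x \<noteq> 0" "poly (pderiv p) y \<noteq> 0"
    using nz x y ab by auto
  ultimately have "0 < poly (pderiv p) x * poly (pderiv p) y"
    by (metis sgn_mult sgn_pos zero_less_mult_iff linorder_neqE_linordered_idom
        mult_neg_neg sgn_greater sgn_less zero_less_one)
  moreover have "poly p a * poly p b = - ((r - a) * (b - r)) * (poly (pderiv p) x * poly (pderiv p) y)"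
  proof -
    have "poly p a = - ((r - a) * poly (pderiv p) x)" "poly p b = (b - r) * poly (pderiv p) y"
      using x(3) y(3) r(1) by simp_all
    then show ?thesis by (simp only: mult_minus_left mult_minus_right mult.assoc mult.left_commute)
  qed
  moreover have "(r - a) * (b - r) > 0" using ab by simp
  ultimately have "poly p a * poly p b < 0" by (simp add: mult_neg_pos mult_pos_neg)
  then have "sgn (poly p a) * sgn (poly p b) < 0" by (metis sgn_mult sgn_less)
  then have "sgn (poly p' (\<sigma> a)) * sgn (poly p' (\<sigma> b)) < 0" using s ab by simp
  then have "poly p' (\<sigma> a) * poly p' (\<sigma> b) < 0" by (metis sgn_mult sgn_less)
  moreover have "\<sigma> a < \<sigma> b" using mono ab by (simp add: strict_mono_on_less)
  ultimately obtain r' where r': "\<sigma> a < r'" "r' < \<sigma> b" "poly p' r' = 0" using poly_IVT by blast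
  have "match Z \<sigma> r r'" unfolding match_iff
  proof
    fix z assume z: "z \<in> Z"
    with adj consider "z \<le> a" | "b \<le> z" by blast
    then show "(r < z \<longleftrightarrow> r' < \<sigma> z) \<and> (z < r \<longleftrightarrow> \<sigma> z < r')"
    proof cases
      case 1
      then have "\<sigma> z \<le> \<sigma> a" using mono z ab by (simp add: strict_mono_on_less_eq)
      with 1 show ?thesis using r' ab by auto
    next
      case 2
      then have "\<sigma> b \<le> \<sigma> z" using mono z ab by (simp add: strict_mono_on_less_eq)
      with 2 show ?thesis using r' ab by auto
    qed
  qed
  with r' show ?thesis by blast
qed

text \<open>The sign at t is read off at an end of the cell of t where p does not vanish. By Rolle,
  p cannot vanish at both ends of a bounded cell without critical points; on the unbounded cells the
  ends m and M are not roots.\<close>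

lemma sgn_between_roots:
  assumes Z: "finite Z" and mono: "strict_mono_on Z \<sigma>"
    and s: "\<And>z. z \<in> Z \<Longrightarrow> sgn (poly p z) = sgn (poly p' (\<sigma> z))"
    and d: "\<And>x. poly (pderiv p) x = 0 \<Longrightarrow> x \<in> Z"
    and roots: "\<And>x. poly p x = 0 \<Longrightarrow> x \<in> Z" "\<And>x. poly p' x = 0 \<Longrightarrow> x \<in> \<sigma> ` Z"
    and ends: "m \<in> Z" "M \<in> Z" "poly p m \<noteq> 0" "poly p M \<noteq> 0"
      "\<And>z. z \<in> Z \<Longrightarrow> m \<le> z" "\<And>z. z \<in> Z \<Longrightarrow> z \<le> M"
    and tt: "match Z \<sigma> t t'"
  shows "sgn (poly p t) = sgn (poly p' (t'::real))"
proof (cases "t \<in> Z")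
  case True
  then show ?thesis using s match_point_iff[OF tt True] by simp
next
  case False
  have "\<exists>z\<in>Z. poly p z \<noteq> 0 \<and> (\<forall>x\<in>Z. \<not> (min z t < x \<and> x < max z t))"
  proof -
    consider "t < m" | "M < t" | "m < t" "t < M" using False ends(1,2) by (metis linorder_neqE)
    then show ?thesis
    proof cases
      case 1
      have "\<not> (min m t < x \<and> x < max m t)" if "x \<in> Z" for x
        using 1 ends(5)[OF that] by auto
      then show ?thesis using ends by blast
    next
      case 2
      have "\<not> (min M t < x \<and> x < max M t)" if "x \<in> Z" for x
        using 2 ends(6)[OF that] by auto
      then show ?thesis using ends by blast
    next
      case 3
      obtain a b where ab: "a \<in> Z" "b \<in> Z" "a < t" "t < b"
        and adj: "\<And>x. x \<in> Z \<Longrightarrow> x \<le> a \<or> b \<le> x"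
        using neighbours[OF Z False ends(1,2) 3] by blast
      have "poly p a \<noteq> 0 \<or> poly p b \<noteq> 0"
        using poly_Rolle[of a b p] ab adj d by (metis less_trans not_le)
      moreover have "\<not> (min a t < x \<and> x < max a t)" "\<not> (min b t < x \<and> x < max b t)" if "x \<in> Z" for x
        using ab adj[OF that] by auto
      ultimately show ?thesis using ab by blast
    qed
  qed
  then obtain z where z: "z \<in> Z" "poly p z \<noteq> 0"
    and adj: "\<And>x. x \<in> Z \<Longrightarrow> \<not> (min z t < x \<and> x < max z t)" by blast
  have "sgn (poly p t) = sgn (poly p z)"
  proof (rule poly_sgn_const)
    fix x assume x: "min t z \<le> x" "x \<le> max t z"
    show "poly p x \<noteq> 0"
    proof
      assume 0: "poly p x = 0"
      then have "x \<in> Z" using roots by blast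
      then have "x \<noteq> t" "x \<noteq> z" using False z 0 by auto
      with adj[OF \<open>x \<in> Z\<close>] x show False by (auto simp: min_def max_def split: if_splits)
    qed
  qed
  moreover have "sgn (poly p' t') = sgn (poly p' (\<sigma> z))"
  proof (rule poly_sgn_const)
    fix x assume x: "min t' (\<sigma> z) \<le> x" "x \<le> max t' (\<sigma> z)"
    show "poly p' x \<noteq> 0"
    proof
      assume 0: "poly p' x = 0"
      then obtain y where y: "y \<in> Z" "x = \<sigma> y" using roots by blast
      have "poly p y = 0" using s[OF y(1)] 0 y by (metis sgn_0 sgn_0_0)
      then have "y \<noteq> z" "y \<noteq> t" using z False y by auto
      moreover have "(y < z \<longleftrightarrow> \<sigma> y < \<sigma> z)" "(z < y \<longleftrightarrow> \<sigma> z < \<sigma> y)"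
        using y z mono by (auto simp: strict_mono_on_less)
      moreover have "(t < y \<longleftrightarrow> t' < \<sigma> y)" "(y < t \<longleftrightarrow> \<sigma> y < t')" using tt y unfolding match_iff by auto
      ultimately show False using adj[OF y(1)] x y(2)
        by (auto simp: min_def max_def split: if_splits)
    qed
  qed
  ultimately show ?thesis using s[OF z(1)] by simp
qed


section \<open>Signs near infinity and the extension of a diagram by one polynomial\<close>

lemma poly_sgn_at_top:
  fixes p :: "real poly"
  shows "\<forall>\<^sub>F x in at_top. sgn (poly p x) = sgn (lead_coeff p)"
proof -
  consider "lead_coeff p > 0" | "p = 0" | "lead_coeff p < 0"
    by (metis leading_coeff_0_iff linorder_neqE_linordered_idom)
  then show ?thesis
  proof cases
    case 1
    then obtain n where "\<forall>x\<ge>n. lead_coeff p \<le> poly p x" using poly_pinfty_gt_lc by blast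
    with 1 show ?thesis
      by (intro eventually_at_top_linorderI[of n]) (metis less_le_trans sgn_pos)
  next
    case 2 then show ?thesis by simp
  next
    case 3
    then have "lead_coeff (- p) > 0" by simp
    then obtain n where "\<forall>x\<ge>n. lead_coeff (- p) \<le> poly (- p) x" using poly_pinfty_gt_lc by blast
    then have n: "poly p x < 0" if "x \<ge> n" for x using 3 that by force
    with 3 show ?thesis by (intro eventually_at_top_linorderI[of n]) simp
  qed
qed

lemma poly_sgn_at_bot:
  fixes p :: "real poly"
  shows "\<forall>\<^sub>F x in at_top. sgn (poly p (- x)) = sgn ((- 1) ^ degree p * lead_coeff p)"
  using poly_sgn_at_top[of "pcompose p [:0, - 1:]"]
  by (simp add: poly_pcompose lead_coeff_comp mult.commute)

text \<open>The points $\pm M$ beyond all roots turn the unbounded cells into cells without roots.\<close>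

lemma add_polynomial_to_diagram:
  fixes p p' :: "real poly"
  assumes Z: "finite Z" and mono: "strict_mono_on Z \<sigma>"
    and s: "\<And>z. z \<in> Z \<Longrightarrow> sgn (poly p z) = sgn (poly p' (\<sigma> z))"
    and d: "\<And>x. poly (pderiv p) x = 0 \<Longrightarrow> x \<in> Z"
    and d': "\<And>x. poly (pderiv p') x = 0 \<Longrightarrow> x \<in> \<sigma> ` Z"
    and deg: "degree p = degree p'" "degree p \<noteq> 0"
    and lc: "sgn (lead_coeff p) = sgn (lead_coeff p')"
  obtains Y \<tau> where "finite Y" "strict_mono_on Y \<tau>" "\<And>t t'. match Y \<tau> t t' \<Longrightarrow> match Z \<sigma> t t'"
    and "\<And>t t'. match Y \<tau> t t' \<Longrightarrow> sgn (poly p t) = sgn (poly p' t')"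
proof -
  have [simp]: "p \<noteq> 0" "p' \<noteq> 0" using deg by auto
  define S where "S = Z \<union> \<sigma> ` Z \<union> {x. poly p x = 0} \<union> {x. poly p' x = 0}"
  have "finite S" using Z by (simp add: S_def poly_roots_finite)
  then have "\<forall>\<^sub>F M in at_top. \<forall>x\<in>S. \<bar>x\<bar> < M"
    by (simp add: eventually_ball_finite_distrib eventually_gt_at_top)
  then have "\<forall>\<^sub>F M in at_top. (\<forall>x\<in>S. \<bar>x\<bar> < M) \<and> sgn (poly p M) = sgn (lead_coeff p) \<and>
      sgn (poly p' M) = sgn (lead_coeff p') \<and> sgn (poly p (- M)) = sgn ((- 1) ^ degree p * lead_coeff p) \<and>
      sgn (poly p' (- M)) = sgn ((- 1) ^ degree p' * lead_coeff p') \<and> (0::real) < M"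
    by (intro eventually_conj poly_sgn_at_top poly_sgn_at_bot eventually_gt_at_top)
  then obtain M where M: "\<And>x. x \<in> S \<Longrightarrow> \<bar>x\<bar> < M" "0 < M"
    and pM: "sgn (poly p M) = sgn (lead_coeff p)" "sgn (poly p' M) = sgn (lead_coeff p')"
    "sgn (poly p (- M)) = sgn ((- 1) ^ degree p * lead_coeff p)"
    "sgn (poly p' (- M)) = sgn ((- 1) ^ degree p' * lead_coeff p')"
    unfolding eventually_at_top_linorder by blast
  have Mbd: "- M < x \<and> x < M" if "x \<in> S" for x using M(1)[OF that] by auto
  define X where "X = Z \<union> {- M, M}"
  \<comment> \<open>\<rho> extends \<sigma> by fixing -M and M. There the signs are those of the
    leading terms, which agree by the assumptions on degree and leading coefficient.\<close>
  define \<rho> where "\<rho> x = (if x \<in> Z then \<sigma> x else x)" for x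
  have X: "finite X" "- M \<in> X" "M \<in> X" using Z by (auto simp: X_def)
  have \<rho>Z: "\<rho> z = \<sigma> z" if "z \<in> Z" for z using that by (simp add: \<rho>_def)
  have ZS: "z \<in> S" "\<sigma> z \<in> S" if "z \<in> Z" for z using that by (auto simp: S_def)
  have nM: "M \<notin> Z" "- M \<notin> Z" using Mbd ZS by force+
  have \<rho>M: "\<rho> M = M" "\<rho> (- M) = - M" using nM by (auto simp: \<rho>_def)
  have monoX: "strict_mono_on X \<rho>"
  proof (rule strict_mono_onI)
    fix x y assume xy: "x \<in> X" "y \<in> X" "x < y"
    have b: "- M \<le> z \<and> z \<le> M" if "z \<in> X" for z
      using that Mbd ZS M(2) by (fastforce simp: X_def)
    show "\<rho> x < \<rho> y"
    proof (cases "x \<in> Z \<and> y \<in> Z")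
      case True
      then show ?thesis using mono xy by (simp add: \<rho>Z strict_mono_on_less)
    next
      case False
      then consider "x = - M" "y = M" | "x = - M" "y \<in> Z" | "x \<in> Z" "y = M"
        using xy b[OF xy(1)] b[OF xy(2)] M(2) by (auto simp: X_def)
      then show ?thesis
        by cases (use M(2) Mbd[OF ZS(2)] in \<open>auto simp: \<rho>M \<rho>Z\<close>)
    qed
  qed
  have sX: "sgn (poly p z) = sgn (poly p' (\<rho> z))" if z: "z \<in> X" for z
  proof -
    consider "z \<in> Z" | "z = M" | "z = - M" using z by (auto simp: X_def)
    then show ?thesis
      by cases (use s pM lc deg in \<open>auto simp: \<rho>M \<rho>Z sgn_mult\<close>)
  qed
  have transfer: "\<exists>r'. match X \<rho> r r' \<and> poly p' r' = 0" if r: "poly p r = 0" for r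
  proof (cases "r \<in> X")
    case True
    then have "poly p' (\<rho> r) = 0" using sX r by (metis sgn_0 sgn_0_0)
    with True match_self[OF monoX] show ?thesis by blast
  next
    case False
    have "r \<in> S" using r by (simp add: S_def)
    then show ?thesis
      using root_transfer[OF X(1) monoX sX _ X(2,3) _ _ r False] d Mbd by (auto simp: X_def)
  qed
  have transfer': "\<exists>r. match X \<rho> r r' \<and> poly p r = 0" if r': "poly p' r' = 0" for r'
  proof (cases "r' \<in> \<rho> ` X")
    case True
    then obtain z where z: "z \<in> X" "r' = \<rho> z" by blast
    then have "poly p z = 0" using sX r' by (metis sgn_0 sgn_0_0)
    with z match_self[OF monoX] show ?thesis by blast
  next
    case False
    have inj: "inj_on \<rho> X" using monoX by (rule strict_mono_on_imp_inj_on)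
    have "\<exists>r. match (\<rho> ` X) (inv_into X \<rho>) r' r \<and> poly p r = 0"
    proof (rule root_transfer)
      show "strict_mono_on (\<rho> ` X) (inv_into X \<rho>)" using monoX by (rule strict_mono_on_inv_into)
      show "sgn (poly p' z) = sgn (poly p (inv_into X \<rho> z))" if "z \<in> \<rho> ` X" for z
        using that sX inj by (auto simp: inv_into_f_f)
      show "x \<in> \<rho> ` X" if "poly (pderiv p') x = 0" for x
        using d'[OF that] \<rho>Z by (force simp: X_def)
      show "- M \<in> \<rho> ` X" "M \<in> \<rho> ` X" using \<rho>M X by (metis imageI)+
      have "r' \<in> S" using r' by (simp add: S_def)
      then show "- M < r'" "r' < M" using Mbd by blast+
    qed (use X r' False in auto)
    then show ?thesis using match_inv_into[OF monoX] by blast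
  qed
  have uniq: "r = t" if "match X \<rho> r u" "match X \<rho> t u" "poly p r = 0" "poly p t = 0" for r t u
  proof -
    have False if rt: "match X \<rho> r u" "match X \<rho> t u" "poly p r = 0" "poly p t = 0" "r < t" for r t u
    proof -
      obtain x where "r < x" "x < t" "poly (pderiv p) x = 0" using poly_Rolle rt by blast
      then have "x \<in> X" using d by (simp add: X_def)
      with rt \<open>r < x\<close> \<open>x < t\<close> show False unfolding match_iff by (meson less_asym)
    qed
    with that show ?thesis by (metis linorder_neqE)
  qed
  \<comment> \<open>By Rolle a cell contains at most one root of \<open>p'\<close>, so the choice
    made in \<tau> below reaches every root of \<open>p'\<close>.\<close>
  have uniq': "r = t" if "match X \<rho> u r" "match X \<rho> u t" "poly p' r = 0" "poly p' t = 0" for r t u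
  proof -
    have False if rt: "match X \<rho> u r" "match X \<rho> u t" "poly p' r = 0" "poly p' t = 0" "r < t" for r t u
    proof -
      obtain x where x: "r < x" "x < t" "poly (pderiv p') x = 0" using poly_Rolle rt by blast
      then obtain z where "z \<in> X" "x = \<rho> z" using d'[OF x(3)] \<rho>Z by (force simp: X_def)
      with rt x show False unfolding match_iff by (meson less_asym)
    qed
    with that show ?thesis by (metis linorder_neqE)
  qed
  define R where "R = {r. poly p r = 0}"
  define Y where "Y = X \<union> R"
  define \<tau> where "\<tau> y = (if y \<in> X then \<rho> y else SOME r'. match X \<rho> y r' \<and> poly p' r' = 0)" for y
  have \<tau>R: "match X \<rho> r (\<tau> r) \<and> poly p' (\<tau> r) = 0" if "r \<in> R" for r
  proof (cases "r \<in> X")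
    case True
    then have "poly p' (\<rho> r) = 0" using sX that by (metis R_def mem_Collect_eq sgn_0 sgn_0_0)
    with True show ?thesis using match_self[OF monoX] by (simp add: \<tau>_def)
  next
    case False
    then show ?thesis using someI_ex[OF transfer, of r] that by (simp add: \<tau>_def R_def)
  qed
  have \<tau>X: "\<tau> x = \<rho> x" if "x \<in> X" for x using that by (simp add: \<tau>_def)
  have \<tau>Y: "match X \<rho> y (\<tau> y)" if "y \<in> Y" for y
    using that \<tau>R match_self[OF monoX] \<tau>X by (auto simp: Y_def)
  have finY: "finite Y" using X by (simp add: Y_def R_def poly_roots_finite)
  have monoY: "strict_mono_on Y \<tau>"
  proof (rule strict_mono_onI)
    fix x y assume xy: "x \<in> Y" "y \<in> Y" "x < y"
    \<comment> \<open>Either some point of X lies between x and y, ends included, or both are roots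
      of p and Rolle supplies such a point.\<close>
    show "\<tau> x < \<tau> y"
    proof (cases "\<exists>z\<in>X. x \<le> z \<and> z \<le> y")
      case True
      then obtain z where z: "z \<in> X" "x \<le> z" "z \<le> y" by blast
      have "\<tau> x \<le> \<rho> z" "\<rho> z \<le> \<tau> y"
        using \<tau>Y[OF xy(1)] \<tau>Y[OF xy(2)] z unfolding match_iff by (meson not_le)+
      moreover have "\<tau> x \<noteq> \<rho> z \<or> \<tau> y \<noteq> \<rho> z"
        using match_point_iff[OF \<tau>Y[OF xy(1)] z(1)] match_point_iff[OF \<tau>Y[OF xy(2)] z(1)] xy(3) by auto
      ultimately show ?thesis by linarith
    next
      case False
      then have R: "x \<in> R" "y \<in> R" using xy by (auto simp: Y_def)
      then obtain z where "x < z" "z < y" "poly (pderiv p) z = 0"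
        using poly_Rolle[OF xy(3)] by (auto simp: R_def)
      then show ?thesis using False d by (force simp: X_def)
    qed
  qed
  have YX: "match X \<rho> t t'" if "match Y \<tau> t t'" for t t'
  proof -
    have "match X \<tau> t t'" using match_subset[OF that] by (simp add: Y_def)
    then show ?thesis using match_cong[of X \<tau> \<rho>] \<tau>X by blast
  qed
  have YZ: "match Z \<sigma> t t'" if "match Y \<tau> t t'" for t t'
  proof -
    have "match Z \<rho> t t'" by (rule match_subset[OF YX[OF that]]) (auto simp: X_def)
    then show ?thesis using match_cong[of Z \<rho> \<sigma>] \<rho>Z by blast
  qed
  have sY: "sgn (poly p z) = sgn (poly p' (\<tau> z))" if "z \<in> Y" for z
    using that sX \<tau>X \<tau>R by (auto simp: Y_def R_def)
  have "sgn (poly p t) = sgn (poly p' t')" if "match Y \<tau> t t'" for t t'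
  proof (rule sgn_between_roots[OF finY monoY sY _ _ _ _ _ _ _ _ _ that])
    show "- M \<in> Y" "M \<in> Y" using X by (auto simp: Y_def)
    show "poly p (- M) \<noteq> 0" "poly p M \<noteq> 0" using Mbd[of M] Mbd[of "- M"] by (auto simp: S_def)
    show "- M \<le> z" "z \<le> M" if "z \<in> Y" for z
      using that Mbd[of z] ZS(1)[of z] M(2) by (auto simp: Y_def X_def R_def S_def)
    show "x \<in> \<tau> ` Y" if x: "poly p' x = 0" for x
    proof -
      obtain r where r: "match X \<rho> r x" "poly p r = 0" using transfer' x by blast
      then have "r \<in> R" by (simp add: R_def)
      then have "x = \<tau> r" using uniq'[OF r(1) _ x] \<tau>R by blast
      then show ?thesis using \<open>r \<in> R\<close> by (auto simp: Y_def)
    qed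
  qed (use d in \<open>auto simp: Y_def X_def R_def\<close>)
  then show ?thesis using that finY monoY YZ by blast
qed


text \<open>d is a formal degree: the coefficient of index d may vanish at particular x, and the
  elimination branches on whether it does.\<close>

definition poly_family :: "('a::euclidean_space \<Rightarrow> real poly) \<Rightarrow> nat \<Rightarrow> bool" where
  "poly_family P d \<longleftrightarrow>
     (\<forall>i. real_polynomial_function (\<lambda>x. coeff (P x) i)) \<and> (\<forall>x. degree (P x) \<le> d)"

text \<open>The reduction of \<open>P\<close> modulo \<open>Q\<close>, scaled by a square so that it has the sign of \<open>P\<close> at the
  roots of \<open>Q\<close>; no further division is necessary, as the degree is already smaller than \<open>m\<close>.\<close>

definition reduct :: "('a \<Rightarrow> real poly) \<Rightarrow> nat \<Rightarrow> ('a \<Rightarrow> real poly) \<times> nat \<Rightarrow> ('a \<Rightarrow> real poly) \<times> nat" where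
  "reduct P m = (\<lambda>(Q, d). (\<lambda>x. smult ((coeff (Q x) d)\<^sup>2) (P x) -
      smult (coeff (Q x) d * coeff (P x) m) (monom 1 (m - d) * Q x), m - 1))"

text \<open>Where the formal leading coefficient vanishes, this is the same polynomial with the
  formal degree lowered by one.\<close>

definition truncate :: "('a \<Rightarrow> real poly) \<times> nat \<Rightarrow> ('a \<Rightarrow> real poly) \<times> nat" where
  "truncate = (\<lambda>(Q, d). (\<lambda>x. Q x - monom (coeff (Q x) d) d, d - 1))"

lemma degree_less_of_coeff_0:
  assumes "degree p \<le> m" "coeff p m = 0" "0 < m"
  shows "degree p \<le> m - 1"
  using assms by (metis Suc_pred' leI le_antisym le_simps(2) less_Suc_eq_le eq_zero_or_degree_less
      degree_0 less_imp_le zero_le)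

lemma poly_family_truncate:
  assumes "poly_family Q d" "0 < d"
  shows "poly_family (fst (truncate (Q, d))) (d - 1)"
proof -
  have "real_polynomial_function (\<lambda>x. coeff (Q x - monom (coeff (Q x) d) d) i)" for i
    using assms by (cases "d = i") (auto simp: poly_family_def coeff_monom)
  moreover have "degree (Q x - monom (coeff (Q x) d) d) \<le> d - 1" for x
    by (rule degree_less_of_coeff_0)
      (use assms in \<open>auto simp: poly_family_def coeff_monom degree_monom_le intro!: degree_diff_le\<close>)
  ultimately show ?thesis by (simp add: poly_family_def truncate_def)
qed

lemma poly_family_reduct:
  assumes P: "poly_family P m" and Q: "poly_family Q d" and "d \<le> m" "0 < m"
  shows "poly_family (fst (reduct P m (Q, d))) (m - 1)"
proof -
  let ?R = "\<lambda>x. smult ((coeff (Q x) d)\<^sup>2) (P x) -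
      smult (coeff (Q x) d * coeff (P x) m) (monom 1 (m - d) * Q x)"
  have "real_polynomial_function (\<lambda>x. coeff (?R x) i)" for i
    using P Q by (cases "i < m - d")
      (auto simp: poly_family_def coeff_monom_mult intro!: real_polynomial_function_diff
          real_polynomial_function.intros(4) real_polynomial_function_power)
  moreover have "degree (?R x) \<le> m - 1" for x
  proof (rule degree_less_of_coeff_0)
    have "degree (monom 1 (m - d) * Q x) \<le> (m - d) + d"
      using Q by (intro order.trans[OF degree_mult_le] add_mono degree_monom_le) (simp add: poly_family_def)
    then show "degree (?R x) \<le> m" using P \<open>d \<le> m\<close>
      by (intro degree_diff_le order.trans[OF degree_smult_le]) (auto simp: poly_family_def)
    show "coeff (?R x) m = 0" using \<open>d \<le> m\<close> by (simp add: coeff_monom_mult power2_eq_square)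
  qed fact
  ultimately show ?thesis by (simp add: poly_family_def reduct_def)
qed

lemma poly_family_pderiv:
  assumes "poly_family P m"
  shows "poly_family (\<lambda>x. pderiv (P x)) (m - 1)"
  using assms by (auto simp: poly_family_def coeff_pderiv degree_pderiv intro: diff_le_mono)

text \<open>The idea of Cohen and Hoermander: at a root of a member of K with nonzero leading
  coefficient, P has the sign of its reduct modulo this member. So the signs of P are known at all
  roots of K, among them the critical points of P, and this determines the diagram with P
  added.\<close>

lemma same_sign_diagram_step:
  fixes P :: "'a::euclidean_space \<Rightarrow> real poly" and F :: "(('a \<Rightarrow> real poly) \<times> nat) set"
  assumes P: "poly_family P m" "0 < m" "coeff (P x) m \<noteq> 0"
      "sgn (coeff (P x) m) = sgn (coeff (P x') m)"
    and K_def: "K = insert (\<lambda>x. pderiv (P x), m - 1) F"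
    and lc: "\<And>Q d. (Q, d) \<in> F \<Longrightarrow> poly_family Q d \<and> sgn (coeff (Q x) d) = sgn (coeff (Q x') d)"
      "\<And>Q d. (Q, d) \<in> F \<Longrightarrow> 0 < d \<Longrightarrow> coeff (Q x) d \<noteq> 0"
    and ssd: "same_sign_diagram (K \<union> reduct P m ` K) (\<lambda>Q. fst Q x) (\<lambda>Q. fst Q x')"
  shows "same_sign_diagram (insert (P, m) F) (\<lambda>Q. fst Q x) (\<lambda>Q. fst Q x')"
proof -
  obtain Z \<sigma> where Z: "finite Z" "strict_mono_on Z \<sigma>"
    and s: "\<And>t t' k. match Z \<sigma> t t' \<Longrightarrow> k \<in> K \<union> reduct P m ` K \<Longrightarrow>
      sgn (poly (fst k x) t) = sgn (poly (fst k x') t')"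
    using ssd unfolding same_sign_diagram_def by blast
  \<comment> \<open>Only roots of members of K are kept, since only there the reducts give the sign
    of P.\<close>
  define Y where "Y = {z\<in>Z. \<exists>k\<in>K. fst k x \<noteq> 0 \<and> poly (fst k x) z = 0}"
  have Y: "finite Y" "strict_mono_on Y \<sigma>" using Z by (auto simp: Y_def strict_mono_on_def)
  have P': "coeff (P x') m \<noteq> 0" using P by (metis sgn_0 sgn_0_0)
  have deg: "degree (P x) = m" "degree (P x') = m"
    using P P' by (meson antisym le_degree poly_family_def)+
  have signs: "sgn (poly (P x) z) = sgn (poly (P x') (\<sigma> z))" if z: "z \<in> Y" for z
  proof -
    obtain Q d where Q: "(Q, d) \<in> K" "Q x \<noteq> 0" "poly (Q x) z = 0" "z \<in> Z"
      using z unfolding Y_def by auto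
    have m: "match Z \<sigma> z (\<sigma> z)" using match_self Z Q by blast
    have Q': "poly (Q x') (\<sigma> z) = 0" using s[OF m UnI1[OF Q(1)]] Q(3) by (simp add: sgn_0_0)
    have b: "sgn (coeff (Q x) d) = sgn (coeff (Q x') d)" "coeff (Q x) d \<noteq> 0"
    proof -
      have "sgn (coeff (Q x) d) = sgn (coeff (Q x') d) \<and> coeff (Q x) d \<noteq> 0"
      proof (cases "(Q, d) \<in> F")
        case True
        show ?thesis
        proof (cases "d = 0")
          case d: True
          then have "degree (Q x) = 0" using lc(1)[OF True] by (auto simp: poly_family_def)
          then have "coeff (Q x) 0 \<noteq> 0" using Q(2) by (metis leading_coeff_0_iff)
          then show ?thesis using lc(1)[OF True] d by auto
        next
          case False
          then show ?thesis using lc True by auto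
        qed
      next
        case False
        then have "Q = (\<lambda>x. pderiv (P x))" "d = m - 1" using Q(1) by (auto simp: K_def)
        then show ?thesis using P by (auto simp: coeff_pderiv sgn_mult)
      qed
      then show "sgn (coeff (Q x) d) = sgn (coeff (Q x') d)" "coeff (Q x) d \<noteq> 0" by auto
    qed
    then have b': "coeff (Q x') d \<noteq> 0" by (metis sgn_0 sgn_0_0)
    have "sgn (poly (fst (reduct P m (Q, d)) x) z) = sgn (poly (fst (reduct P m (Q, d)) x') (\<sigma> z))"
      using s[OF m UnI2[OF imageI[OF Q(1)]]] .
    moreover have "(sgn (coeff (Q x) d))\<^sup>2 = 1" "(sgn (coeff (Q x') d))\<^sup>2 = 1"
      using b(2) b' by (simp_all add: sgn_if)
    ultimately show ?thesis using Q(3) Q' by (simp add: reduct_def sgn_mult)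
  qed
  have pd: "(\<lambda>x. pderiv (P x), m - 1) \<in> K" by (simp add: K_def)
  have spd: "sgn (poly (pderiv (P x)) t) = sgn (poly (pderiv (P x')) t')" if "match Z \<sigma> t t'" for t t'
    using s[OF that UnI1[OF pd]] by simp
  have "pderiv (P x) \<noteq> 0" using deg P(2) by (simp add: pderiv_eq_0_iff)
  have pd1: "t \<in> Y" if "poly (pderiv (P x)) t = 0" for t
    using root_in_of_sgn[OF Z spd \<open>pderiv (P x) \<noteq> 0\<close> that] that \<open>pderiv (P x) \<noteq> 0\<close> pd
    by (force simp: Y_def)
  have pd2: "u \<in> \<sigma> ` Y" if "poly (pderiv (P x')) u = 0" for u
  proof -
    obtain t where t: "match Z \<sigma> t u" using match_ex'[OF Z] by blast
    then have "poly (pderiv (P x)) t = 0" using spd[OF t] that by (simp add: sgn_0_0)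
    then have "t \<in> Y" by (rule pd1)
    then show ?thesis using match_point_iff[OF t] by (auto simp: Y_def)
  qed
  obtain W \<tau> where W: "finite W" "strict_mono_on W \<tau>" "\<And>t t'. match W \<tau> t t' \<Longrightarrow> match Y \<sigma> t t'"
    and sW: "\<And>t t'. match W \<tau> t t' \<Longrightarrow> sgn (poly (P x) t) = sgn (poly (P x') t')"
    by (rule add_polynomial_to_diagram[OF Y signs pd1 pd2]) (use deg P in auto)
  \<comment> \<open>Passing from Z to Y has lost nothing about the members of K, by
    \<open>match_roots_only\<close>.\<close>
  have "sgn (poly (fst k x) t) = sgn (poly (fst k x') t')"
    if "match W \<tau> t t'" "k \<in> insert (P, m) F" for t t' k
  proof (cases "k \<in> K")
    case True
    show ?thesis
      by (rule match_roots_only[OF Z, of K "\<lambda>Q. fst Q x" "\<lambda>Q. fst Q x'"])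
        (use s W(3)[OF that(1)] True in \<open>auto simp: Y_def\<close>)
  next
    case False
    then show ?thesis using that sW by (auto simp: K_def)
  qed
  then show ?thesis using W unfolding same_sign_diagram_def by blast
qed


lemma truncate_eq: "coeff (Q x) d = 0 \<Longrightarrow> fst (truncate (Q, d)) x = Q x"
  by (simp add: truncate_def)

lemma same_sign_diagram_const:
  assumes "\<And>k. k \<in> K \<Longrightarrow> degree (q k) = 0 \<and> degree (q' k) = 0 \<and> sgn (coeff (q k) 0) = sgn (coeff (q' k) 0)"
  shows "same_sign_diagram K q q'"
proof -
  have "sgn (poly (q k) t) = sgn (poly (q' k) t')" if k: "k \<in> K" for k t t'
  proof -
    obtain a b where "q k = [:a:]" "q' k = [:b:]" using assms[OF k] degree_eq_zeroE by metis
    then show ?thesis using assms[OF k] by simp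
  qed
  then show ?thesis
    unfolding same_sign_diagram_def by (intro exI[of _ "{}"]) (auto simp: strict_mono_on_def)
qed

text \<open>Induction on the multiset of formal degrees. At a given x either some formal leading
  coefficient vanishes and its polynomial is truncated, or a polynomial of maximal degree is
  replaced by its derivative and reducts. The case depends on x only through the signs of the
  leading coefficients, so G collects these together with the polynomials from all branches.\<close>

theorem sign_diagram_finitely_determined:
  fixes F :: "(('a::euclidean_space \<Rightarrow> real poly) \<times> nat) multiset"
  assumes "\<And>P d. (P, d) \<in># F \<Longrightarrow> poly_family P d"
  shows "\<exists>G. finite G \<and> (\<forall>g\<in>G. real_polynomial_function g) \<and>
    (\<forall>x x'. (\<forall>g\<in>G. sgn (g x) = sgn (g x')) \<longrightarrow>
      same_sign_diagram (set_mset F) (\<lambda>Q. fst Q x) (\<lambda>Q. fst Q x'))"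
proof -
  have "wf (inv_image (mult less_than) (image_mset (snd :: ('a \<Rightarrow> real poly) \<times> nat \<Rightarrow> nat)))"
    by (simp add: wf_mult)
  from this assms show ?thesis
  proof (induction F rule: wf_induct_rule)
    case (less F)
    note 1 = less
    let ?det = "\<lambda>F G. finite G \<and> (\<forall>g\<in>G. real_polynomial_function g) \<and>
      (\<forall>x x'. (\<forall>g\<in>G. sgn (g x) = sgn (g x')) \<longrightarrow>
        same_sign_diagram (set_mset F) (\<lambda>Q. fst Q x) (\<lambda>Q. fst Q x'))"
    \<comment> \<open>The multiset order allows one member to be traded for any number of members of
      smaller formal degree.\<close>
    have smaller: "\<exists>G. ?det (E + (F - {#q#})) G" if q: "q \<in># F"
      and E: "\<And>P d. (P, d) \<in># E \<Longrightarrow> poly_family P d \<and> d < snd q" for q E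
    proof (rule 1)
      have "(image_mset snd (F - {#q#}) + image_mset snd E, image_mset snd (F - {#q#}) + {#snd q#})
          \<in> mult less_than"
        by (rule one_step_implies_mult) (use E in auto)
      moreover have "image_mset snd F = image_mset snd (F - {#q#}) + {#snd q#}"
        using q by (metis add_mset_add_single image_mset_add_mset insert_DiffM)
      ultimately show "(E + (F - {#q#}), F) \<in> inv_image (mult less_than) (image_mset snd)"
        by (simp add: union_commute)
    next
      fix P d assume "(P, d) \<in># E + (F - {#q#})"
      then show "poly_family P d" using E 1(2) by (auto dest: in_diffD)
    qed
    define L where "L = (\<lambda>(Q, d) x. coeff (Q x) d) ` set_mset F"
    have L: "finite L" "\<And>g. g \<in> L \<Longrightarrow> real_polynomial_function g"
      using 1(2) by (auto simp: L_def poly_family_def)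
    have Lsgn: "sgn (coeff (Q x) d) = sgn (coeff (Q x') d)"
      if "\<forall>g\<in>L. sgn (g x) = sgn (g x')" "(Q, d) \<in># F" for Q d x x'
      using that(1)[unfolded L_def, rule_format, OF imageI[OF that(2)]] by simp
    show ?case
    proof (cases "\<exists>Q d. (Q, d) \<in># F \<and> 0 < d")
      case False
      have "same_sign_diagram (set_mset F) (\<lambda>Q. fst Q x) (\<lambda>Q. fst Q x')"
        if "\<forall>g\<in>L. sgn (g x) = sgn (g x')" for x x'
      proof (rule same_sign_diagram_const)
        fix k assume k: "k \<in># F"
        obtain Q d where [simp]: "k = (Q, d)" by (cases k)
        have "d = 0" using False k by auto
        then show "degree (fst k x) = 0 \<and> degree (fst k x') = 0 \<and>
            sgn (coeff (fst k x) 0) = sgn (coeff (fst k x') 0)"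
          using 1(2)[of Q d] k Lsgn[OF that, of Q d] by (auto simp: poly_family_def)
      qed
      with L show ?thesis by (intro exI[of _ L]) blast
    next
      case True
      \<comment> \<open>The degree is maximal so that every other member can serve as
        divisor.\<close>
      define m where "m = Max (snd ` set_mset F)"
      have mmax: "d \<le> m" if "(Q, d) \<in># F" for Q d
        using that by (force simp: m_def intro!: Max_ge)
      have "m \<in> snd ` set_mset F" unfolding m_def using True by (intro Max_in) auto
      then obtain P where P: "(P, m) \<in># F" by auto
      have "0 < m" using True mmax by fastforce
      define H where "H = F - {#(P, m)#}"
      have F: "F = add_mset (P, m) H" using P by (simp add: H_def)
      define K where "K = add_mset (\<lambda>x. pderiv (P x), m - 1) H"
      define E where "E = add_mset (\<lambda>x. pderiv (P x), m - 1) (image_mset (reduct P m) K)"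
      have Kd: "poly_family Q d \<and> d \<le> m" if "(Q, d) \<in># K" for Q d
      proof (cases "(Q, d) \<in># H")
        case True
        then have "(Q, d) \<in># F" using F by simp
        then show ?thesis using 1(2) mmax by blast
      next
        case False
        then have "Q = (\<lambda>x. pderiv (P x))" "d = m - 1" using that by (auto simp: K_def)
        then show ?thesis using poly_family_pderiv 1(2)[OF P] by auto
      qed
      have "\<exists>G. ?det (E + H) G" unfolding H_def
      proof (rule smaller[OF P])
        fix Q d assume Q: "(Q, d) \<in># E"
        show "poly_family Q d \<and> d < snd (P, m)"
        proof (cases "(Q, d) = (\<lambda>x. pderiv (P x), m - 1)")
          case True
          then show ?thesis using poly_family_pderiv 1(2)[OF P] \<open>0 < m\<close> by auto
        next
          case False
          then obtain R e where R: "(R, e) \<in># K" "(Q, d) = reduct P m (R, e)" using Q by (auto simp: E_def)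
          then have "d = m - 1" "Q = fst (reduct P m (R, e))" by (auto simp: reduct_def)
          then show ?thesis using poly_family_reduct[OF 1(2)[OF P]] Kd[OF R(1)] \<open>0 < m\<close> by auto
        qed
      qed
      then obtain G1 where G1: "?det (E + H) G1" by blast
      have "\<forall>q\<in>{q. q \<in># F \<and> 0 < snd q}. \<exists>G. ?det ({#truncate q#} + (F - {#q#})) G"
      proof
        fix q assume q: "q \<in> {q. q \<in># F \<and> 0 < snd q}"
        show "\<exists>G. ?det ({#truncate q#} + (F - {#q#})) G"
        proof (rule smaller)
          fix Q d assume "(Q, d) \<in># {#truncate q#}"
          moreover obtain R e where "q = (R, e)" by (cases q)
          ultimately show "poly_family Q d \<and> d < snd q"
            using q 1(2)[of R e] poly_family_truncate[of R e] by (auto simp: truncate_def)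
        qed (use q in auto)
      qed
      from bchoice[OF this] obtain G2
        where *: "\<forall>q\<in>{q. q \<in># F \<and> 0 < snd q}. ?det ({#truncate q#} + (F - {#q#})) (G2 q)"
        by (rule exE)
      have G2: "?det ({#truncate q#} + (F - {#q#})) (G2 q)" if "q \<in># F" "0 < snd q" for q
        by (rule bspec[OF *]) (use that in simp)
      define G where "G = L \<union> G1 \<union> (\<Union>q\<in>{q. q \<in># F \<and> 0 < snd q}. G2 q)"
      have "same_sign_diagram (set_mset F) (\<lambda>Q. fst Q x) (\<lambda>Q. fst Q x')"
        if G: "\<forall>g\<in>G. sgn (g x) = sgn (g x')" for x x'
      proof (cases "\<exists>Q d. (Q, d) \<in># F \<and> 0 < d \<and> coeff (Q x) d = 0")
        case True
        then obtain Q d where Q: "(Q, d) \<in># F" "0 < d" "coeff (Q x) d = 0" by blast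
        have Ls: "\<forall>g\<in>L. sgn (g x) = sgn (g x')" using G unfolding G_def by blast
        have "sgn (coeff (Q x) d) = sgn (coeff (Q x') d)" by (rule Lsgn[OF Ls Q(1)])
        then have Q': "coeff (Q x') d = 0" using Q(3) by (simp add: sgn_0_0)
        have "\<forall>g\<in>G2 (Q, d). sgn (g x) = sgn (g x')" 
        proof -
          have "(Q, d) \<in> {q. q \<in># F \<and> 0 < snd q}" using Q by simp
          then have "G2 (Q, d) \<subseteq> G" unfolding G_def by blast
          then show ?thesis using G by blast
        qed
        then have *: "same_sign_diagram (set_mset ({#truncate (Q, d)#} + (F - {#(Q, d)#})))
            (\<lambda>Q. fst Q x) (\<lambda>Q. fst Q x')" using G2[OF Q(1)] Q(2) by simp
        show ?thesis
        proof (rule same_sign_diagram_reindex[OF *])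
          fix k assume k: "k \<in># F"
          show "\<exists>l\<in>set_mset ({#truncate (Q, d)#} + (F - {#(Q, d)#})). fst k x = fst l x \<and> fst k x' = fst l x'"
          proof (cases "k = (Q, d)")
            case True
            then show ?thesis using Q(3) Q' by (intro bexI[of _ "truncate (Q, d)"]) (auto simp: truncate_eq)
          next
            case False
            then have "k \<in># F - {#(Q, d)#}" using k using False Q(1) by (metis insert_DiffM insert_noteq_member)
            then show ?thesis by auto
          qed
        qed
      next
        case False
        have "\<forall>g\<in>G1. sgn (g x) = sgn (g x')" using G unfolding G_def by blast
        then have *: "same_sign_diagram (set_mset (E + H)) (\<lambda>Q. fst Q x) (\<lambda>Q. fst Q x')"
          using G1 by blast
        have Ls: "\<forall>g\<in>L. sgn (g x) = sgn (g x')" using G unfolding G_def by blast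
        have "same_sign_diagram (insert (P, m) (set_mset H)) (\<lambda>Q. fst Q x) (\<lambda>Q. fst Q x')"
        proof (rule same_sign_diagram_step)
          show "same_sign_diagram (set_mset K \<union> reduct P m ` set_mset K) (\<lambda>Q. fst Q x) (\<lambda>Q. fst Q x')"
            by (rule same_sign_diagram_reindex[OF *]) (auto simp: E_def K_def)
          show "set_mset K = insert (\<lambda>x. pderiv (P x), m - 1) (set_mset H)" by (simp add: K_def)
          show "coeff (P x) m \<noteq> 0" using False P \<open>0 < m\<close> by blast
          show "coeff (Q x) d \<noteq> 0" if "(Q, d) \<in># H" "0 < d" for Q d using False that F by auto
          show "poly_family Q d \<and> sgn (coeff (Q x) d) = sgn (coeff (Q x') d)" if "(Q, d) \<in># H" for Q d
            using 1(2)[of Q d] Lsgn[OF Ls, of Q d] that F by auto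
        qed (use 1(2)[OF P] \<open>0 < m\<close> Lsgn[OF Ls P] in auto)
        then show ?thesis by (simp add: F)
      qed
      moreover have "finite G" "\<forall>g\<in>G. real_polynomial_function g"
      proof -
        have "finite {q. q \<in># F \<and> 0 < snd q}" by simp
        moreover have "finite (G2 q) \<and> (\<forall>g\<in>G2 q. real_polynomial_function g)"
          if "q \<in> {q. q \<in># F \<and> 0 < snd q}" for q using G2 that by blast
        ultimately show "finite G" "\<forall>g\<in>G. real_polynomial_function g"
          unfolding G_def using L G1 by blast+
      qed
      ultimately show ?thesis by blast
    qed
  qed
qed

section \<open>Semialgebraic sets\<close>

lemma rpf_const: "real_polynomial_function (\<lambda>x. c)"
  by (rule real_polynomial_function.intros)

lemma rpf_add: "real_polynomial_function f \<Longrightarrow> real_polynomial_function g \<Longrightarrow>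
    real_polynomial_function (\<lambda>x. f x + g x)"
  by (rule real_polynomial_function.intros)

lemma rpf_mult: "real_polynomial_function f \<Longrightarrow> real_polynomial_function g \<Longrightarrow>
    real_polynomial_function (\<lambda>x. f x * g x)"
  by (rule real_polynomial_function.intros)

lemma semialgebraic_gt: "real_polynomial_function p \<Longrightarrow> real_polynomial_function q \<Longrightarrow>
    semialgebraic {x. p x < q x}"
  using semialgebraic.pos[of "\<lambda>x. q x - p x"] by (auto intro: real_polynomial_function_diff)

lemma semialgebraic_not: "semialgebraic {x. P x} \<Longrightarrow> semialgebraic {x. \<not> P x}"
  using semialgebraic.Compl[of "{x. P x}"] by (simp add: Collect_neg_eq)

lemma semialgebraic_conj: "semialgebraic {x. P x} \<Longrightarrow> semialgebraic {x. Q x} \<Longrightarrow>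
    semialgebraic {x. P x \<and> Q x}"
  using semialgebraic.Int[of "{x. P x}" "{x. Q x}"] by (simp add: Collect_conj_eq)

lemma semialgebraic_disj: "semialgebraic {x. P x} \<Longrightarrow> semialgebraic {x. Q x} \<Longrightarrow>
    semialgebraic {x. P x \<or> Q x}"
  using semialgebraic.Un[of "{x. P x}" "{x. Q x}"] by (simp add: Collect_disj_eq)

lemma semialgebraic_imp: "semialgebraic {x. P x} \<Longrightarrow> semialgebraic {x. Q x} \<Longrightarrow>
    semialgebraic {x. P x \<longrightarrow> Q x}"
  unfolding imp_conv_disj by (intro semialgebraic_disj semialgebraic_not)

lemma semialgebraic_le: "real_polynomial_function p \<Longrightarrow> real_polynomial_function q \<Longrightarrow>
    semialgebraic {x. p x \<le> q x}"
  using semialgebraic_not[OF semialgebraic_gt[of q p]] by (simp add: not_less)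

lemma semialgebraic_eq: "real_polynomial_function p \<Longrightarrow> real_polynomial_function q \<Longrightarrow>
    semialgebraic {x. p x = q x}"
  using semialgebraic_conj[OF semialgebraic_le[of p q] semialgebraic_le[of q p]]
  by (simp add: order_eq_iff)

lemma semialgebraic_triv: "semialgebraic {x. P}"
proof (cases P)
  case True
  then show ?thesis using semialgebraic.pos[OF rpf_const[of 1]] by simp
next
  case False
  then show ?thesis using semialgebraic.pos[OF rpf_const[of 0]] by simp
qed

lemma semialgebraic_UNIV: "semialgebraic UNIV" and semialgebraic_empty: "semialgebraic {}"
  using semialgebraic_triv[of True] semialgebraic_triv[of False] by simp_all

lemma semialgebraic_all_finite:
  "finite I \<Longrightarrow> (\<And>i. i \<in> I \<Longrightarrow> semialgebraic {x. P i x}) \<Longrightarrow> semialgebraic {x. \<forall>i\<in>I. P i x}"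
proof (induction I rule: finite_induct)
  case empty
  show ?case by (simp add: semialgebraic_UNIV)
next
  case (insert i I)
  then have "semialgebraic {x. P i x}" "semialgebraic {x. \<forall>i\<in>I. P i x}" by blast+
  from semialgebraic_conj[OF this] show ?case by (simp only: ball_simps)
qed

lemma semialgebraic_ex_finite:
  "finite I \<Longrightarrow> (\<And>i. i \<in> I \<Longrightarrow> semialgebraic {x. P i x}) \<Longrightarrow> semialgebraic {x. \<exists>i\<in>I. P i x}"
proof (induction I rule: finite_induct)
  case empty
  show ?case by (simp add: semialgebraic_empty)
next
  case (insert i I)
  then have "semialgebraic {x. P i x}" "semialgebraic {x. \<exists>i\<in>I. P i x}" by blast+
  from semialgebraic_disj[OF this] show ?case by (simp only: bex_simps)
qed

lemma semialgebraic_vimage: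
  assumes "semialgebraic A" "polynomial_function g"
  shows "semialgebraic {x. g x \<in> A}"
  using assms(1)
proof induction
  case (pos p)
  then have "real_polynomial_function (p \<circ> g)"
    by (rule real_polynomial_function_compose[OF assms(2)])
  then show ?case using semialgebraic.pos[of "p \<circ> g"] by simp
qed (simp_all add: semialgebraic_disj semialgebraic_conj semialgebraic_not)

text \<open>For finite sets G of polynomials this is a normal form of semialgebraic sets: membership
  is decided by the vector of signs.\<close>

definition sign_determined :: "('a \<Rightarrow> real) set \<Rightarrow> 'a set \<Rightarrow> bool" where
  "sign_determined G A \<longleftrightarrow> (\<forall>x x'. (\<forall>g\<in>G. sgn (g x) = sgn (g x')) \<longrightarrow> (x \<in> A \<longleftrightarrow> x' \<in> A))"

lemma semialgebraic_imp_sign_determined: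
  "semialgebraic A \<Longrightarrow> \<exists>G. finite G \<and> (\<forall>g\<in>G. real_polynomial_function g) \<and> sign_determined G A"
proof (induction rule: semialgebraic.induct)
  case (pos p)
  have "sign_determined {p} {x. 0 < p x}"
    unfolding sign_determined_def by (simp add: sgn_real_eq_iff)
  with pos show ?case by (intro exI[of _ "{p}"]) simp
next
  case (Un A B)
  then obtain G H where "finite G" "finite H" "sign_determined G A" "sign_determined H B"
    "\<forall>g\<in>G. real_polynomial_function g" "\<forall>g\<in>H. real_polynomial_function g" by blast
  moreover from this have "sign_determined (G \<union> H) (A \<union> B)"
    unfolding sign_determined_def by (metis UnCI Un_iff)
  ultimately show ?case by (intro exI[of _ "G \<union> H"]) auto
next
  case (Int A B)
  then obtain G H where "finite G" "finite H" "sign_determined G A" "sign_determined H B"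
    "\<forall>g\<in>G. real_polynomial_function g" "\<forall>g\<in>H. real_polynomial_function g" by blast
  moreover from this have "sign_determined (G \<union> H) (A \<inter> B)"
    unfolding sign_determined_def by (metis UnCI Int_iff)
  ultimately show ?case by (intro exI[of _ "G \<union> H"]) auto
next
  case (Compl A)
  then show ?case unfolding sign_determined_def by auto
qed

lemma semialgebraic_sgn_eq:
  assumes "real_polynomial_function p"
  shows "semialgebraic {x. sgn (p x) = s}"
proof -
  have *: "semialgebraic {x. 0 < p x}" "semialgebraic {x. p x < 0}" "semialgebraic {x. p x = 0}"
    using assms rpf_const by (auto intro: semialgebraic_gt semialgebraic_eq)
  consider "s = 1" | "s = 0" | "s = -1" | "s \<noteq> 1" "s \<noteq> 0" "s \<noteq> -1" by blast
  then show ?thesis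
  proof cases
    case 4
    then have "sgn (p x) \<noteq> s" for x by (auto simp: sgn_if)
    then show ?thesis by (simp add: semialgebraic_empty)
  qed (use * in \<open>simp_all add: sgn_1_pos sgn_1_neg sgn_0_0\<close>)
qed

lemma sign_determined_imp_semialgebraic:
  fixes G :: "('a::euclidean_space \<Rightarrow> real) set"
  assumes "finite G" "\<forall>g\<in>G. real_polynomial_function g" "sign_determined G A"
  shows "semialgebraic A"
proof -
  define sv where "sv x = (\<lambda>g\<in>G. sgn (g x))" for x :: 'a
  have "sgn a \<in> {-1, 0, 1}" for a :: real by (cases a "0::real" rule: linorder_cases) simp_all
  then have "sv ` A \<subseteq> G \<rightarrow>\<^sub>E {-1, 0, 1}" unfolding sv_def by (intro image_subsetI) auto
  moreover have "finite (G \<rightarrow>\<^sub>E {-1, 0, 1 :: real})" using assms(1) by (intro finite_PiE) auto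
  ultimately have "finite (sv ` A)" by (rule finite_subset)
  \<comment> \<open>A is the union of the finitely many sign conditions realised on it.\<close>
  then have "semialgebraic {x. \<exists>s\<in>sv ` A. \<forall>g\<in>G. sgn (g x) = s g}"
    using assms by (intro semialgebraic_ex_finite semialgebraic_all_finite semialgebraic_sgn_eq) auto
  moreover have "{x. \<exists>s\<in>sv ` A. \<forall>g\<in>G. sgn (g x) = s g} = A"
    using assms(3) unfolding sign_determined_def sv_def by fastforce
  ultimately show ?thesis by simp
qed

text \<open>On the lines in direction e, the parameter c becomes the variable to be eliminated; no
  choice of coordinates is involved.\<close>

lemma real_polynomial_function_on_line:
  fixes p :: "'a::euclidean_space \<Rightarrow> real"
  assumes "real_polynomial_function p"
  shows "\<exists>P d. poly_family P d \<and> (\<forall>x c. poly (P x) c = p (x + c *\<^sub>R e))"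
  using assms
proof (induction rule: real_polynomial_function.induct)
  case (linear f)
  interpret f: bounded_linear f by fact
  have "real_polynomial_function (\<lambda>x. coeff [:f x, f e:] i)" for i
    using linear by (cases i; cases "i - 1") (auto simp: coeff_pCons split: nat.split)
  then show ?case
    by (intro exI[of _ "\<lambda>x. [:f x, f e:]"] exI[of _ 1])
      (simp add: poly_family_def f.add f.scaleR degree_pCons_le mult.commute)
next
  case (const c)
  have "real_polynomial_function (\<lambda>x::'a. coeff [:c:] i)" for i by auto
  then show ?case by (intro exI[of _ "\<lambda>x. [:c:]"] exI[of _ 0]) (simp add: poly_family_def)
next
  case (add f g)
  then obtain P d Q e' where "poly_family P d" "poly_family Q e'"
    "\<forall>x c. poly (P x) c = f (x + c *\<^sub>R e)" "\<forall>x c. poly (Q x) c = g (x + c *\<^sub>R e)" by blast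
  moreover from this have "degree (P x + Q x) \<le> max d e'" for x
    by (meson degree_add_le_max max.mono order.trans poly_family_def)
  ultimately show ?case
    by (intro exI[of _ "\<lambda>x. P x + Q x"] exI[of _ "max d e'"]) (auto simp: poly_family_def)
next
  case (mult f g)
  then obtain P d Q e' where *: "poly_family P d" "poly_family Q e'"
    "\<forall>x c. poly (P x) c = f (x + c *\<^sub>R e)" "\<forall>x c. poly (Q x) c = g (x + c *\<^sub>R e)" by blast
  then have "degree (P x * Q x) \<le> d + e'" for x
    by (meson add_mono degree_mult_le order.trans poly_family_def)
  with * show ?case
    by (intro exI[of _ "\<lambda>x. P x * Q x"] exI[of _ "d + e'"])
      (auto simp: poly_family_def coeff_mult intro!: real_polynomial_function_sum rpf_mult)
qed

text \<open>This is projection along e inside the same space. If x and x' have the same diagram, a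
  witness c for x is matched with some c' at which all polynomials describing A have the same signs,
  so c' is a witness for x'.\<close>

lemma semialgebraic_saturate:
  fixes A :: "'a::euclidean_space set"
  assumes "semialgebraic A"
  shows "semialgebraic {x. \<exists>c. x + c *\<^sub>R e \<in> A}"
proof -
  obtain G where G: "finite G" "\<forall>g\<in>G. real_polynomial_function g" "sign_determined G A"
    using semialgebraic_imp_sign_determined[OF assms] by blast
  have "\<forall>g\<in>G. \<exists>Pd. poly_family (fst Pd) (snd Pd) \<and> (\<forall>x c. poly (fst Pd x) c = g (x + c *\<^sub>R e))"
    using G(2) real_polynomial_function_on_line[of _ e] by fastforce
  from bchoice[OF this] obtain Q
    where Q: "\<forall>g\<in>G. poly_family (fst (Q g)) (snd (Q g)) \<and>
      (\<forall>x c. poly (fst (Q g) x) c = g (x + c *\<^sub>R e))" by (rule exE)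
  define F where "F = mset_set (Q ` G)"
  have F: "set_mset F = Q ` G" using G(1) by (simp add: F_def)
  have fam: "poly_family P d" if "(P, d) \<in># F" for P d
  proof -
    obtain g where "g \<in> G" "(P, d) = Q g" using \<open>(P, d) \<in># F\<close> F by blast
    then show ?thesis using Q by (metis fst_conv snd_conv)
  qed
  have "\<exists>H. finite H \<and> (\<forall>g\<in>H. real_polynomial_function g) \<and>
      (\<forall>x x'. (\<forall>g\<in>H. sgn (g x) = sgn (g x')) \<longrightarrow>
        same_sign_diagram (set_mset F) (\<lambda>P. fst P x) (\<lambda>P. fst P x'))"
    by (rule sign_diagram_finitely_determined) (rule fam)
  then obtain H where "finite H \<and> (\<forall>g\<in>H. real_polynomial_function g) \<and>
      (\<forall>x x'. (\<forall>g\<in>H. sgn (g x) = sgn (g x')) \<longrightarrow>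
        same_sign_diagram (Q ` G) (\<lambda>P. fst P x) (\<lambda>P. fst P x'))" unfolding F by (rule exE)
  then have H: "finite H" "\<forall>g\<in>H. real_polynomial_function g"
    and ssd: "\<And>x x'. \<forall>g\<in>H. sgn (g x) = sgn (g x') \<Longrightarrow>
      same_sign_diagram (Q ` G) (\<lambda>P. fst P x) (\<lambda>P. fst P x')"
    by blast+
  have imp: "x' \<in> {x. \<exists>c. x + c *\<^sub>R e \<in> A}"
    if eq: "\<forall>g\<in>H. sgn (g x) = sgn (g x')" and x: "x \<in> {x. \<exists>c. x + c *\<^sub>R e \<in> A}" for x x'
  proof -
    obtain Z \<sigma> where Z: "finite Z" "strict_mono_on Z \<sigma>"
      and s: "\<And>t t' k. match Z \<sigma> t t' \<Longrightarrow> k \<in> Q ` G \<Longrightarrow>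
        sgn (poly (fst k x) t) = sgn (poly (fst k x') t')"
      using ssd[OF eq] unfolding same_sign_diagram_def by blast
    obtain c where c: "x + c *\<^sub>R e \<in> A" using x by blast
    obtain c' where c': "match Z \<sigma> c c'" using match_ex[OF Z] by blast
    have "sgn (g (x + c *\<^sub>R e)) = sgn (g (x' + c' *\<^sub>R e))" if "g \<in> G" for g
      using s[OF c' imageI[OF that]] Q that by simp
    then have "x' + c' *\<^sub>R e \<in> A" using G(3) c unfolding sign_determined_def by blast
    then show ?thesis by blast
  qed
  have "sign_determined H {x. \<exists>c. x + c *\<^sub>R e \<in> A}"
    unfolding sign_determined_def
  proof (intro allI impI iffI)
    fix x x' assume "\<forall>g\<in>H. sgn (g x) = sgn (g x')"
    then have "\<forall>g\<in>H. sgn (g x') = sgn (g x)" by (metis (no_types))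
    then show "x' \<in> {x. \<exists>c. x + c *\<^sub>R e \<in> A} \<Longrightarrow> x \<in> {x. \<exists>c. x + c *\<^sub>R e \<in> A}"
      by (rule imp)
  qed (rule imp)
  then show ?thesis using H sign_determined_imp_semialgebraic by blast
qed

text \<open>Saturating in the directions (0, b), one basis vector b after the other, makes the set
  invariant in y; its slice at y = 0 is then the projection.\<close>

theorem tarski_seidenberg:
  fixes P :: "'a::euclidean_space \<Rightarrow> 'b::euclidean_space \<Rightarrow> bool"
  assumes "semialgebraic {(x, y). P x y}"
  shows "semialgebraic {x. \<exists>y. P x y}"
proof -
  define A where "A = {(x, y). P x y}"
  have "semialgebraic {z. \<exists>v\<in>span B. z + (0, v) \<in> A}" if "finite B" for B :: "'b set"
    using that
  proof (induction B rule: finite_induct)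
    case empty
    then show ?case using assms by (simp add: A_def zero_prod_def[symmetric])
  next
    case (insert b B)
    have *: "(\<exists>v\<in>span (insert b B). z + (0, v) \<in> A) \<longleftrightarrow>
        (\<exists>c. z + c *\<^sub>R (0, b) \<in> {z. \<exists>v\<in>span B. z + (0, v) \<in> A})" for z
    proof
      assume "\<exists>v\<in>span (insert b B). z + (0, v) \<in> A"
      then obtain v k where v: "v - k *\<^sub>R b \<in> span B" "z + (0, v) \<in> A"
        unfolding span_insert by blast
      have "z + (0, v) = z + k *\<^sub>R (0, b) + (0, v - k *\<^sub>R b)" by (simp add: prod_eq_iff)
      with v have "z + k *\<^sub>R (0, b) \<in> {z. \<exists>v\<in>span B. z + (0, v) \<in> A}" by force
      then show "\<exists>c. z + c *\<^sub>R (0, b) \<in> {z. \<exists>v\<in>span B. z + (0, v) \<in> A}" ..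
    next
      assume "\<exists>c. z + c *\<^sub>R (0, b) \<in> {z. \<exists>v\<in>span B. z + (0, v) \<in> A}"
      then obtain c v where v: "v \<in> span B" "z + c *\<^sub>R (0, b) + (0, v) \<in> A" by blast
      have "z + c *\<^sub>R (0, b) + (0, v) = z + (0, c *\<^sub>R b + v)" by (simp add: prod_eq_iff)
      moreover have "c *\<^sub>R b + v \<in> span (insert b B)"
        using v(1) by (meson insertI1 span_add span_base span_mono span_scale subsetD subset_insertI)
      ultimately show "\<exists>v\<in>span (insert b B). z + (0, v) \<in> A" using v(2) by metis
    qed
    show ?case unfolding * by (rule semialgebraic_saturate[OF insert(3)])
  qed
  from this[of Basis] have "semialgebraic {z. \<exists>v. z + (0, v) \<in> A}" by simp
  moreover have "polynomial_function (\<lambda>x::'a. (x, 0::'b))"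
    by (intro polynomial_function_bounded_linear bounded_linear_Pair bounded_linear_ident bounded_linear_zero)
  ultimately have "semialgebraic {x. (x, 0) \<in> {z. \<exists>v. z + (0, v) \<in> A}}"
    by (rule semialgebraic_vimage)
  then show ?thesis by (simp add: A_def)
qed

lemma semialgebraic_all:
  fixes P :: "'a::euclidean_space \<Rightarrow> 'b::euclidean_space \<Rightarrow> bool"
  assumes "semialgebraic {(x, y). P x y}"
  shows "semialgebraic {x. \<forall>y. P x y}"
proof -
  have "semialgebraic {(x, y). \<not> P x y}"
    using semialgebraic_not[of "\<lambda>(x, y). P x y"] assms by (simp add: case_prod_unfold)
  from semialgebraic_not[OF tarski_seidenberg[OF this]] show ?thesis by simp
qed


lemma semialgebraic_exI:
  assumes "semialgebraic {z. P (fst z) (snd z)}"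
  shows "semialgebraic {x. \<exists>y. P x y}"
  using tarski_seidenberg[of P] assms by (simp add: case_prod_unfold)

lemma semialgebraic_allI:
  assumes "semialgebraic {z. P (fst z) (snd z)}"
  shows "semialgebraic {x. \<forall>y. P x y}"
  using semialgebraic_all[of P] assms by (simp add: case_prod_unfold)

section \<open>Polynomial maps and zeros of polynomials\<close>

named_theorems poly_intros

lemma polynomial_function_fst [poly_intros]:
  "polynomial_function g \<Longrightarrow> polynomial_function (\<lambda>x. fst (g x))"
  using polynomial_function_compose[OF _ polynomial_function_bounded_linear[OF bounded_linear_fst], of g]
  by (simp add: o_def)

lemma polynomial_function_snd [poly_intros]:
  "polynomial_function g \<Longrightarrow> polynomial_function (\<lambda>x. snd (g x))"
  using polynomial_function_compose[OF _ polynomial_function_bounded_linear[OF bounded_linear_snd], of g]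
  by (simp add: o_def)

lemma polynomial_function_Pair [poly_intros]:
  assumes "polynomial_function f" "polynomial_function g"
  shows "polynomial_function (\<lambda>x. (f x, g x))"
proof -
  have "polynomial_function (\<lambda>x. (\<lambda>y. (y, 0)) (f x))" "polynomial_function (\<lambda>x. (\<lambda>y. (0, y)) (g x))"
    using polynomial_function_compose[OF assms(1), of "\<lambda>y. (y, 0)"]
      polynomial_function_compose[OF assms(2), of "\<lambda>y. (0, y)"]
    by (simp_all add: o_def polynomial_function_bounded_linear bounded_linear_Pair
        bounded_linear_ident bounded_linear_zero)
  from polynomial_function_add[OF this] show ?thesis by simp
qed

lemma polynomial_function_ident [poly_intros]: "polynomial_function (\<lambda>x. x)"
  by (rule polynomial_function_id)

lemma polynomial_function_constant [poly_intros]: "polynomial_function (\<lambda>x. c)"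
  by (rule polynomial_function_const)

lemma rpf_inner [poly_intros]:
  fixes f g :: "'a::euclidean_space \<Rightarrow> 'b::euclidean_space"
  assumes "polynomial_function f" "polynomial_function g"
  shows "real_polynomial_function (\<lambda>x. f x \<bullet> g x)"
proof -
  have "real_polynomial_function (\<lambda>x. f x \<bullet> b)" "real_polynomial_function (\<lambda>x. g x \<bullet> b)" for b
    using assms bounded_linear_inner_left[of b] unfolding polynomial_function_def by (auto simp: o_def)
  then show ?thesis
    by (subst euclidean_inner) (intro real_polynomial_function_sum rpf_mult; simp)
qed

lemma rpf_nth [poly_intros]:
  fixes g :: "'a::euclidean_space \<Rightarrow> real ^ 'n"
  assumes "polynomial_function g"
  shows "real_polynomial_function (\<lambda>x. g x $ i)"
  using assms bounded_linear_vec_nth[of i] unfolding polynomial_function_def by (auto simp: o_def)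

lemma rpf_of_pf: "polynomial_function g \<Longrightarrow> real_polynomial_function g"
  by (simp add: real_polynomial_function_eq)

lemma rpf_fst [poly_intros]: "polynomial_function g \<Longrightarrow> real_polynomial_function (\<lambda>x. fst (g x))"
  by (intro rpf_of_pf poly_intros)

lemma rpf_snd [poly_intros]: "polynomial_function g \<Longrightarrow> real_polynomial_function (\<lambda>x. snd (g x))"
  by (intro rpf_of_pf poly_intros)

lemmas [poly_intros] = rpf_const rpf_add rpf_mult real_polynomial_function_diff
  real_polynomial_function_minus real_polynomial_function_sum real_polynomial_function_prod
  real_polynomial_function_power polynomial_function_add polynomial_function_diff
  polynomial_function_minus polynomial_function_sum polynomial_function_mult

text \<open>On the line from a point of U to x the polynomial has infinitely many zeros near that
  point.\<close>

lemma real_polynomial_function_eq_0: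
  fixes p :: "'a::euclidean_space \<Rightarrow> real"
  assumes p: "real_polynomial_function p" and U: "open U" "U \<noteq> {}" "\<And>x. x \<in> U \<Longrightarrow> p x = 0"
  shows "p x = 0"
proof -
  obtain a where a: "a \<in> U" using U by blast
  obtain P d where P: "\<And>y c. poly (P y) c = p (y + c *\<^sub>R (x - a))"
    using real_polynomial_function_on_line[OF p, of "x - a"] by blast
  have "((\<lambda>c. a + c *\<^sub>R (x - a)) \<longlongrightarrow> a + 0 *\<^sub>R (x - a)) (at_right 0)"
    by (intro tendsto_intros)
  then have "\<forall>\<^sub>F c in at_right 0. a + c *\<^sub>R (x - a) \<in> U"
    using U(1) a by (simp add: tendsto_def)
  then obtain \<delta> where \<delta>: "0 < \<delta>" "\<And>c. 0 < c \<Longrightarrow> c < \<delta> \<Longrightarrow> a + c *\<^sub>R (x - a) \<in> U"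
    unfolding eventually_at_right_field by blast
  then have "{0<..<\<delta>} \<subseteq> {c. poly (P a) c = 0}" using U(3) P by auto
  moreover have "infinite {0<..<\<delta>}" using \<delta>(1) by (rule infinite_Ioo)
  ultimately have "P a = 0" using poly_roots_finite finite_subset by metis
  then have "poly (P a) 1 = 0" by simp
  then show ?thesis unfolding P by simp
qed

lemma open_nonzero:
  assumes "real_polynomial_function p"
  shows "open {x. p x \<noteq> 0}"
proof -
  have "continuous_on UNIV p"
    using assms continuous_on_polymonial_function real_polynomial_function_eq by blast
  from open_Collect_neq[OF this continuous_on_const] show ?thesis .
qed

lemma mult_nonzero:
  fixes p q :: "'a::euclidean_space \<Rightarrow> real"
  assumes "real_polynomial_function p" "real_polynomial_function q" "p a \<noteq> 0" "q b \<noteq> 0"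
  shows "\<exists>x. p x * q x \<noteq> 0"
proof (rule ccontr)
  assume *: "\<nexists>x. p x * q x \<noteq> 0"
  have "q b = 0"
  proof (rule real_polynomial_function_eq_0[OF assms(2) open_nonzero[OF assms(1)]])
    show "{x. p x \<noteq> 0} \<noteq> {}" using assms(3) by blast
    show "q x = 0" if "x \<in> {x. p x \<noteq> 0}" for x
      using * that mult_eq_0_iff[of "p x" "q x"] by blast
  qed
  with assms(4) show False by simp
qed

lemma prod_nonzero:
  fixes F :: "('a::euclidean_space \<Rightarrow> real) set"
  assumes "finite F" "\<And>p. p \<in> F \<Longrightarrow> real_polynomial_function p \<and> (\<exists>x. p x \<noteq> 0)"
  shows "\<exists>x. \<forall>p\<in>F. p x \<noteq> 0"
proof -
  have "\<exists>x. (\<Prod>p\<in>F. p x) \<noteq> 0" using assms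
  proof (induction F rule: finite_induct)
    case empty
    show ?case by simp
  next
    case (insert q F)
    then obtain x y where xy: "(\<Prod>p\<in>F. p x) \<noteq> 0" "q y \<noteq> 0" by blast
    have "real_polynomial_function (\<lambda>x. \<Prod>p\<in>F. p x)" "real_polynomial_function q"
      using insert by (auto intro: real_polynomial_function_prod)
    from mult_nonzero[OF this(2,1) xy(2,1)] show ?case
      unfolding prod.insert[OF insert(1,2)] .
  qed
  with assms(1) show ?thesis by (meson prod_zero_iff)
qed

text \<open>P is a product of polynomials occurring in the description of S; off its zeros all their
  signs are locally constant.\<close>

lemma semialgebraic_generic:
  fixes S :: "'a::euclidean_space set"
  assumes "semialgebraic S"
  shows "\<exists>P. real_polynomial_function P \<and> (\<exists>x. P x \<noteq> 0) \<and>
    open (S \<inter> {x. P x \<noteq> 0}) \<and> open (- S \<inter> {x. P x \<noteq> 0})"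
  using assms
proof (induction rule: semialgebraic.induct)
  case (pos p)
  show ?case
  proof (cases "\<exists>x. p x \<noteq> 0")
    case True
    have c: "continuous_on UNIV p"
      using pos continuous_on_polymonial_function real_polynomial_function_eq by blast
    have "{x. 0 < p x} \<inter> {x. p x \<noteq> 0} = {x. 0 < p x}" "- {x. 0 < p x} \<inter> {x. p x \<noteq> 0} = {x. p x < 0}"
      by auto
    then show ?thesis using True pos c
      by (intro exI[of _ p]) (auto intro: open_Collect_less continuous_on_const)
  next
    case False
    then show ?thesis by (intro exI[of _ "\<lambda>x. 1"]) (auto intro: rpf_const)
  qed
next
  case (Un A B)
  then obtain P Q where P: "real_polynomial_function P" "\<exists>x. P x \<noteq> 0"
      "open (A \<inter> {x. P x \<noteq> 0})" "open (- A \<inter> {x. P x \<noteq> 0})"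
    and Q: "real_polynomial_function Q" "\<exists>x. Q x \<noteq> 0"
      "open (B \<inter> {x. Q x \<noteq> 0})" "open (- B \<inter> {x. Q x \<noteq> 0})" by blast
  have "(A \<union> B) \<inter> {x. P x * Q x \<noteq> 0} =
      (A \<inter> {x. P x \<noteq> 0}) \<inter> {x. Q x \<noteq> 0} \<union> (B \<inter> {x. Q x \<noteq> 0}) \<inter> {x. P x \<noteq> 0}"
    "- (A \<union> B) \<inter> {x. P x * Q x \<noteq> 0} = (- A \<inter> {x. P x \<noteq> 0}) \<inter> (- B \<inter> {x. Q x \<noteq> 0})" by auto
  then show ?case using P Q mult_nonzero[OF P(1) Q(1)] open_nonzero
    by (intro exI[of _ "\<lambda>x. P x * Q x"]) (auto intro!: open_Un open_Int rpf_mult)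
next
  case (Int A B)
  then obtain P Q where P: "real_polynomial_function P" "\<exists>x. P x \<noteq> 0"
      "open (A \<inter> {x. P x \<noteq> 0})" "open (- A \<inter> {x. P x \<noteq> 0})"
    and Q: "real_polynomial_function Q" "\<exists>x. Q x \<noteq> 0"
      "open (B \<inter> {x. Q x \<noteq> 0})" "open (- B \<inter> {x. Q x \<noteq> 0})" by blast
  have "- (A \<inter> B) \<inter> {x. P x * Q x \<noteq> 0} =
      (- A \<inter> {x. P x \<noteq> 0}) \<inter> {x. Q x \<noteq> 0} \<union> (- B \<inter> {x. Q x \<noteq> 0}) \<inter> {x. P x \<noteq> 0}"
    "(A \<inter> B) \<inter> {x. P x * Q x \<noteq> 0} = (A \<inter> {x. P x \<noteq> 0}) \<inter> (B \<inter> {x. Q x \<noteq> 0})" by auto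
  then show ?case using P Q mult_nonzero[OF P(1) Q(1)] open_nonzero
    by (intro exI[of _ "\<lambda>x. P x * Q x"]) (auto intro!: open_Un open_Int rpf_mult)
next
  case (Compl A)
  then show ?case by auto
qed

text \<open>The link from topology to algebra: smallness obtained from Baire's theorem, or from the
  absence of cells, becomes a polynomial equation.\<close>

lemma semialgebraic_thin:
  fixes S :: "'a::euclidean_space set"
  assumes "semialgebraic S" "interior S = {}"
  shows "\<exists>P. real_polynomial_function P \<and> (\<exists>x. P x \<noteq> 0) \<and> (\<forall>x\<in>S. P x = 0)"
proof -
  obtain P where P: "real_polynomial_function P" "\<exists>x. P x \<noteq> 0" "open (S \<inter> {x. P x \<noteq> 0})"
    using semialgebraic_generic[OF assms(1)] by blast
  then have "S \<inter> {x. P x \<noteq> 0} \<subseteq> interior S" by (intro interior_maximal) auto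
  with P assms show ?thesis by blast
qed

section \<open>Cylinders and selections\<close>

text \<open>The preimage of the projection of \<Gamma> to the coordinates in J. As it stays in the
  ambient space, its interior tells whether the projection has interior, and no space of dimension
  card J has to be formed.\<close>

definition cyl :: "'a::euclidean_space set \<Rightarrow> 'a set \<Rightarrow> 'a set" where
  "cyl J \<Gamma> = {z. \<exists>w\<in>\<Gamma>. \<forall>b\<in>J. w \<bullet> b = z \<bullet> b}"

definition restr :: "'a::euclidean_space set \<Rightarrow> 'a \<Rightarrow> 'a" where
  "restr J w = (\<Sum>b\<in>J. (w \<bullet> b) *\<^sub>R b)"

lemma inner_restr:
  assumes "J \<subseteq> Basis" "b \<in> Basis"
  shows "restr J w \<bullet> b = (if b \<in> J then w \<bullet> b else 0)"
proof -
  have "finite J" using assms finite_subset finite_Basis by blast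
  have "restr J w \<bullet> b = (\<Sum>c\<in>J. (w \<bullet> c) * (if c = b then 1 else 0))"
    unfolding restr_def inner_sum_left using assms by (intro sum.cong) (auto simp: inner_Basis)
  also have "\<dots> = (if b \<in> J then w \<bullet> b else 0)" using \<open>finite J\<close> by (simp add: if_distrib cong: if_cong)
  finally show ?thesis .
qed

lemma restr_eq_iff:
  assumes "J \<subseteq> Basis"
  shows "restr J w = restr J z \<longleftrightarrow> (\<forall>b\<in>J. w \<bullet> b = z \<bullet> b)"
proof
  assume "restr J w = restr J z"
  then show "\<forall>b\<in>J. w \<bullet> b = z \<bullet> b" using inner_restr[OF assms] assms by (metis subsetD)
qed (simp add: restr_def)

lemma bounded_linear_restr: "bounded_linear (restr J)"
  unfolding restr_def
  by (intro bounded_linear_sum bounded_linear_scaleR_const bounded_linear_inner_left)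

lemma continuous_on_restr [continuous_intros]:
  "continuous_on S f \<Longrightarrow> continuous_on S (\<lambda>x. restr J (f x))"
  using bounded_linear.continuous_on[OF bounded_linear_restr] .

lemma cyl_eq:
  assumes "J \<subseteq> Basis"
  shows "cyl J \<Gamma> = restr J -` (restr J ` \<Gamma>)"
proof -
  have "cyl J \<Gamma> = {z. \<exists>w\<in>\<Gamma>. restr J z = restr J w}"
    unfolding cyl_def restr_eq_iff[OF assms, symmetric] by (metis (no_types))
  then show ?thesis by (simp add: vimage_def image_iff)
qed

lemma closed_cyl:
  assumes "compact \<Gamma>" "J \<subseteq> Basis"
  shows "closed (cyl J \<Gamma>)"
proof -
  have "continuous_on UNIV (restr J)" by (intro continuous_intros)
  then have "closed (restr J ` \<Gamma>)"
    by (meson assms(1) compact_continuous_image compact_imp_closed continuous_on_subset subset_UNIV)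
  with \<open>continuous_on UNIV (restr J)\<close> show ?thesis unfolding cyl_eq[OF assms(2)] by (rule closed_vimage[rotated])
qed

text \<open>Squared distances keep the description of balls polynomial. The parameter makes it
  uniform over a family of sets.\<close>

lemma semialgebraic_interior_param:
  fixes A :: "('p::euclidean_space \<times> 'a::euclidean_space) set"
  assumes "semialgebraic A"
  shows "semialgebraic {y. snd y \<in> interior {z. (fst y, z) \<in> A}}"
proof -
  have "snd y \<in> interior {z. (fst y, z) \<in> A} \<longleftrightarrow>
      (\<exists>\<delta>::real. 0 < \<delta> \<and> (\<forall>z. (snd y - z) \<bullet> (snd y - z) < \<delta> \<longrightarrow> (fst y, z) \<in> A))" for y
  proof
    assume "snd y \<in> interior {z. (fst y, z) \<in> A}"
    then obtain e where e: "e > 0" "\<And>z. dist (snd y) z < e \<Longrightarrow> (fst y, z) \<in> A"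
      unfolding mem_interior subset_iff mem_ball by blast
    show "\<exists>\<delta>::real. 0 < \<delta> \<and> (\<forall>z. (snd y - z) \<bullet> (snd y - z) < \<delta> \<longrightarrow> (fst y, z) \<in> A)"
    proof (intro exI[of _ "e\<^sup>2"] conjI allI impI e)
      fix z assume "(snd y - z) \<bullet> (snd y - z) < e\<^sup>2"
      then show "dist (snd y) z < e"
        using e(1) by (simp add: dist_norm power2_norm_eq_inner[symmetric] power_less_imp_less_base)
    qed (use e in simp)
  next
    assume "\<exists>\<delta>::real. 0 < \<delta> \<and> (\<forall>z. (snd y - z) \<bullet> (snd y - z) < \<delta> \<longrightarrow> (fst y, z) \<in> A)"
    then obtain \<delta> :: real where \<delta>: "0 < \<delta>"
      "\<And>z. (snd y - z) \<bullet> (snd y - z) < \<delta> \<Longrightarrow> (fst y, z) \<in> A" by blast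
    have "(snd y - z) \<bullet> (snd y - z) < \<delta>" if "dist (snd y) z < sqrt \<delta>" for z
      using that \<delta>(1) by (simp add: dist_norm power2_norm_eq_inner[symmetric])
        (metis norm_ge_zero real_sqrt_less_iff real_sqrt_unique)
    then have "ball (snd y) (sqrt \<delta>) \<subseteq> {z. (fst y, z) \<in> A}" using \<delta>(2) by auto
    then show "snd y \<in> interior {z. (fst y, z) \<in> A}" using \<delta>(1) unfolding mem_interior
      by (intro exI[of _ "sqrt \<delta>"]) simp
  qed
  moreover have "semialgebraic {y :: 'p \<times> 'a. \<exists>\<delta>::real. 0 < \<delta> \<and>
      (\<forall>z. (snd y - z) \<bullet> (snd y - z) < \<delta> \<longrightarrow> (fst y, z) \<in> A)}"
    by (intro semialgebraic_exI semialgebraic_conj semialgebraic_gt semialgebraic_allI semialgebraic_imp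
        semialgebraic_vimage[OF assms] poly_intros)
  ultimately show ?thesis by simp
qed

lemma semialgebraic_cyl_param:
  fixes A :: "('p::euclidean_space \<times> 'a::euclidean_space) set"
  assumes "semialgebraic A" "J \<subseteq> Basis"
  shows "semialgebraic {y. snd y \<in> cyl J {w. (fst y, w) \<in> A}}"
proof -
  have fin: "finite J" using assms(2) finite_subset finite_Basis by blast
  have "semialgebraic {y :: 'p \<times> 'a. \<exists>w. (fst y, w) \<in> A \<and> (\<forall>b\<in>J. w \<bullet> b = snd y \<bullet> b)}"
    by (intro semialgebraic_exI semialgebraic_conj semialgebraic_eq semialgebraic_all_finite[OF fin]
        semialgebraic_vimage[OF assms(1)] poly_intros)
  then show ?thesis by (simp add: cyl_def Bex_def)
qed

lemma interior_countable_Union_thin: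
  fixes F :: "'i \<Rightarrow> 'a::euclidean_space set"
  assumes "countable I" "\<And>i. i \<in> I \<Longrightarrow> closed (F i)" "\<And>i. i \<in> I \<Longrightarrow> interior (F i) = {}"
  shows "interior (\<Union>i\<in>I. F i) = {}"
proof -
  have "UNIV \<subseteq> closure (\<Inter>((\<lambda>i. - F i) ` I))"
  proof (rule Baire)
    fix T assume "T \<in> (\<lambda>i. - F i) ` I"
    then obtain i where i: "i \<in> I" "T = - F i" by blast
    then have "closure T = UNIV" using assms(3) by (simp add: closure_complement)
    with i assms(2) show "openin (top_of_set UNIV) T \<and> UNIV \<subseteq> closure T"
      by (simp add: open_Compl)
  qed (use assms(1) in auto)
  then have "closure (- (\<Union>i\<in>I. F i)) = UNIV" by (simp add: Compl_UN top.extremum_uniqueI)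
  then show ?thesis unfolding closure_complement by blast
qed

lemma pf_of_rpf: "real_polynomial_function p \<Longrightarrow> polynomial_function p"
  by (simp add: real_polynomial_function_eq)

text \<open>The function \<open>z \<mapsto> min {w \<bullet> b | w \<in> \<Gamma> over z}\<close> is lower semicontinuous, so it is
  discontinuous only on a meagre set. This set is semialgebraic and hence thin.\<close>

lemma select_min:
  fixes \<Gamma> :: "'a::euclidean_space set"
  assumes \<Gamma>: "compact \<Gamma>" "semialgebraic \<Gamma>" and J: "J \<subseteq> Basis"
    and int: "interior (cyl J \<Gamma>) \<noteq> {}"
  obtains \<Gamma>' where "\<Gamma>' \<subseteq> \<Gamma>" "compact \<Gamma>'" "semialgebraic \<Gamma>'" "interior (cyl J \<Gamma>') \<noteq> {}"
    and "\<And>w w'. w \<in> \<Gamma>' \<Longrightarrow> w' \<in> \<Gamma>' \<Longrightarrow> \<forall>c\<in>J. w \<bullet> c = w' \<bullet> c \<Longrightarrow> w \<bullet> b = w' \<bullet> b"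
proof -
  have finJ: "finite J" using J finite_subset finite_Basis by blast
  \<comment> \<open>C q is the set where the fibrewise minimum of w \<bullet> b is at most q. Its
    closedness is lower semicontinuity of the minimum.\<close>
  define C where "C q = cyl J (\<Gamma> \<inter> {w. w \<bullet> b \<le> q})" for q
  have cC: "closed (C q)" for q
    unfolding C_def by (intro closed_cyl[OF _ J] compact_Int_closed \<Gamma> closed_halfspace_component_le)
  have mono: "C q \<subseteq> C q'" if "q \<le> q'" for q q'
    using that unfolding C_def cyl_def by fastforce
  define A where "A = {y :: real \<times> 'a. snd y \<in> C (fst y)}"
  have sA: "semialgebraic A"
  proof -
    have "semialgebraic {y :: real \<times> 'a. snd y \<in> \<Gamma> \<and> snd y \<bullet> b \<le> fst y}"
      by (intro semialgebraic_conj semialgebraic_le semialgebraic_vimage[OF \<Gamma>(2)] poly_intros)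
    from semialgebraic_cyl_param[OF this J] show ?thesis
      by (simp add: A_def C_def Int_def)
  qed
  \<comment> \<open>D consists of the points where upper semicontinuity of the minimum
    fails.\<close>
  define D where "D = {z. \<exists>p :: real \<times> real. fst p < snd p \<and> z \<in> C (fst p) \<and> z \<notin> interior (C (snd p))}"
  have sD: "semialgebraic D"
  proof -
    have 1: "semialgebraic {y :: real \<times> 'a. snd y \<in> interior (C (fst y))}"
      using semialgebraic_interior_param[OF sA] by (simp add: A_def)
    have "semialgebraic {z. \<exists>p :: real \<times> real. fst p < snd p \<and> (fst p, z) \<in> A \<and>
        \<not> (snd p, z) \<in> {y :: real \<times> 'a. snd y \<in> interior (C (fst y))}}"
      by (intro semialgebraic_exI semialgebraic_conj semialgebraic_gt semialgebraic_not
          semialgebraic_vimage[OF sA] semialgebraic_vimage[OF 1] poly_intros)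
    then show ?thesis by (simp add: D_def A_def)
  qed
  \<comment> \<open>Rational levels suffice, so D is covered by countably many frontiers of closed
    sets, none of which has interior.\<close>
  have "D \<subseteq> (\<Union>a\<in>\<rat>. frontier (C a))"
  proof
    fix z assume "z \<in> D"
    then obtain q q' where q: "q < q'" "z \<in> C q" "z \<notin> interior (C q')" unfolding D_def by auto
    obtain a where a: "a \<in> \<rat>" "q < a" "a < q'" using Rats_dense_in_real[OF q(1)] by blast
    have "z \<in> C a" using mono[of q a] a q by auto
    moreover have "z \<notin> interior (C a)" using interior_mono[OF mono[of a q']] a q by auto
    ultimately show "z \<in> (\<Union>a\<in>\<rat>. frontier (C a))"
      using a cC by (auto simp: frontier_def)
  qed
  moreover have "interior (\<Union>a\<in>\<rat>. frontier (C a)) = {}"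
  proof (rule interior_countable_Union_thin)
    show "interior (frontier (C a)) = {}" for a
    proof -
      have "interior (frontier (C a)) \<subseteq> interior (C a)"
        using cC by (intro interior_mono) (simp add: frontier_subset_closed)
      moreover have "interior (frontier (C a)) \<inter> interior (C a) = {}"
        using interior_subset[of "frontier (C a)"] by (auto simp: frontier_def)
      ultimately show ?thesis by blast
    qed
  qed (auto simp: countable_rat)
  ultimately have "interior D = {}" by (metis interior_mono subset_empty)
  with sD obtain P where P: "real_polynomial_function P" "\<exists>x. P x \<noteq> 0" "\<forall>x\<in>D. P x = 0"
    using semialgebraic_thin by blast
  \<comment> \<open>U is disjoint from D, so the minimum is continuous there.\<close>
  define U where "U = interior (cyl J \<Gamma>) \<inter> {x. P x \<noteq> 0}"
  have "open U" unfolding U_def by (intro open_Int open_interior open_nonzero P)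
  moreover have "U \<noteq> {}"
  proof
    assume "U = {}"
    then have "P x = 0" if "x \<in> interior (cyl J \<Gamma>)" for x using that by (auto simp: U_def)
    then have "P x = 0" for x by (rule real_polynomial_function_eq_0[OF P(1) open_interior int])
    with P(2) show False by blast
  qed
  ultimately obtain z1 \<epsilon> where \<epsilon>: "0 < \<epsilon>" "cball z1 \<epsilon> \<subseteq> U"
    by (meson all_not_in_conv open_contains_cball_eq)
  \<comment> \<open>\<zeta> replaces the coordinates outside J by those of z1. Requiring \<zeta> w
    to lie in the ball around z1 thus restricts only the coordinates in J and ensures that \<zeta> w
    is not in D.\<close>
  define \<zeta> where "\<zeta> w = z1 + restr J (w - z1)" for w
  have \<zeta>J: "\<zeta> w \<bullet> c = w \<bullet> c" if "c \<in> J" for w c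
    using inner_restr[OF J, of c "w - z1"] that J by (auto simp: \<zeta>_def inner_add_left inner_diff_left)
  have cont\<zeta>: "continuous_on S \<zeta>" for S unfolding \<zeta>_def by (intro continuous_intros)
  have cyl\<zeta>: "z \<in> cyl J M \<longleftrightarrow> \<zeta> z \<in> cyl J M" for z M unfolding cyl_def using \<zeta>J by simp
  have \<zeta>eq: "\<zeta> w = \<zeta> z" if "\<forall>c\<in>J. w \<bullet> c = z \<bullet> c" for w z
    unfolding \<zeta>_def using that by (simp add: restr_eq_iff[OF J] inner_diff_left)
  define \<Gamma>' where "\<Gamma>' = {w. w \<in> \<Gamma> \<and> (\<zeta> w - z1) \<bullet> (\<zeta> w - z1) \<le> \<epsilon>\<^sup>2 \<and>
    (\<forall>w'. w' \<in> \<Gamma> \<and> (\<forall>c\<in>J. w \<bullet> c = w' \<bullet> c) \<longrightarrow> w \<bullet> b \<le> w' \<bullet> b)}"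
  have ball: "(\<zeta> w - z1) \<bullet> (\<zeta> w - z1) \<le> \<epsilon>\<^sup>2 \<longleftrightarrow> \<zeta> w \<in> cball z1 \<epsilon>" for w
    using \<epsilon>(1) by (simp add: dist_norm norm_minus_commute power2_norm_eq_inner[symmetric])
  have "semialgebraic \<Gamma>'"
    unfolding \<Gamma>'_def \<zeta>_def restr_def
    by (intro semialgebraic_conj semialgebraic_allI semialgebraic_imp semialgebraic_le
        semialgebraic_eq semialgebraic_all_finite[OF finJ] semialgebraic_vimage[OF \<Gamma>(2)] poly_intros pf_of_rpf finJ)
  moreover have "\<Gamma>' \<subseteq> \<Gamma>" by (auto simp: \<Gamma>'_def)
  moreover have "closed \<Gamma>'"
  proof (unfold closed_sequential_limits, intro allI impI, elim conjE)
    fix u w assume u: "\<forall>n. u n \<in> \<Gamma>'" and lim: "u \<longlonglongrightarrow> w"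
    have "closed \<Gamma>" using \<Gamma>(1) by (rule compact_imp_closed)
    then have w: "w \<in> \<Gamma>" using u lim \<open>\<Gamma>' \<subseteq> \<Gamma>\<close> unfolding closed_sequential_limits by blast
    have \<zeta>lim: "(\<lambda>n. \<zeta> (u n)) \<longlonglongrightarrow> \<zeta> w"
      using cont\<zeta>[of UNIV] lim by (simp add: continuous_on_tendsto_compose)
    have "\<zeta> (u n) \<in> cball z1 \<epsilon>" for n using u ball unfolding \<Gamma>'_def by blast
    then have \<zeta>w: "\<zeta> w \<in> cball z1 \<epsilon>" using closed_sequentially[OF closed_cball _ \<zeta>lim] by blast
    \<comment> \<open>If the limit w of minimal points were not minimal, a level q below w \<bullet>
      b would be reached over a neighbourhood of \<zeta> w, hence in the fibres of almost all u n,
      and their values could not tend to w \<bullet> b.\<close>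
    have "w \<bullet> b \<le> w' \<bullet> b" if w': "w' \<in> \<Gamma>" "\<forall>c\<in>J. w \<bullet> c = w' \<bullet> c" for w'
    proof (rule ccontr)
      assume "\<not> w \<bullet> b \<le> w' \<bullet> b"
      then obtain q where q: "w' \<bullet> b < q" "q < w \<bullet> b" using dense by (meson not_le)
      have "\<zeta> w \<in> C (w' \<bullet> b)" unfolding C_def cyl_def using w' \<zeta>J by auto
      moreover have "\<zeta> w \<notin> D" using \<epsilon>(2) \<zeta>w P(3) by (auto simp: U_def)
      ultimately have "\<zeta> w \<in> interior (C q)" unfolding D_def using q(1) by auto
      then have "\<forall>\<^sub>F n in sequentially. \<zeta> (u n) \<in> interior (C q)"
        using \<zeta>lim open_interior by (simp add: tendsto_def)
      then have "\<forall>\<^sub>F n in sequentially. u n \<bullet> b \<le> q"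
      proof (rule eventually_mono)
        fix n assume "\<zeta> (u n) \<in> interior (C q)"
        then have "\<zeta> (u n) \<in> C q" using interior_subset by blast
        then obtain v where v: "v \<in> \<Gamma>" "v \<bullet> b \<le> q" "\<forall>c\<in>J. v \<bullet> c = u n \<bullet> c"
          unfolding C_def cyl_def using \<zeta>J by auto
        then have "u n \<bullet> b \<le> v \<bullet> b" using u unfolding \<Gamma>'_def by auto
        with v show "u n \<bullet> b \<le> q" by simp
      qed
      moreover have "(\<lambda>n. u n \<bullet> b) \<longlonglongrightarrow> w \<bullet> b" using lim by (intro tendsto_intros)
      ultimately have "w \<bullet> b \<le> q" by (intro tendsto_upperbound[of _ "w \<bullet> b" sequentially]) auto
      with q show False by simp
    qed
    with w \<zeta>w show "w \<in> \<Gamma>'" unfolding \<Gamma>'_def ball by blast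
  qed
  moreover have "compact \<Gamma>'"
    using \<open>closed \<Gamma>'\<close> \<open>\<Gamma>' \<subseteq> \<Gamma>\<close> \<Gamma>(1) by (metis compact_Int_closed inf.absorb2)
  moreover have "interior (cyl J \<Gamma>') \<noteq> {}"
  proof -
    define V where "V = {z. dist z1 (\<zeta> z) < \<epsilon>}"
    have "open V" unfolding V_def by (intro open_Collect_less continuous_intros cont\<zeta>)
    moreover have "z1 \<in> V" using \<epsilon>(1) by (simp add: V_def \<zeta>_def restr_def)
    moreover have "V \<subseteq> cyl J \<Gamma>'"
    proof
      fix z assume "z \<in> V"
      then have z: "\<zeta> z \<in> cball z1 \<epsilon>" by (simp add: V_def)
      then have "\<zeta> z \<in> interior (cyl J \<Gamma>)" using \<epsilon>(2) by (auto simp: U_def)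
      then have "z \<in> cyl J \<Gamma>" using cyl\<zeta> interior_subset by blast
      define K where "K = \<Gamma> \<inter> {w. \<forall>c\<in>J. w \<bullet> c = z \<bullet> c}"
      have "closed {w. \<forall>c\<in>J. w \<bullet> c = z \<bullet> c}"
        unfolding Collect_ball_eq by (intro closed_INT ballI closed_Collect_eq continuous_intros)
      then have "compact K" unfolding K_def by (intro compact_Int_closed \<Gamma>)
      moreover have "K \<noteq> {}" using \<open>z \<in> cyl J \<Gamma>\<close> unfolding K_def cyl_def by auto
      moreover have "continuous_on K (\<lambda>w. w \<bullet> b)" by (intro continuous_intros)
      ultimately obtain w where w: "w \<in> K" "\<And>v. v \<in> K \<Longrightarrow> w \<bullet> b \<le> v \<bullet> b"
        using continuous_attains_inf[of K "\<lambda>w. w \<bullet> b"] by blast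
      have "\<zeta> w = \<zeta> z" using w(1) by (intro \<zeta>eq) (simp add: K_def)
      then have "w \<in> \<Gamma>'" unfolding \<Gamma>'_def ball using w z by (auto simp: K_def)
      then show "z \<in> cyl J \<Gamma>'" using w(1) unfolding cyl_def K_def by auto
    qed
    ultimately show ?thesis using interior_maximal by blast
  qed
  moreover have "w \<bullet> b = w' \<bullet> b" if "w \<in> \<Gamma>'" "w' \<in> \<Gamma>'" "\<forall>c\<in>J. w \<bullet> c = w' \<bullet> c" for w w'
    using that unfolding \<Gamma>'_def by (auto intro!: antisym)
  ultimately show ?thesis using that[of \<Gamma>'] by blast
qed

text \<open>Minimising one coordinate after the other leaves at most one point in each fibre, as
  what an earlier step made unique stays unique on subsets.\<close>

lemma select_section:
  fixes \<Gamma> :: "'a::euclidean_space set"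
  assumes \<Gamma>: "compact \<Gamma>" "semialgebraic \<Gamma>" and J: "J \<subseteq> Basis"
    and int: "interior (cyl J \<Gamma>) \<noteq> {}"
  obtains \<Gamma>' where "\<Gamma>' \<subseteq> \<Gamma>" "compact \<Gamma>'" "semialgebraic \<Gamma>'" "interior (cyl J \<Gamma>') \<noteq> {}"
    and "\<And>w w'. w \<in> \<Gamma>' \<Longrightarrow> w' \<in> \<Gamma>' \<Longrightarrow> \<forall>c\<in>J. w \<bullet> c = w' \<bullet> c \<Longrightarrow> w = w'"
proof -
  have "\<exists>\<Gamma>'\<subseteq>\<Gamma>. compact \<Gamma>' \<and> semialgebraic \<Gamma>' \<and> interior (cyl J \<Gamma>') \<noteq> {} \<and>
      (\<forall>b\<in>B. \<forall>w\<in>\<Gamma>'. \<forall>w'\<in>\<Gamma>'. (\<forall>c\<in>J. w \<bullet> c = w' \<bullet> c) \<longrightarrow> w \<bullet> b = w' \<bullet> b)"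
    if "finite B" for B :: "'a set" using that
  proof (induction B rule: finite_induct)
    case empty
    show ?case using assms by blast
  next
    case (insert b B)
    then obtain \<Gamma>1 where 1: "\<Gamma>1 \<subseteq> \<Gamma>" "compact \<Gamma>1" "semialgebraic \<Gamma>1" "interior (cyl J \<Gamma>1) \<noteq> {}"
      "\<forall>b\<in>B. \<forall>w\<in>\<Gamma>1. \<forall>w'\<in>\<Gamma>1. (\<forall>c\<in>J. w \<bullet> c = w' \<bullet> c) \<longrightarrow> w \<bullet> b = w' \<bullet> b" by blast
    obtain \<Gamma>2 where 2: "\<Gamma>2 \<subseteq> \<Gamma>1" "compact \<Gamma>2" "semialgebraic \<Gamma>2" "interior (cyl J \<Gamma>2) \<noteq> {}"
      "\<And>w w'. w \<in> \<Gamma>2 \<Longrightarrow> w' \<in> \<Gamma>2 \<Longrightarrow> \<forall>c\<in>J. w \<bullet> c = w' \<bullet> c \<Longrightarrow> w \<bullet> b = w' \<bullet> b"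
      using select_min[OF 1(2,3) J 1(4), of b] by blast
    have "\<forall>e\<in>insert b B. \<forall>w\<in>\<Gamma>2. \<forall>w'\<in>\<Gamma>2. (\<forall>c\<in>J. w \<bullet> c = w' \<bullet> c) \<longrightarrow> w \<bullet> e = w' \<bullet> e"
      using 1(5) 2(1,5) by blast
    with 1(1) 2 show ?case by (intro exI[of _ \<Gamma>2]) blast
  qed
  from this[OF finite_Basis] obtain \<Gamma>' where \<Gamma>': "\<Gamma>' \<subseteq> \<Gamma>" "compact \<Gamma>'" "semialgebraic \<Gamma>'"
    "interior (cyl J \<Gamma>') \<noteq> {}"
    "\<forall>b\<in>Basis. \<forall>w\<in>\<Gamma>'. \<forall>w'\<in>\<Gamma>'. (\<forall>c\<in>J. w \<bullet> c = w' \<bullet> c) \<longrightarrow> w \<bullet> b = w' \<bullet> b" by blast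
  show ?thesis by (rule that[OF \<Gamma>'(1-4)]) (use \<Gamma>'(5) in \<open>blast intro: euclidean_eqI\<close>)
qed


section \<open>Semialgebraic maps and cells\<close>

lemma semialgebraic_map_iff: "semialgebraic_map S f \<longleftrightarrow> semialgebraic {z. fst z \<in> S \<and> snd z = f (fst z)}"
proof -
  have "(\<lambda>x. (x, f x)) ` S = {z. fst z \<in> S \<and> snd z = f (fst z)}" by (auto simp: image_iff)
  then show ?thesis by (simp add: semialgebraic_map_def)
qed

lemma semialgebraic_map_compose:
  assumes f: "semialgebraic_map S f" and g: "semialgebraic_map T g" and "f ` S \<subseteq> T"
  shows "semialgebraic_map S (\<lambda>x. g (f x))"
proof -
  have "semialgebraic {z. \<exists>y. (fst z, y) \<in> {z. fst z \<in> S \<and> snd z = f (fst z)} \<and>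
      (y, snd z) \<in> {z. fst z \<in> T \<and> snd z = g (fst z)}}"
    by (intro semialgebraic_exI semialgebraic_conj semialgebraic_vimage[OF f[unfolded semialgebraic_map_iff]]
        semialgebraic_vimage[OF g[unfolded semialgebraic_map_iff]] poly_intros)
  moreover have "{z. \<exists>y. (fst z, y) \<in> {z. fst z \<in> S \<and> snd z = f (fst z)} \<and>
      (y, snd z) \<in> {z. fst z \<in> T \<and> snd z = g (fst z)}} = {z. fst z \<in> S \<and> snd z = g (f (fst z))}"
    using assms(3) by auto
  ultimately show ?thesis unfolding semialgebraic_map_iff by simp
qed

lemma semialgebraic_vec_eq:
  fixes f g :: "'a::euclidean_space \<Rightarrow> 'b::euclidean_space"
  assumes "polynomial_function f" "polynomial_function g"
  shows "semialgebraic {x. f x = g x}"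
proof -
  have "semialgebraic {x. \<forall>b\<in>Basis. f x \<bullet> b = g x \<bullet> b}"
    by (intro semialgebraic_all_finite semialgebraic_eq poly_intros assms finite_Basis)
  then show ?thesis by (simp add: euclidean_eq_iff[of "f _"])
qed

lemma semialgebraic_map_polynomial:
  assumes "semialgebraic S" "polynomial_function f"
  shows "semialgebraic_map S f"
  unfolding semialgebraic_map_iff
  by (intro semialgebraic_conj semialgebraic_vimage[OF assms(1)] semialgebraic_vec_eq poly_intros
      polynomial_function_compose[unfolded o_def, OF _ assms(2)])

lemma semialgebraic_map_inverse:
  assumes "semialgebraic_map S f" "\<And>x. x \<in> S \<Longrightarrow> g (f x) = x"
  shows "semialgebraic_map (f ` S) g"
proof -
  have "semialgebraic {z. (snd z, fst z) \<in> {z. fst z \<in> S \<and> snd z = f (fst z)}}"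
    by (intro semialgebraic_vimage[OF assms(1)[unfolded semialgebraic_map_iff]] poly_intros)
  moreover have "{z. (snd z, fst z) \<in> {z. fst z \<in> S \<and> snd z = f (fst z)}} =
      {z. fst z \<in> f ` S \<and> snd z = g (fst z)}" using assms(2) by auto
  ultimately show ?thesis by (simp add: semialgebraic_map_iff)
qed

lemma semialgebraic_map_image:
  assumes "semialgebraic_map S f"
  shows "semialgebraic (f ` S)"
proof -
  have "semialgebraic {y. \<exists>x. (x, y) \<in> {z. fst z \<in> S \<and> snd z = f (fst z)}}"
    by (intro semialgebraic_exI semialgebraic_vimage[OF assms[unfolded semialgebraic_map_iff]] poly_intros)
  moreover have "{y. \<exists>x. (x, y) \<in> {z. fst z \<in> S \<and> snd z = f (fst z)}} = f ` S" by auto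
  ultimately show ?thesis by simp
qed

lemma semialgebraic_map_domain:
  assumes "semialgebraic_map S f"
  shows "semialgebraic S"
proof -
  have "semialgebraic {x. \<exists>y. (x, y) \<in> {z. fst z \<in> S \<and> snd z = f (fst z)}}"
    by (intro semialgebraic_exI semialgebraic_vimage[OF assms[unfolded semialgebraic_map_iff]] poly_intros)
  then show ?thesis by simp
qed

lemma semialgebraic_map_subset:
  assumes f: "semialgebraic_map S f" and T: "semialgebraic T" "T \<subseteq> S"
  shows "semialgebraic_map T f"
proof -
  have "semialgebraic {z. z \<in> {z. fst z \<in> S \<and> snd z = f (fst z)} \<and> fst z \<in> T}"
    by (intro semialgebraic_conj semialgebraic_vimage[OF T(1)]
        semialgebraic_vimage[OF f[unfolded semialgebraic_map_iff]] poly_intros)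
  moreover have "{z. z \<in> {z. fst z \<in> S \<and> snd z = f (fst z)} \<and> fst z \<in> T} =
      {z. fst z \<in> T \<and> snd z = f (fst z)}" using T(2) by auto
  ultimately show ?thesis by (simp add: semialgebraic_map_iff)
qed

lemma semialgebraic_open_cube: "semialgebraic (open_cube I)"
proof -
  have "semialgebraic {x :: real ^ 'a. if i \<in> I then 0 < x $ i \<and> x $ i < 1 else x $ i = 0}" for i
    by (cases "i \<in> I") (simp_all, (intro semialgebraic_conj semialgebraic_gt semialgebraic_eq poly_intros)+)
  then have "semialgebraic {x :: real ^ 'a. \<forall>i\<in>UNIV. if i \<in> I then 0 < x $ i \<and> x $ i < 1 else x $ i = 0}"
    by (intro semialgebraic_all_finite) simp
  then show ?thesis by (simp add: open_cube_def)
qed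

lemma polynomial_function_vecI:
  assumes "\<And>i. real_polynomial_function (\<lambda>x. g x $ i)"
  shows "polynomial_function (g :: 'a::euclidean_space \<Rightarrow> real ^ 'n)"
  unfolding polynomial_function_iff_Basis_inner
  using assms by (auto simp: Basis_vec_def inner_axis real_polynomial_function_eq)

lemma norm_restr_le:
  assumes "J \<subseteq> Basis" "\<And>c. c \<in> J \<Longrightarrow> \<bar>w \<bullet> c\<bar> \<le> \<delta>"
  shows "norm (restr J w) \<le> real (card J) * \<delta>"
proof -
  have "norm (restr J w) \<le> (\<Sum>c\<in>J. norm ((w \<bullet> c) *\<^sub>R c))" unfolding restr_def by (rule norm_sum)
  also have "\<dots> \<le> (\<Sum>c\<in>J. \<delta>)" using assms by (intro sum_mono) (auto simp: subset_iff)
  finally show ?thesis by simp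
qed

text \<open>On the compact section \<Gamma>' the projection q to the coordinates in J is injective,
  hence a homeomorphism onto its image. The image contains a box, which the scaling built into q
  turns into the unit cube.\<close>

lemma interior_cyl_imp_cell:
  fixes \<Gamma> :: "'a::euclidean_space set" and I :: "'n::finite set"
  assumes \<Gamma>: "compact \<Gamma>" "semialgebraic \<Gamma>" and J: "J \<subseteq> Basis"
    and int: "interior (cyl J \<Gamma>) \<noteq> {}" and \<beta>: "bij_betw \<beta> I J"
  obtains T h q where "T \<subseteq> \<Gamma>" "homeomorphism (open_cube I) T h q"
    "semialgebraic_map (open_cube I) h" "semialgebraic_map T q"
proof -
  obtain \<Gamma>' where \<Gamma>': "\<Gamma>' \<subseteq> \<Gamma>" "compact \<Gamma>'" "semialgebraic \<Gamma>'" "interior (cyl J \<Gamma>') \<noteq> {}"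
    and single: "\<And>w w'. w \<in> \<Gamma>' \<Longrightarrow> w' \<in> \<Gamma>' \<Longrightarrow> \<forall>c\<in>J. w \<bullet> c = w' \<bullet> c \<Longrightarrow> w = w'"
    using select_section[OF \<Gamma> J int] by blast
  obtain z1 \<epsilon> where \<epsilon>: "0 < \<epsilon>" "ball z1 \<epsilon> \<subseteq> cyl J \<Gamma>'"
    using \<Gamma>'(4) by (meson all_not_in_conv mem_interior)
  \<comment> \<open>The points of a box with sides \<delta> at z1 have distance at most card J *
    \<delta> from z1; adding 1 in the denominator keeps this below \<epsilon>, also for empty
    J.\<close>
  define \<delta> where "\<delta> = \<epsilon> / (real (card J) + 1)"
  have \<delta>: "0 < \<delta>" "real (card J) * \<delta> < \<epsilon>" using \<epsilon>(1) by (auto simp: \<delta>_def field_simps)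
  define q :: "'a \<Rightarrow> real ^ 'n"
    where "q w = (\<chi> i. if i \<in> I then (w \<bullet> \<beta> i - z1 \<bullet> \<beta> i) / \<delta> else 0)" for w
  have q_nth: "q w $ i = (if i \<in> I then (w \<bullet> \<beta> i - z1 \<bullet> \<beta> i) / \<delta> else 0)" for w i
    by (simp add: q_def)
  have pq: "polynomial_function q"
  proof (rule polynomial_function_vecI)
    show "real_polynomial_function (\<lambda>w. q w $ i)" for i
      unfolding q_nth by (cases "i \<in> I") (simp_all add: divide_inverse, (intro poly_intros)+)
  qed
  have inj: "inj_on q \<Gamma>'"
  proof (rule inj_onI, rule single)
    fix w w' assume "q w = q w'"
    then show "\<forall>c\<in>J. w \<bullet> c = w' \<bullet> c"
    proof (intro ballI)
      fix c assume "c \<in> J"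
      then obtain i where i: "i \<in> I" "c = \<beta> i" using \<beta> by (auto simp: bij_betw_def)
      with arg_cong[OF \<open>q w = q w'\<close>, of "\<lambda>x. x $ i"] \<delta>(1) show "w \<bullet> c = w' \<bullet> c"
        by (simp add: q_nth)
    qed
  qed
  have cont: "continuous_on S q" for S using pq by (rule continuous_on_polymonial_function)
  obtain h where h: "homeomorphism \<Gamma>' (q ` \<Gamma>') q h"
    using homeomorphism_compact[OF \<Gamma>'(2) cont refl inj] by blast
  have cube: "open_cube I \<subseteq> q ` \<Gamma>'"
  proof
    fix x assume x: "x \<in> open_cube I"
    define z where "z = z1 + (\<Sum>i\<in>I. (\<delta> * x $ i) *\<^sub>R \<beta> i)"
    have xi: "0 < x $ i \<and> x $ i < 1" if "i \<in> I" for i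
      using x that unfolding open_cube_def by (metis (mono_tags, lifting) mem_Collect_eq)
    have \<beta>B: "\<beta> i \<in> Basis" if "i \<in> I" for i using \<beta> J that by (auto simp: bij_betw_def)
    have zi: "z \<bullet> \<beta> i = z1 \<bullet> \<beta> i + \<delta> * x $ i" if "i \<in> I" for i
    proof -
      have "(\<Sum>j\<in>I. (\<delta> * x $ j) *\<^sub>R \<beta> j) \<bullet> \<beta> i = (\<Sum>j\<in>I. if j = i then \<delta> * x $ j else 0)"
        unfolding inner_sum_left using \<beta>B that \<beta>
        by (intro sum.cong) (auto simp: inner_Basis bij_betw_def inj_on_def)
      then show ?thesis using that by (simp add: z_def inner_add_left)
    qed
    have zJ: "\<bar>(z - z1) \<bullet> c\<bar> \<le> \<delta>" if c: "c \<in> J" for c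
    proof -
      obtain i where i: "i \<in> I" "c = \<beta> i" using \<beta> c by (auto simp: bij_betw_def)
      then show ?thesis using zi[OF i(1)] xi[OF i(1)] \<delta>(1)
        by (simp add: inner_diff_left abs_mult mult_le_cancel_left2)
    qed
    have "dist z1 (z1 + restr J (z - z1)) < \<epsilon>"
      using norm_restr_le[OF J zJ] \<delta>(2) by (simp add: dist_norm)
    then have "z1 + restr J (z - z1) \<in> cyl J \<Gamma>'" using \<epsilon>(2) by auto
    then obtain w where w: "w \<in> \<Gamma>'" "\<And>c. c \<in> J \<Longrightarrow> w \<bullet> c = z1 \<bullet> c + restr J (z - z1) \<bullet> c"
      unfolding cyl_def by (auto simp: inner_add_left)
    have "w \<bullet> c = z \<bullet> c" if "c \<in> J" for c
      using w(2)[OF that] inner_restr[OF J, of c "z - z1"] that J by (auto simp: inner_diff_left)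
    then have "q w = x"
    proof (intro vec_eq_iff[THEN iffD2] allI)
      fix i assume wz: "\<And>c. c \<in> J \<Longrightarrow> w \<bullet> c = z \<bullet> c"
      show "q w $ i = x $ i"
      proof (cases "i \<in> I")
        case True
        then have "w \<bullet> \<beta> i = z \<bullet> \<beta> i" using wz \<beta> by (auto simp: bij_betw_def)
        then show ?thesis using True zi[OF True] \<delta>(1) by (simp add: q_nth)
      next
        case False
        then have "x $ i = 0" using x unfolding open_cube_def by (metis (mono_tags, lifting) mem_Collect_eq)
        then show ?thesis using False by (simp add: q_nth)
      qed
    qed
    with w(1) show "x \<in> q ` \<Gamma>'" by blast
  qed
  define T where "T = h ` open_cube I"
  have hom: "homeomorphism (open_cube I) T h q"
    by (rule homeomorphism_of_subsets[OF homeomorphism_symD[OF h] cube subset_refl T_def[symmetric]])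
  have hq: "h (q w) = w" if "w \<in> \<Gamma>'" for w using homeomorphism_apply1[OF h that] .
  have qh: "q (h x) = x" "h x \<in> \<Gamma>'" if "x \<in> open_cube I" for x
  proof -
    have *: "x \<in> q ` \<Gamma>'" using cube that by (rule subsetD)
    show "q (h x) = x" by (rule homeomorphism_apply2[OF h *])
    show "h x \<in> \<Gamma>'" using imageI[OF *, of h] unfolding homeomorphism_image2[OF h] .
  qed
  have "T = {w. w \<in> \<Gamma>' \<and> q w \<in> open_cube I}"
  proof
    show "T \<subseteq> {w. w \<in> \<Gamma>' \<and> q w \<in> open_cube I}" using qh unfolding T_def by auto
    show "{w. w \<in> \<Gamma>' \<and> q w \<in> open_cube I} \<subseteq> T" using hq unfolding T_def by force
  qed
  moreover have "semialgebraic {w. w \<in> \<Gamma>' \<and> q w \<in> open_cube I}"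
    by (intro semialgebraic_conj semialgebraic_vimage[OF \<Gamma>'(3)] semialgebraic_vimage[OF semialgebraic_open_cube]
        poly_intros pq)
  ultimately have T: "semialgebraic T" "T \<subseteq> \<Gamma>" using \<Gamma>'(1) by auto
  have sq: "semialgebraic_map T q" by (rule semialgebraic_map_polynomial[OF T(1) pq])
  have "semialgebraic_map (q ` T) h"
    by (rule semialgebraic_map_inverse[OF sq]) (use hom in \<open>simp add: homeomorphism_def\<close>)
  moreover have "q ` T = open_cube I" using hom by (simp add: homeomorphism_def)
  ultimately show ?thesis using that[OF T(2) hom] sq by simp
qed

text \<open>\<open>fst\<close> maps a cell in the graph to a cell in X, with the graph map as
  inverse. J may mix coordinates of x and of f x; I carries the number card J, since
  \<open>open_cube\<close> lives in the space of x.\<close>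

lemma semialgebraic_dim_ge:
  fixes X :: "(real ^ 'n::finite) set" and f :: "real ^ 'n \<Rightarrow> 'b::euclidean_space" and I :: "'n set"
  assumes X: "compact X" "X \<subseteq> A" and f: "continuous_on X f" "semialgebraic_map X f"
    and J: "J \<subseteq> Basis" "card J = card I" and int: "interior (cyl J ((\<lambda>x. (x, f x)) ` X)) \<noteq> {}"
  shows "card I \<le> semialgebraic_dim A"
proof -
  let ?\<Gamma> = "(\<lambda>x. (x, f x)) ` X"
  have contg: "continuous_on X (\<lambda>x. (x, f x))" by (intro continuous_intros f)
  have "finite J" using J finite_subset finite_Basis by blast
  then obtain \<beta> where \<beta>: "bij_betw \<beta> I J" using J(2) by (metis bij_betw_iff_card finite)
  obtain T h q where T: "T \<subseteq> ?\<Gamma>" and hom: "homeomorphism (open_cube I) T h q"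
    and sh: "semialgebraic_map (open_cube I) h" and sq: "semialgebraic_map T q"
    using interior_cyl_imp_cell[OF compact_continuous_image[OF contg X(1)]
        f(2)[unfolded semialgebraic_map_def] J(1) int \<beta>] by blast
  have "homeomorphism T (fst ` T) fst (\<lambda>x. (x, f x))"
  proof (rule homeomorphismI)
    show "continuous_on T fst" by (intro continuous_intros)
    show "continuous_on (fst ` T) (\<lambda>x. (x, f x))" using T by (intro continuous_on_subset[OF contg]) auto
  qed (use T in auto)
  from homeomorphism_compose[OF hom this]
  have "homeomorphism (open_cube I) (fst ` T) (fst \<circ> h) (q \<circ> (\<lambda>x. (x, f x)))" .
  moreover have "fst ` T \<subseteq> A" using T X by auto
  moreover have sT: "semialgebraic_map T fst"
    by (intro semialgebraic_map_polynomial semialgebraic_map_domain[OF sq] poly_intros)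
  moreover have "semialgebraic_map (open_cube I) (fst \<circ> h)"
    unfolding o_def by (rule semialgebraic_map_compose[OF sh sT]) (use hom in \<open>simp add: homeomorphism_def\<close>)
  moreover have "semialgebraic_map (fst ` T) (q \<circ> (\<lambda>x. (x, f x)))"
    unfolding o_def
  proof (rule semialgebraic_map_compose[OF _ sq])
    show "semialgebraic_map (fst ` T) (\<lambda>x. (x, f x))" using T by (intro semialgebraic_map_inverse[OF sT]) auto
  qed (use T in auto)
  ultimately have "card I \<in> {card I | I :: 'n set. \<exists>S h g. S \<subseteq> A \<and> homeomorphism (open_cube I) S h g \<and>
      semialgebraic_map (open_cube I) h \<and> semialgebraic_map S g}" by blast
  moreover have "finite {card I | I :: 'n set. \<exists>S h g. S \<subseteq> A \<and> homeomorphism (open_cube I) S h g \<and>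
      semialgebraic_map (open_cube I) h \<and> semialgebraic_map S g}"
    by (rule finite_subset[of _ "card ` UNIV"]) auto
  ultimately show ?thesis unfolding semialgebraic_dim_def by (rule Max_ge[rotated])
qed

section \<open>Spans of monomials\<close>

definition spanned :: "'p set \<Rightarrow> 'k set \<Rightarrow> ('k \<Rightarrow> 'p \<Rightarrow> real) \<Rightarrow> ('p \<Rightarrow> real) \<Rightarrow> bool" where
  "spanned A K b f \<longleftrightarrow> (\<exists>c. \<forall>p\<in>A. f p = (\<Sum>k\<in>K. c k * b k p))"

lemma spanned_cong: "spanned A K b f \<Longrightarrow> (\<And>p. p \<in> A \<Longrightarrow> g p = f p) \<Longrightarrow> spanned A K b g"
  unfolding spanned_def by simp

lemma spanned_base: "finite K \<Longrightarrow> k \<in> K \<Longrightarrow> spanned A K b (b k)"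
  unfolding spanned_def by (intro exI[of _ "\<lambda>j. if j = k then 1 else 0"]) (simp add: if_distrib[of "\<lambda>x. x * _"] cong: if_cong)

lemma spanned_scale:
  assumes "spanned A K b f"
  shows "spanned A K b (\<lambda>p. c * f p)"
proof -
  obtain a where "\<forall>p\<in>A. f p = (\<Sum>k\<in>K. a k * b k p)" using assms unfolding spanned_def by blast
  then show ?thesis unfolding spanned_def
    by (intro exI[of _ "\<lambda>k. c * a k"]) (simp add: sum_distrib_left mult.assoc)
qed

lemma spanned_zero: "spanned A K b (\<lambda>p. 0)"
  unfolding spanned_def by (intro exI[of _ "\<lambda>k. 0"]) simp

lemma spanned_add:
  assumes "spanned A K b f" "spanned A K b g"
  shows "spanned A K b (\<lambda>p. f p + g p)"
proof -
  obtain c d where "\<forall>p\<in>A. f p = (\<Sum>k\<in>K. c k * b k p)" "\<forall>p\<in>A. g p = (\<Sum>k\<in>K. d k * b k p)"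
    using assms unfolding spanned_def by blast
  then show ?thesis unfolding spanned_def
    by (intro exI[of _ "\<lambda>k. c k + d k"]) (simp add: sum.distrib distrib_right)
qed

lemma spanned_sum:
  "(\<And>j. j \<in> L \<Longrightarrow> spanned A K b (f j)) \<Longrightarrow> spanned A K b (\<lambda>p. \<Sum>j\<in>L. f j p)"
proof (induction L rule: infinite_finite_induct)
  case (insert j L)
  then have "spanned A K b (f j)" "spanned A K b (\<lambda>p. \<Sum>j\<in>L. f j p)" by auto
  from spanned_add[OF this] show ?case using insert(1,2) by simp
qed (simp_all add: spanned_zero)

lemma spanned_trans:
  assumes "spanned A K b f" "\<And>k. k \<in> K \<Longrightarrow> spanned A L b' (b k)"
  shows "spanned A L b' f"
proof -
  obtain c where c: "\<forall>p\<in>A. f p = (\<Sum>k\<in>K. c k * b k p)" using assms(1) unfolding spanned_def by blast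
  have "spanned A L b' (\<lambda>p. \<Sum>k\<in>K. c k * b k p)"
    by (intro spanned_sum spanned_scale assms(2))
  then show ?thesis by (rule spanned_cong) (use c in blast)
qed

lemma spanned_mult:
  assumes "spanned A K b f" "spanned A L b' g"
  shows "spanned A (K \<times> L) (\<lambda>(k, l) p. b k p * b' l p) (\<lambda>p. f p * g p)"
proof -
  obtain c d where "\<forall>p\<in>A. f p = (\<Sum>k\<in>K. c k * b k p)" "\<forall>p\<in>A. g p = (\<Sum>k\<in>L. d k * b' k p)"
    using assms unfolding spanned_def by blast
  then show ?thesis unfolding spanned_def
    by (intro exI[of _ "\<lambda>(k, l). c k * d l"])
      (simp add: sum_product sum.cartesian_product case_prod_unfold mult_ac)
qed

text \<open>Gaussian elimination: if equation k involves an unknown e0, it is solved for e0 and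
  substituted into the others.\<close>

lemma underdetermined_system:
  fixes a :: "'e \<Rightarrow> 'k \<Rightarrow> real"
  assumes "finite K" "finite E" "card K < card E"
  shows "\<exists>c. (\<exists>e\<in>E. c e \<noteq> 0) \<and> (\<forall>k\<in>K. (\<Sum>e\<in>E. c e * a e k) = 0)"
  using assms
proof (induction K arbitrary: E a rule: finite_induct)
  case empty
  then show ?case by (intro exI[of _ "\<lambda>e. 1"]) (auto simp: card_gt_0_iff)
next
  case (insert k K)
  show ?case
  proof (cases "\<forall>e\<in>E. a e k = 0")
    case True
    have "card K < card E" using insert by simp
    from insert(3)[OF insert(4) this, of a] True show ?thesis by auto
  next
    case False
    then obtain e0 where e0: "e0 \<in> E" "a e0 k \<noteq> 0" by blast
    have "card K < card (E - {e0})" using insert e0 by simp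
    from insert(3)[OF _ this, of "\<lambda>e j. a e j - a e k / a e0 k * a e0 j"] insert(4)
    obtain c e1 where c: "e1 \<in> E - {e0}" "c e1 \<noteq> 0"
      "\<forall>j\<in>K. (\<Sum>e\<in>E - {e0}. c e * (a e j - a e k / a e0 k * a e0 j)) = 0" by auto
    define s where "s = (\<Sum>e\<in>E - {e0}. c e * a e k)"
    define d where "d e = (if e = e0 then - s / a e0 k else c e)" for e
    have split: "(\<Sum>e\<in>E. d e * a e j) = - s / a e0 k * a e0 j + (\<Sum>e\<in>E - {e0}. c e * a e j)" for j
      using insert(4) e0(1) by (subst sum.remove[of E e0]) (auto simp: d_def intro!: sum.cong)
    have "(\<Sum>e\<in>E. d e * a e j) = 0" if "j \<in> insert k K" for j
    proof (cases "j = k")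
      case True
      then show ?thesis using e0(2) unfolding split by (simp add: s_def)
    next
      case False
      then have "(\<Sum>e\<in>E - {e0}. c e * (a e j - a e k / a e0 k * a e0 j)) = 0" using c(3) that by auto
      moreover have "(\<Sum>e\<in>E - {e0}. c e * (a e j - a e k / a e0 k * a e0 j)) =
          (\<Sum>e\<in>E - {e0}. c e * a e j) - s / a e0 k * a e0 j"
        unfolding s_def sum_divide_distrib sum_distrib_right sum_subtractf[symmetric]
        by (intro sum.cong) (simp_all add: algebra_simps)
      ultimately show ?thesis unfolding split by simp
    qed
    moreover have "d e1 \<noteq> 0" "e1 \<in> E" using c by (auto simp: d_def)
    ultimately show ?thesis by blast
  qed
qed

lemma spanned_dependent:
  assumes "finite K" "finite E" "card K < card E" "\<And>e. e \<in> E \<Longrightarrow> spanned A K b (f e)"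
  shows "\<exists>c. (\<exists>e\<in>E. c e \<noteq> 0) \<and> (\<forall>p\<in>A. (\<Sum>e\<in>E. c e * f e p) = 0)"
proof -
  have "\<forall>e\<in>E. \<exists>a. \<forall>p\<in>A. f e p = (\<Sum>k\<in>K. a k * b k p)"
    using assms(4) unfolding spanned_def by blast
  from bchoice[OF this] obtain a where a: "\<forall>e\<in>E. \<forall>p\<in>A. f e p = (\<Sum>k\<in>K. a e k * b k p)" by (rule exE)
  obtain c e0 where c: "e0 \<in> E" "c e0 \<noteq> 0" "\<forall>k\<in>K. (\<Sum>e\<in>E. c e * a e k) = 0"
    using underdetermined_system[OF assms(1-3), of a] by blast
  have "(\<Sum>e\<in>E. c e * f e p) = 0" if "p \<in> A" for p
  proof -
    have "(\<Sum>e\<in>E. c e * f e p) = (\<Sum>e\<in>E. \<Sum>k\<in>K. c e * a e k * b k p)"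
      using a that by (intro sum.cong) (simp_all add: sum_distrib_left mult.assoc)
    also have "\<dots> = (\<Sum>k\<in>K. (\<Sum>e\<in>E. c e * a e k) * b k p)"
      by (subst sum.swap) (simp add: sum_distrib_right)
    finally show ?thesis using c(3) by simp
  qed
  with c show ?thesis by blast
qed

text \<open>Exponents are total functions vanishing off I, so that a monomial in fewer variables is
  also one in more.\<close>

definition exponents :: "'i set \<Rightarrow> ('i \<Rightarrow> nat) set" where
  "exponents I = {e. \<forall>i. i \<notin> I \<longrightarrow> e i = 0}"

definition monom_at :: "'i set \<Rightarrow> ('i \<Rightarrow> 'p \<Rightarrow> real) \<Rightarrow> ('i \<Rightarrow> nat) \<Rightarrow> 'p \<Rightarrow> real" where
  "monom_at I \<xi> e p = (\<Prod>i\<in>I. \<xi> i p ^ e i)"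

lemma monom_at_add: "monom_at I \<xi> (\<lambda>i. e i + e' i) p = monom_at I \<xi> e p * monom_at I \<xi> e' p"
  by (simp add: monom_at_def power_add prod.distrib)

lemma finite_exponents_bounded:
  assumes "finite I"
  shows "finite {e \<in> exponents I. \<forall>i\<in>I. e i \<le> N i}" (is ?A)
    and "card {e \<in> exponents I. \<forall>i\<in>I. e i \<le> N i} = (\<Prod>i\<in>I. N i + 1)" (is ?B)
proof -
  let ?E = "{e \<in> exponents I. \<forall>i\<in>I. e i \<le> N i}"
  have "bij_betw (\<lambda>e. restrict e I) ?E (PiE I (\<lambda>i. {..N i}))"
  proof (rule bij_betw_byWitness[where f' = "\<lambda>e i. if i \<in> I then e i else 0"])
    show "\<forall>e\<in>?E. (\<lambda>i. if i \<in> I then restrict e I i else 0) = e"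
      by (auto simp: exponents_def)
    show "\<forall>e\<in>PiE I (\<lambda>i. {..N i}). restrict (\<lambda>i. if i \<in> I then e i else 0) I = e"
      by (auto simp: PiE_def extensional_def restrict_def fun_eq_iff)
  qed (auto simp: exponents_def PiE_def)
  then have "card ?E = card (PiE I (\<lambda>i. {..N i}))" "finite ?E \<longleftrightarrow> finite (PiE I (\<lambda>i. {..N i}))"
    by (simp_all add: bij_betw_same_card bij_betw_finite)
  then show ?A ?B using assms by (simp_all add: card_PiE finite_PiE)
qed

text \<open>The weights are powers t ^ idx i. Two exponents collide only if t is a root of the
  nonzero polynomial \<open>Q e e'\<close>, so all but finitely many t work; t = 0 is excluded to
  keep the weights positive.\<close>

lemma separating_weights:
  assumes "finite I" "finite E" "E \<subseteq> exponents I"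
  shows "\<exists>w :: 'i \<Rightarrow> nat. (\<forall>i. 1 \<le> w i) \<and> inj_on (\<lambda>e. \<Sum>i\<in>I. w i * e i) E"
proof -
  obtain idx :: "'i \<Rightarrow> nat" where idx: "inj_on idx I"
    using finite_imp_inj_to_nat_seg[OF assms(1)] by blast
  define Q where "Q e e' = (\<Sum>i\<in>I. Polynomial.monom (real (e i) - real (e' i)) (idx i))"
    for e e' :: "'i \<Rightarrow> nat"
  have Q0: "Q e e' \<noteq> 0" if ee: "e \<in> E" "e' \<in> E" "e \<noteq> e'" for e e'
  proof -
    obtain i where i: "e i \<noteq> e' i" using ee(3) by blast
    have "e \<in> exponents I" "e' \<in> exponents I" using ee assms(3) by blast+
    with i have "i \<in> I" unfolding exponents_def by (metis (mono_tags, lifting) mem_Collect_eq)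
    have "coeff (Q e e') (idx i) = (\<Sum>j\<in>I. if j = i then real (e j) - real (e' j) else 0)"
      unfolding Q_def coeff_sum using idx \<open>i \<in> I\<close>
      by (intro sum.cong) (auto simp: inj_on_def)
    also have "\<dots> = real (e i) - real (e' i)" using \<open>i \<in> I\<close> assms(1) by simp
    finally show ?thesis using i by auto
  qed
  define R where "R = (\<Union>(e, e')\<in>{(e, e'). e \<in> E \<and> e' \<in> E \<and> e \<noteq> e'}. {x. poly (Q e e') x = 0})"
  have "finite {(e, e'). e \<in> E \<and> e' \<in> E \<and> e \<noteq> e'}"
    by (rule finite_subset[of _ "E \<times> E"]) (use assms(2) in auto)
  then have "finite R" unfolding R_def using Q0 by (intro finite_UN_I) (auto intro: poly_roots_finite)
  then have "finite (real -` R)" by (intro finite_vimageI) (auto simp: inj_on_def)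
  then obtain t where t: "t \<notin> insert 0 (real -` R)"
    by (meson ex_new_if_finite finite_insert infinite_UNIV_nat)
  define w where "w i = t ^ idx i" for i
  have "inj_on (\<lambda>e. \<Sum>i\<in>I. w i * e i) E"
  proof (rule inj_onI, rule ccontr)
    fix e e' assume e: "e \<in> E" "e' \<in> E" "(\<Sum>i\<in>I. w i * e i) = (\<Sum>i\<in>I. w i * e' i)" "e \<noteq> e'"
    have "poly (Q e e') (real t) = (\<Sum>i\<in>I. real (w i) * real (e i)) - (\<Sum>i\<in>I. real (w i) * real (e' i))"
      by (simp add: Q_def poly_sum poly_monom w_def sum_subtractf[symmetric] algebra_simps)
    also have "\<dots> = real (\<Sum>i\<in>I. w i * e i) - real (\<Sum>i\<in>I. w i * e' i)" by simp
    also have "\<dots> = 0" using e(3) by simp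
    finally have "real t \<in> R" using e unfolding R_def by blast
    with t show False by simp
  qed
  moreover have "1 \<le> w i" for i using t by (simp add: w_def)
  ultimately show ?thesis by blast
qed

text \<open>Substituting powers of one variable for the coordinates keeps the monomials distinct.\<close>

lemma monomials_independent:
  assumes "finite I" "finite E" "E \<subseteq> exponents I"
    and zero: "\<And>x :: 'i \<Rightarrow> real. (\<Sum>e\<in>E. c e * (\<Prod>i\<in>I. x i ^ e i)) = 0" and "e \<in> E"
  shows "c e = (0::real)"
proof -
  obtain w :: "'i \<Rightarrow> nat" where w: "inj_on (\<lambda>e. \<Sum>i\<in>I. w i * e i) E"
    using separating_weights[OF assms(1-3)] by blast
  define Q where "Q = (\<Sum>e\<in>E. Polynomial.monom (c e) (\<Sum>i\<in>I. w i * e i))"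
  have "poly Q t = 0" for t
  proof -
    have "poly Q t = (\<Sum>e\<in>E. c e * (\<Prod>i\<in>I. (t ^ w i) ^ e i))"
      by (simp add: Q_def poly_sum poly_monom power_sum power_mult)
    then show ?thesis using zero[of "\<lambda>i. t ^ w i"] by simp
  qed
  then have "Q = 0" using poly_all_0_iff_0 by blast
  then have "0 = coeff Q (\<Sum>i\<in>I. w i * e i)" by simp
  also have "\<dots> = (\<Sum>e'\<in>E. if e' = e then c e' else 0)"
    unfolding Q_def coeff_sum using w \<open>e \<in> E\<close> by (intro sum.cong) (auto simp: inj_on_def)
  finally show ?thesis using assms by simp
qed


text \<open>The Zariski closure of the image of A under the coordinates \<xi> has dimension at most
  d: any d + 1 of the coordinates are algebraically dependent on A. As E lists only monomials with
  nonzero coefficient, \<open>E \<noteq> {}\<close> expresses nontriviality.\<close>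

definition alg_dim_le :: "'p set \<Rightarrow> 'i set \<Rightarrow> ('i \<Rightarrow> 'p \<Rightarrow> real) \<Rightarrow> nat \<Rightarrow> bool" where
  "alg_dim_le A I \<xi> d \<longleftrightarrow> (\<forall>J\<subseteq>I. card J = Suc d \<longrightarrow>
     (\<exists>E c. finite E \<and> E \<noteq> {} \<and> E \<subseteq> exponents J \<and> (\<forall>e\<in>E. c e \<noteq> 0) \<and>
        (\<forall>p\<in>A. (\<Sum>e\<in>E. c e * monom_at I \<xi> e p) = 0)))"

text \<open>With respect to a weight that separates the monomials of the given relations, every monomial
  reduces to those divisible by no leading monomial. In such a monomial at most \<open>d\<close> exponents are
  large, as otherwise it would be divisible by the leading monomial in \<open>d + 1\<close> of the variables.\<close>

lemma spanning_monomials: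
  fixes \<xi> :: "'i \<Rightarrow> 'p \<Rightarrow> real"
  assumes I: "finite I" and dim: "alg_dim_le A I \<xi> d"
  shows "\<exists>C. \<forall>D. \<exists>B. finite B \<and> card B \<le> C * (D + 1) ^ d \<and>
    (\<forall>e\<in>exponents I. (\<Sum>i\<in>I. e i) \<le> D \<longrightarrow> spanned A B (monom_at I \<xi>) (monom_at I \<xi> e))"
proof -
  define \<J> where "\<J> = {J. J \<subseteq> I \<and> card J = Suc d}"
  have fin\<J>: "finite \<J>" unfolding \<J>_def using I by simp
  have "\<forall>J\<in>\<J>. \<exists>Ec. finite (fst Ec) \<and> fst Ec \<noteq> {} \<and> fst Ec \<subseteq> exponents J \<and> (\<forall>e\<in>fst Ec. snd Ec e \<noteq> 0) \<and>
        (\<forall>p\<in>A. (\<Sum>e\<in>fst Ec. snd Ec e * monom_at I \<xi> e p) = 0)"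
    using dim unfolding alg_dim_le_def \<J>_def by simp
  from bchoice[OF this] obtain Ec where Ec: "\<forall>J\<in>\<J>. finite (fst (Ec J)) \<and> fst (Ec J) \<noteq> {} \<and>
      fst (Ec J) \<subseteq> exponents J \<and> (\<forall>e\<in>fst (Ec J). snd (Ec J) e \<noteq> 0) \<and>
        (\<forall>p\<in>A. (\<Sum>e\<in>fst (Ec J). snd (Ec J) e * monom_at I \<xi> e p) = 0)" by (rule exE)
  define E where "E J = fst (Ec J)" for J
  define c where "c J = snd (Ec J)" for J
  have E: "finite (E J)" "E J \<noteq> {}" "E J \<subseteq> exponents J" "\<And>e. e \<in> E J \<Longrightarrow> c J e \<noteq> 0"
    "\<And>p. p \<in> A \<Longrightarrow> (\<Sum>e\<in>E J. c J e * monom_at I \<xi> e p) = 0" if "J \<in> \<J>" for J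
    using bspec[OF Ec that] unfolding E_def c_def by auto
  have expI: "exponents J \<subseteq> exponents I" if "J \<in> \<J>" for J
    using that unfolding \<J>_def exponents_def by auto
  have EI: "(\<Union>J\<in>\<J>. E J) \<subseteq> exponents I" using E(3) expI by blast
  have finE: "finite (\<Union>J\<in>\<J>. E J)" using fin\<J> E(1) by blast
  obtain w :: "'i \<Rightarrow> nat" where w: "\<And>i. 1 \<le> w i"
    and inj: "inj_on (\<lambda>e. \<Sum>i\<in>I. w i * e i) (\<Union>J\<in>\<J>. E J)"
    using separating_weights[OF I finE EI] by blast
  define \<omega> where "\<omega> e = (\<Sum>i\<in>I. w i * e i)" for e
  have \<omega>_add: "\<omega> (\<lambda>i. e i + e' i) = \<omega> e + \<omega> e'" for e e'
    by (simp add: \<omega>_def distrib_left sum.distrib)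
  have w_le: "e i \<le> \<omega> e" if "i \<in> I" for e i
  proof -
    have "e i \<le> w i * e i" using w[of i] by simp
    also have "\<dots> \<le> \<omega> e" unfolding \<omega>_def using that I by (intro member_le_sum) auto
    finally show ?thesis .
  qed
  \<comment> \<open>The weight separates the monomials, so each relation has a single monomial of
    largest weight.\<close>
  have "\<forall>J\<in>\<J>. \<exists>m. m \<in> E J \<and> (\<forall>e\<in>E J. e \<noteq> m \<longrightarrow> \<omega> e < \<omega> m)"
  proof
    fix J assume J: "J \<in> \<J>"
    obtain m where m: "m \<in> E J" "\<And>e. e \<in> E J \<Longrightarrow> \<omega> e \<le> \<omega> m"
    proof -
      have "Max (\<omega> ` E J) \<in> \<omega> ` E J" using E(1,2)[OF J] by (intro Max_in) auto
      then obtain m where "m \<in> E J" "Max (\<omega> ` E J) = \<omega> m" by (rule imageE)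
      moreover have "\<omega> e \<le> Max (\<omega> ` E J)" if "e \<in> E J" for e
        using that E(1)[OF J] by (intro Max_ge) auto
      ultimately show thesis using that by simp
    qed
    moreover have "\<omega> e \<noteq> \<omega> m" if "e \<in> E J" "e \<noteq> m" for e
      using inj that m(1) J unfolding \<omega>_def inj_on_def by blast
    ultimately show "\<exists>m. m \<in> E J \<and> (\<forall>e\<in>E J. e \<noteq> m \<longrightarrow> \<omega> e < \<omega> m)"
      by (meson le_neq_implies_less)
  qed
  from bchoice[OF this] obtain m where
    m: "\<forall>J\<in>\<J>. m J \<in> E J \<and> (\<forall>e\<in>E J. e \<noteq> m J \<longrightarrow> \<omega> e < \<omega> (m J))" by (rule exE)
  define std where "std e \<longleftrightarrow> (\<forall>J\<in>\<J>. \<not> (\<forall>i\<in>I. m J i \<le> e i))" for e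
  define B where "B W = {e \<in> exponents I. \<omega> e \<le> W \<and> std e}" for W
  have finB: "finite (B W)" for W
    by (rule finite_subset[OF _ finite_exponents_bounded(1)[OF I, of "\<lambda>i. W"]])
      (auto simp: B_def intro: order.trans[OF w_le])
  have span: "spanned A (B W) (monom_at I \<xi>) (monom_at I \<xi> e)" if "e \<in> exponents I" "\<omega> e \<le> W" for e W
    using that
  proof (induction "\<omega> e" arbitrary: e rule: less_induct)
    case less
    show ?case
    proof (cases "std e")
      case True
      then show ?thesis using less by (intro spanned_base finB) (simp add: B_def)
    next
      case False
      then obtain J where J: "J \<in> \<J>" "\<And>i. i \<in> I \<Longrightarrow> m J i \<le> e i" unfolding std_def by blast
      define r where "r i = e i - m J i" for i
      have mJ: "m J \<in> E J" "m J \<in> exponents I" using m E(3) expI J(1) by blast+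
      have er: "e = (\<lambda>i. m J i + r i)"
      proof
        fix i show "e i = m J i + r i"
          using J(2)[of i] mJ(2) less(2) unfolding r_def exponents_def by (cases "i \<in> I") auto
      qed
      have rI: "r \<in> exponents I" using less(2) by (auto simp: exponents_def r_def)
      \<comment> \<open>The relation of J, multiplied by the monomial r and solved for its leading
        term, expresses e by monomials of smaller weight.\<close>
      have "spanned A (B W) (monom_at I \<xi>)
          (\<lambda>p. \<Sum>e'\<in>E J - {m J}. (- (c J e' / c J (m J))) * monom_at I \<xi> (\<lambda>i. e' i + r i) p)"
      proof (intro spanned_sum spanned_scale)
        fix e' assume e': "e' \<in> E J - {m J}"
        have "\<omega> (\<lambda>i. e' i + r i) < \<omega> e" using m J(1) e' unfolding er \<omega>_add by auto
        moreover have "(\<lambda>i. e' i + r i) \<in> exponents I"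
        proof -
          have "e' \<in> exponents I" using e' E(3)[OF J(1)] expI[OF J(1)] by blast
          with rI show ?thesis unfolding exponents_def by simp
        qed
        ultimately show "spanned A (B W) (monom_at I \<xi>) (monom_at I \<xi> (\<lambda>i. e' i + r i))"
          using less by auto
      qed
      then show ?thesis
      proof (rule spanned_cong)
        fix p assume p: "p \<in> A"
        define s where "s = (\<Sum>e'\<in>E J - {m J}. c J e' * monom_at I \<xi> e' p)"
        have "c J (m J) * monom_at I \<xi> (m J) p + s = 0"
          using E(5)[OF J(1) p] mJ(1) E(1)[OF J(1)] unfolding s_def by (simp add: sum.remove)
        then have mm: "monom_at I \<xi> (m J) p = - (s / c J (m J))"
          using E(4)[OF J(1) mJ(1)] by (simp add: field_simps)
        have "monom_at I \<xi> e p = monom_at I \<xi> (m J) p * monom_at I \<xi> r p"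
          unfolding er monom_at_add ..
        also have "\<dots> = (\<Sum>e'\<in>E J - {m J}. (- (c J e' / c J (m J))) * (monom_at I \<xi> e' p * monom_at I \<xi> r p))"
          unfolding mm s_def by (simp add: sum_divide_distrib sum_distrib_right sum_negf mult.assoc)
        finally show "monom_at I \<xi> e p = (\<Sum>e'\<in>E J - {m J}. (- (c J e' / c J (m J))) * monom_at I \<xi> (\<lambda>i. e' i + r i) p)"
          unfolding monom_at_add .
      qed
    qed
  qed
  obtain M where M: "1 \<le> M" "\<And>J i. J \<in> \<J> \<Longrightarrow> i \<in> I \<Longrightarrow> m J i \<le> M"
  proof
    let ?S = "(\<lambda>(J, i). m J i) ` (\<J> \<times> I)"
    have "finite ?S" using fin\<J> I by simp
    then show "m J i \<le> Max (insert 1 ?S)" if "J \<in> \<J>" "i \<in> I" for J i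
      using that by (intro Max_ge) auto
    show "1 \<le> Max (insert 1 ?S)" using \<open>finite ?S\<close> by (intro Max_ge) auto
  qed
  have cardB: "card (B W) \<le> 2 ^ card I * (M + 1) ^ card I * (W + 1) ^ d" for W
  proof -
    define N where "N S i = (if i \<in> S then W else M)" for S :: "'i set" and i
    define BS where "BS S = {e \<in> exponents I. \<forall>i\<in>I. e i \<le> N S i}" for S
    \<comment> \<open>S collects the variables with large exponent, for which only the bound W is
      used; the other exponents are bounded by M. If S contained d + 1 variables J, the leading
      monomial of J would divide e.\<close>
    have sub: "B W \<subseteq> (\<Union>S\<in>{S. S \<subseteq> I \<and> card S \<le> d}. BS S)"
    proof
      fix e assume e: "e \<in> B W"
      define S where "S = {i\<in>I. M \<le> e i}"
      have "card S \<le> d"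
      proof (rule ccontr)
        assume "\<not> card S \<le> d"
        then obtain J where J: "J \<subseteq> S" "card J = Suc d"
          by (metis Suc_leI not_le obtain_subset_with_card_n)
        then have "J \<in> \<J>" by (auto simp: \<J>_def S_def)
        moreover have "m J i \<le> e i" if "i \<in> I" for i
        proof (cases "i \<in> J")
          case True
          then show ?thesis using J(1) M(2)[OF \<open>J \<in> \<J>\<close> that] by (auto simp: S_def)
        next
          case False
          have "m J \<in> exponents J" using m E(3) \<open>J \<in> \<J>\<close> by blast
          then show ?thesis using False by (simp add: exponents_def)
        qed
        ultimately show False using e unfolding B_def std_def by blast
      qed
      moreover have "e \<in> BS S"
        using e w_le[of _ e] unfolding BS_def B_def N_def S_def by force
      moreover have "S \<subseteq> I" by (auto simp: S_def)
      ultimately show "e \<in> (\<Union>S\<in>{S. S \<subseteq> I \<and> card S \<le> d}. BS S)" by blast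
    qed
    have cBS: "card (BS S) \<le> (M + 1) ^ card I * (W + 1) ^ d" "finite (BS S)" if "S \<subseteq> I" "card S \<le> d" for S
    proof -
      have "card (BS S) = (\<Prod>i\<in>I. N S i + 1)" unfolding BS_def by (rule finite_exponents_bounded[OF I])
      also have "\<dots> = (\<Prod>i\<in>I - S. M + 1) * (\<Prod>i\<in>S. W + 1)"
        unfolding prod.subset_diff[OF that(1) I] N_def by (intro arg_cong2[where f="(*)"] prod.cong) auto
      also have "\<dots> = (M + 1) ^ card (I - S) * (W + 1) ^ card S" by simp
      also have "\<dots> \<le> (M + 1) ^ card I * (W + 1) ^ d"
        using that I by (intro mult_mono power_increasing card_mono) auto
      finally show "card (BS S) \<le> (M + 1) ^ card I * (W + 1) ^ d" .
      show "finite (BS S)" unfolding BS_def by (rule finite_exponents_bounded[OF I])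
    qed
    have finS: "finite {S. S \<subseteq> I \<and> card S \<le> d}" using I by simp
    have "card (B W) \<le> card (\<Union>S\<in>{S. S \<subseteq> I \<and> card S \<le> d}. BS S)"
      using finS cBS(2) by (intro card_mono[OF _ sub]) blast
    also have "\<dots> \<le> (\<Sum>S\<in>{S. S \<subseteq> I \<and> card S \<le> d}. card (BS S))" by (rule card_UN_le[OF finS])
    also have "\<dots> \<le> (\<Sum>S\<in>{S. S \<subseteq> I \<and> card S \<le> d}. (M + 1) ^ card I * (W + 1) ^ d)"
      using cBS(1) by (intro sum_mono) blast
    also have "\<dots> = card {S. S \<subseteq> I \<and> card S \<le> d} * ((M + 1) ^ card I * (W + 1) ^ d)" by simp
    also have "\<dots> \<le> card (Pow I) * ((M + 1) ^ card I * (W + 1) ^ d)"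
      using I by (intro mult_right_mono card_mono) auto
    finally show ?thesis using I by (simp add: card_Pow mult.assoc)
  qed
  \<comment> \<open>v converts a bound on the degree into one on the weight.\<close>
  define v where "v = (\<Sum>i\<in>I. w i) + 1"
  have \<omega>_le: "\<omega> e \<le> v * D" if "(\<Sum>i\<in>I. e i) \<le> D" for e D
  proof -
    have "\<omega> e \<le> (\<Sum>i\<in>I. v * e i)"
      unfolding \<omega>_def v_def using I by (intro sum_mono mult_right_mono trans_le_add1 member_le_sum) auto
    also have "\<dots> \<le> v * D" unfolding sum_distrib_left[symmetric] using that by simp
    finally show ?thesis .
  qed
  show ?thesis
  proof (intro exI[of _ "2 ^ card I * (M + 1) ^ card I * v ^ d"] allI)
    fix D
    have "v * D + 1 \<le> v * (D + 1)" by (simp add: v_def)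
    then have "(v * D + 1) ^ d \<le> (v * (D + 1)) ^ d" by (rule power_mono) simp
    then have "card (B (v * D)) \<le> 2 ^ card I * (M + 1) ^ card I * (v * (D + 1)) ^ d"
      by (intro order.trans[OF cardB] mult_left_mono) auto
    then have "card (B (v * D)) \<le> 2 ^ card I * (M + 1) ^ card I * v ^ d * (D + 1) ^ d"
      unfolding power_mult_distrib by (simp add: mult.assoc)
    moreover have "\<forall>e\<in>exponents I. (\<Sum>i\<in>I. e i) \<le> D \<longrightarrow>
        spanned A (B (v * D)) (monom_at I \<xi>) (monom_at I \<xi> e)"
      using span \<omega>_le by blast
    ultimately show "\<exists>B. finite B \<and> card B \<le> 2 ^ card I * (M + 1) ^ card I * v ^ d * (D + 1) ^ d \<and>
        (\<forall>e\<in>exponents I. (\<Sum>i\<in>I. e i) \<le> D \<longrightarrow> spanned A B (monom_at I \<xi>) (monom_at I \<xi> e))"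
      using finB by blast
  qed
qed

section \<open>Elimination\<close>

text \<open>Agreement with a polynomial of degree m is required on T only. This matters for the
  pivot entries, which are rational in the other coordinates only where the equations hold.\<close>

definition poly_deg :: "'p set \<Rightarrow> 'i set \<Rightarrow> ('i \<Rightarrow> 'p \<Rightarrow> real) \<Rightarrow> nat \<Rightarrow> ('p \<Rightarrow> real) \<Rightarrow> bool" where
  "poly_deg T I \<xi> m f \<longleftrightarrow> spanned T {e \<in> exponents I. sum e I \<le> m} (monom_at I \<xi>) f"

lemma finite_exponents_degree:
  assumes "finite I"
  shows "finite {e \<in> exponents I. sum e I \<le> m}"
proof -
  have "e i \<le> m" if "sum e I \<le> m" "i \<in> I" for e :: "'a \<Rightarrow> nat" and i
    using member_le_sum[of i I e] that assms by force
  then show ?thesis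
    by (intro finite_subset[OF _ finite_exponents_bounded(1)[OF assms, of "\<lambda>i. m"]]) blast
qed

lemma poly_deg_monom:
  assumes "finite I" "e \<in> exponents I" "sum e I \<le> m"
  shows "poly_deg T I \<xi> m (monom_at I \<xi> e)"
  unfolding poly_deg_def using assms by (intro spanned_base finite_exponents_degree) auto

lemma poly_deg_cong: "poly_deg T I \<xi> m f \<Longrightarrow> (\<And>t. t \<in> T \<Longrightarrow> g t = f t) \<Longrightarrow> poly_deg T I \<xi> m g"
  unfolding poly_deg_def by (rule spanned_cong)

lemma poly_deg_scale: "poly_deg T I \<xi> m f \<Longrightarrow> poly_deg T I \<xi> m (\<lambda>t. c * f t)"
  unfolding poly_deg_def by (rule spanned_scale)

lemma poly_deg_const:
  assumes "finite I"
  shows "poly_deg T I \<xi> m (\<lambda>t. c)"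
proof -
  have "poly_deg T I \<xi> m (monom_at I \<xi> (\<lambda>i. 0))"
    by (rule poly_deg_monom) (use assms in \<open>auto simp: exponents_def\<close>)
  from poly_deg_scale[OF this, of c] show ?thesis by (simp add: monom_at_def)
qed

lemma poly_deg_gen:
  assumes "finite I" "i \<in> I" "1 \<le> m"
  shows "poly_deg T I \<xi> m (\<xi> i)"
proof -
  have "poly_deg T I \<xi> m (monom_at I \<xi> (\<lambda>j. if j = i then 1 else 0))"
    by (rule poly_deg_monom) (use assms in \<open>auto simp: exponents_def\<close>)
  then show ?thesis
    by (rule poly_deg_cong) (use assms in \<open>simp add: monom_at_def if_distrib cong: if_cong\<close>)
qed

lemma poly_deg_add: "poly_deg T I \<xi> m f \<Longrightarrow> poly_deg T I \<xi> m g \<Longrightarrow> poly_deg T I \<xi> m (\<lambda>t. f t + g t)"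
  unfolding poly_deg_def by (rule spanned_add)

lemma poly_deg_diff: "poly_deg T I \<xi> m f \<Longrightarrow> poly_deg T I \<xi> m g \<Longrightarrow> poly_deg T I \<xi> m (\<lambda>t. f t - g t)"
  using poly_deg_add[OF _ poly_deg_scale[of T I \<xi> m g "-1"], of f] by simp

lemma poly_deg_sum:
  "(\<And>j. j \<in> L \<Longrightarrow> poly_deg T I \<xi> m (f j)) \<Longrightarrow> poly_deg T I \<xi> m (\<lambda>t. \<Sum>j\<in>L. f j t)"
  unfolding poly_deg_def by (rule spanned_sum)

lemma poly_deg_mono:
  assumes "finite I" "poly_deg T I \<xi> m f" "m \<le> n"
  shows "poly_deg T I \<xi> n f"
  unfolding poly_deg_def
  by (rule spanned_trans[OF assms(2)[unfolded poly_deg_def]])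
    (use assms(3) in \<open>auto intro!: poly_deg_monom[OF assms(1), unfolded poly_deg_def]\<close>)

lemma poly_deg_mult:
  assumes "finite I" "poly_deg T I \<xi> m f" "poly_deg T I \<xi> n g"
  shows "poly_deg T I \<xi> (m + n) (\<lambda>t. f t * g t)"
  unfolding poly_deg_def
proof (rule spanned_trans[OF spanned_mult[OF assms(2,3)[unfolded poly_deg_def]]])
  fix k assume "k \<in> {e \<in> exponents I. sum e I \<le> m} \<times> {e \<in> exponents I. sum e I \<le> n}"
  then obtain e e' where k: "k = (e, e')" "e \<in> exponents I" "e' \<in> exponents I" "sum e I \<le> m" "sum e' I \<le> n"
    by blast
  have "poly_deg T I \<xi> (m + n) (monom_at I \<xi> (\<lambda>i. e i + e' i))"
    by (rule poly_deg_monom[OF assms(1)]) (use k in \<open>auto simp: exponents_def sum.distrib\<close>)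
  then show "spanned T {e \<in> exponents I. sum e I \<le> m + n} (monom_at I \<xi>)
      ((\<lambda>(k, l) p. monom_at I \<xi> k p * monom_at I \<xi> l p) k)"
    unfolding poly_deg_def by (rule spanned_cong) (simp add: k(1) monom_at_add)
qed

lemma poly_deg_mult':
  assumes "finite I" "poly_deg T I \<xi> m f" "poly_deg T I \<xi> n g" "m + n \<le> d"
  shows "poly_deg T I \<xi> d (\<lambda>t. f t * g t)"
  by (rule poly_deg_mono[OF assms(1) poly_deg_mult[OF assms(1-3)] assms(4)])

lemma poly_deg_power:
  assumes "finite I" "poly_deg T I \<xi> m f"
  shows "poly_deg T I \<xi> (m * a) (\<lambda>t. f t ^ a)"
proof (induction a)
  case 0
  show ?case using poly_deg_const[OF assms(1)] by simp
next
  case (Suc a)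
  from poly_deg_mult[OF assms Suc] show ?case by simp
qed

lemma poly_deg_prod:
  assumes "finite I" "finite S" "\<And>s. s \<in> S \<Longrightarrow> poly_deg T I \<xi> (n s) (f s)"
  shows "poly_deg T I \<xi> (sum n S) (\<lambda>t. \<Prod>s\<in>S. f s t)"
  using assms(2,3)
proof (induction S rule: finite_induct)
  case empty
  show ?case using poly_deg_const[OF assms(1)] by simp
next
  case (insert s S)
  then have "poly_deg T I \<xi> (n s) (f s)" "poly_deg T I \<xi> (sum n S) (\<lambda>t. \<Prod>s\<in>S. f s t)" by auto
  from poly_deg_mult[OF assms(1) this] show ?case using insert(1,2) by simp
qed

text \<open>The coordinates \<open>\<tau>\<close> are rational functions, with common denominator \<open>\<delta>\<close>, of coordinates
  whose monomials of degree \<open>D\<close> span a space of dimension \<open>O(D\<^bsup>2k + card I3\<^esup>)\<close>. For large \<open>D\<close> this is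
  less than the number of monomials of degree \<open>D\<close> in \<open>\<tau>\<close>, so these are linearly dependent.\<close>

lemma elimination:
  fixes \<xi> :: "'i \<Rightarrow> 't \<Rightarrow> real" and \<tau> :: "'s \<Rightarrow> 't \<Rightarrow> real"
  assumes fin: "finite I1" "finite I2" "finite I3" "finite S"
    and disj: "I1 \<inter> I2 = {}" "(I1 \<union> I2) \<inter> I3 = {}"
    and dim: "alg_dim_le T I1 \<xi> k" "alg_dim_le T I2 \<xi> k"
    and \<delta>: "\<And>t. t \<in> T \<Longrightarrow> \<delta> t \<noteq> 0" "poly_deg T (I1 \<union> I2 \<union> I3) \<xi> d \<delta>"
      "\<And>s. s \<in> S \<Longrightarrow> poly_deg T (I1 \<union> I2 \<union> I3) \<xi> d (\<lambda>t. \<delta> t * \<tau> s t)"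
    and card: "2 * k + card I3 < card S"
  shows "\<exists>E c. finite E \<and> E \<noteq> {} \<and> E \<subseteq> exponents S \<and> (\<forall>e\<in>E. c e \<noteq> 0) \<and>
    (\<forall>t\<in>T. (\<Sum>e\<in>E. c e * monom_at S \<tau> e t) = 0)"
proof -
  define I where "I = I1 \<union> I2 \<union> I3"
  have finI: "finite I" using fin by (simp add: I_def)
  obtain C1 where C1: "\<And>D. \<exists>B. finite B \<and> card B \<le> C1 * (D + 1) ^ k \<and>
    (\<forall>e\<in>exponents I1. sum e I1 \<le> D \<longrightarrow> spanned T B (monom_at I1 \<xi>) (monom_at I1 \<xi> e))"
    using spanning_monomials[OF fin(1) dim(1)] by blast
  obtain C2 where C2: "\<And>D. \<exists>B. finite B \<and> card B \<le> C2 * (D + 1) ^ k \<and>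
    (\<forall>e\<in>exponents I2. sum e I2 \<le> D \<longrightarrow> spanned T B (monom_at I2 \<xi>) (monom_at I2 \<xi> e))"
    using spanning_monomials[OF fin(2) dim(2)] by blast
  \<comment> \<open>Monomials in \<tau> with exponents up to D0 have degree at most Dg; multiplied
    by the power Dg of \<delta>, they have degree at most m in the source coordinates. Since m + 1
    \<le> Q * (D0 + 1) and D0 = C1 * C2 * Q ^ r, they lie in a span of dimension at most D0 * (D0 +
    1) ^ r, which is less than their number (D0 + 1) ^ N.\<close>
  define N where "N = card S"
  define r where "r = 2 * k + card I3"
  define Q where "Q = d * N + 1"
  define D0 where "D0 = C1 * C2 * Q ^ r"
  define Dg where "Dg = N * D0"
  define m where "m = d * Dg"
  obtain B1 where B1: "finite B1" "card B1 \<le> C1 * (m + 1) ^ k"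
    "\<And>e. e \<in> exponents I1 \<Longrightarrow> sum e I1 \<le> m \<Longrightarrow> spanned T B1 (monom_at I1 \<xi>) (monom_at I1 \<xi> e)"
    using C1[of m] by blast
  obtain B2 where B2: "finite B2" "card B2 \<le> C2 * (m + 1) ^ k"
    "\<And>e. e \<in> exponents I2 \<Longrightarrow> sum e I2 \<le> m \<Longrightarrow> spanned T B2 (monom_at I2 \<xi>) (monom_at I2 \<xi> e)"
    using C2[of m] by blast
  define B3 where "B3 = {e \<in> exponents I3. \<forall>i\<in>I3. e i \<le> m}"
  have B3: "finite B3" "card B3 = (m + 1) ^ card I3"
    using finite_exponents_bounded[OF fin(3), of "\<lambda>i. m"] by (simp_all add: B3_def)
  define K where "K = (B1 \<times> B2) \<times> B3"
  define b where "b = (\<lambda>(e12, e3) t. (\<lambda>(e1, e2) t. monom_at I1 \<xi> e1 t * monom_at I2 \<xi> e2 t) e12 t *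
    monom_at I3 \<xi> e3 t)"
  have finK: "finite K" using B1 B2 B3 by (simp add: K_def)
  have "card K = card B1 * card B2 * card B3" by (simp add: K_def card_cartesian_product)
  also have "\<dots> \<le> (C1 * (m + 1) ^ k) * (C2 * (m + 1) ^ k) * (m + 1) ^ card I3"
    unfolding B3(2) by (intro mult_mono B1 B2) auto
  also have "\<dots> = C1 * C2 * (m + 1) ^ r" by (simp add: r_def power_add power2_eq_square mult_2)
  also have "\<dots> \<le> C1 * C2 * (Q * (D0 + 1)) ^ r"
    by (intro mult_left_mono power_mono) (simp_all add: m_def Dg_def Q_def algebra_simps)
  also have "\<dots> = D0 * (D0 + 1) ^ r" by (simp only: power_mult_distrib mult.assoc[symmetric] D0_def[symmetric])
  also have "\<dots> < (D0 + 1) * (D0 + 1) ^ r" by (intro mult_strict_right_mono) auto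
  also have "\<dots> = (D0 + 1) ^ Suc r" by simp
  also have "\<dots> \<le> (D0 + 1) ^ N" using card by (intro power_increasing) (auto simp: r_def N_def)
  finally have cardK: "card K < (D0 + 1) ^ N" .
  define F where "F = {e \<in> exponents S. \<forall>s\<in>S. e s \<le> D0}"
  have F: "finite F" "card F = (D0 + 1) ^ N"
    using finite_exponents_bounded[OF fin(4), of "\<lambda>i. D0"] by (simp_all add: F_def N_def)
  have pd: "spanned T K b f" if "poly_deg T I \<xi> m f" for f
  proof (rule spanned_trans[OF that[unfolded poly_deg_def]])
    fix e assume e: "e \<in> {e \<in> exponents I. sum e I \<le> m}"
    \<comment> \<open>The parts of e in I1, I2 and I3 are treated separately.\<close>
    define p where "p J i = (if i \<in> J then e i else 0)" for J i
    have p_exp: "p J \<in> exponents J" for J by (simp add: p_def exponents_def)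
    have p_mon: "monom_at J \<xi> (p J) t = monom_at J \<xi> e t" for J t
      unfolding monom_at_def p_def by (intro prod.cong) auto
    have p_sum: "sum (p J) J \<le> m" if "J \<subseteq> I" for J
    proof -
      have "sum (p J) J = sum e J" by (intro sum.cong) (auto simp: p_def)
      also have "\<dots> \<le> sum e I" using that finI by (intro sum_mono2) auto
      finally show ?thesis using e by simp
    qed
    have sp: "spanned T B1 (monom_at I1 \<xi>) (monom_at I1 \<xi> (p I1))"
        "spanned T B2 (monom_at I2 \<xi>) (monom_at I2 \<xi> (p I2))"
      using p_exp p_sum by (auto simp: I_def intro!: B1(3) B2(3))
    have "p I3 \<in> B3"
    proof -
      have "p I3 i \<le> m" if "i \<in> I3" for i
        using member_le_sum[OF that _ fin(3), of "p I3"] p_sum[of I3] by (force simp: I_def)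
      then show ?thesis using p_exp by (simp add: B3_def)
    qed
    then have "spanned T B3 (monom_at I3 \<xi>) (monom_at I3 \<xi> (p I3))" by (rule spanned_base[OF B3(1)])
    from spanned_mult[OF spanned_mult[OF sp] this]
    have "spanned T K b (\<lambda>t. monom_at I1 \<xi> (p I1) t * monom_at I2 \<xi> (p I2) t * monom_at I3 \<xi> (p I3) t)"
      unfolding K_def b_def by (simp add: case_prod_unfold)
    then show "spanned T K b (monom_at I \<xi> e)"
    proof (rule spanned_cong)
      fix t
      show "monom_at I \<xi> e t = monom_at I1 \<xi> (p I1) t * monom_at I2 \<xi> (p I2) t * monom_at I3 \<xi> (p I3) t"
        unfolding p_mon unfolding monom_at_def I_def
        using fin disj by (simp add: prod.union_disjoint)
    qed
  qed
  have span: "spanned T K b (\<lambda>t. \<delta> t ^ Dg * monom_at S \<tau> e t)" if "e \<in> F" for e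
  proof (rule pd, rule poly_deg_cong)
    have le: "sum e S \<le> Dg" unfolding Dg_def N_def using that sum_bounded_above[of S e D0] by (simp add: F_def)
    \<comment> \<open>Each factor \<open>\<tau> s\<close> absorbs one factor \<delta>; the remaining
      powers of \<delta> fill the degree up to m.\<close>
    have "poly_deg T I \<xi> (\<Sum>s\<in>S. d * e s) (\<lambda>t. \<Prod>s\<in>S. (\<delta> t * \<tau> s t) ^ e s)"
      by (intro poly_deg_prod poly_deg_power finI fin \<delta>(3)[folded I_def])
    from poly_deg_mult[OF finI poly_deg_power[OF finI \<delta>(2)[folded I_def], of "Dg - sum e S"] this]
    have "poly_deg T I \<xi> (d * (Dg - sum e S) + (\<Sum>s\<in>S. d * e s))
        (\<lambda>t. \<delta> t ^ (Dg - sum e S) * (\<Prod>s\<in>S. (\<delta> t * \<tau> s t) ^ e s))" .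
    moreover have "d * (Dg - sum e S) + (\<Sum>s\<in>S. d * e s) = m"
      using le by (simp add: m_def sum_distrib_left[symmetric] distrib_left[symmetric])
    ultimately show "poly_deg T I \<xi> m (\<lambda>t. \<delta> t ^ (Dg - sum e S) * (\<Prod>s\<in>S. (\<delta> t * \<tau> s t) ^ e s))" by simp
    fix t
    have "\<delta> t ^ Dg = \<delta> t ^ (Dg - sum e S) * \<delta> t ^ sum e S" using le by (simp add: power_add[symmetric])
    then show "\<delta> t ^ Dg * monom_at S \<tau> e t = \<delta> t ^ (Dg - sum e S) * (\<Prod>s\<in>S. (\<delta> t * \<tau> s t) ^ e s)"
      by (simp add: monom_at_def power_mult_distrib prod.distrib power_sum)
  qed
  from spanned_dependent[where f="\<lambda>e t. \<delta> t ^ Dg * monom_at S \<tau> e t", OF finK F(1) cardK[folded F(2)] span]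
  obtain c e0 where c: "e0 \<in> F" "c e0 \<noteq> 0"
    "\<forall>t\<in>T. (\<Sum>e\<in>F. c e * (\<delta> t ^ Dg * monom_at S \<tau> e t)) = 0" by blast
  define E where "E = {e\<in>F. c e \<noteq> 0}"
  have "(\<Sum>e\<in>E. c e * monom_at S \<tau> e t) = 0" if t: "t \<in> T" for t
  proof -
    have "\<delta> t ^ Dg * (\<Sum>e\<in>F. c e * monom_at S \<tau> e t) = 0"
      using c(3) t by (simp add: sum_distrib_left mult.left_commute)
    then have "(\<Sum>e\<in>F. c e * monom_at S \<tau> e t) = 0" using \<delta>(1)[OF t] by simp
    also have "(\<Sum>e\<in>F. c e * monom_at S \<tau> e t) = (\<Sum>e\<in>E. c e * monom_at S \<tau> e t)"
      using F(1) by (intro sum.mono_neutral_right) (auto simp: E_def)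
    finally show ?thesis .
  qed
  moreover have "finite E" "\<forall>e\<in>E. c e \<noteq> 0" using F(1) by (auto simp: E_def)
  moreover have "E \<noteq> {}" "E \<subseteq> exponents S" using c by (auto simp: E_def F_def)
  ultimately show ?thesis by blast
qed

text \<open>A relation between \<open>x\<close> and a further coordinate, divided by a power of that coordinate, survives
  in the limit where the coordinate tends to \<open>0\<close>.\<close>

lemma relation_in_limit:
  fixes r0 :: 'i
  assumes "finite S" "r0 \<notin> S" and E: "finite E" "E \<noteq> {}" "E \<subseteq> exponents (insert r0 S)"
    and c: "\<And>e. e \<in> E \<Longrightarrow> c e \<noteq> (0::real)"
  shows "\<exists>E' c'. finite E' \<and> E' \<noteq> {} \<and> E' \<subseteq> exponents S \<and> (\<forall>e\<in>E'. c' e \<noteq> (0::real)) \<and>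
    (\<forall>y z. (\<lambda>n :: nat. y n r0) \<longlonglongrightarrow> 0 \<and> (\<forall>n. y n r0 \<noteq> 0) \<and> (\<forall>s\<in>S. (\<lambda>n. y n s) \<longlonglongrightarrow> z s) \<and>
      (\<forall>n. (\<Sum>e\<in>E. c e * (\<Prod>i\<in>insert r0 S. y n i ^ e i)) = 0) \<longrightarrow>
      (\<Sum>e\<in>E'. c' e * (\<Prod>i\<in>S. z i ^ e i)) = 0)"
proof -
  \<comment> \<open>After division by the power q of the small coordinate, the terms with a higher
    power of it tend to 0.\<close>
  define q where "q = Min ((\<lambda>e. e r0) ` E)"
  have q: "q \<le> e r0" if "e \<in> E" for e using that E(1) by (auto simp: q_def)
  have "q \<in> (\<lambda>e. e r0) ` E" unfolding q_def using E by (intro Min_in) auto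
  define E0 where "E0 = {e\<in>E. e r0 = q}"
  have E0: "finite E0" "E0 \<noteq> {}" using E(1) \<open>q \<in> _\<close> by (auto simp: E0_def)
  \<comment> \<open>On E0 the exponent of \<open>r0\<close> is constantly q, so deleting it merges
    no monomials and the limit relation stays nontrivial.\<close>
  define g where "g e = e(r0 := 0)" for e :: "'i \<Rightarrow> nat"
  have inj: "inj_on g E0"
  proof (rule inj_onI)
    fix e e' assume "e \<in> E0" "e' \<in> E0" "g e = g e'"
    then have "e i = e' i" for i
      by (cases "i = r0") (auto simp: E0_def g_def dest: fun_cong[of _ _ i])
    then show "e = e'" by blast
  qed
  define c' where "c' e = c (inv_into E0 g e)" for e
  have c'g: "c' (g e) = c e" if "e \<in> E0" for e using inj that by (simp add: c'_def inv_into_f_f)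
  show ?thesis
  proof (intro exI[of _ "g ` E0"] exI[of _ c'] conjI ballI allI impI)
    show "finite (g ` E0)" "g ` E0 \<noteq> {}" using E0 by auto
    show "g ` E0 \<subseteq> exponents S" using E(3) by (fastforce simp: E0_def g_def exponents_def)
    show "c' e \<noteq> 0" if "e \<in> g ` E0" for e using that c c'g by (auto simp: E0_def)
    fix y z
    assume *: "(\<lambda>n :: nat. y n r0) \<longlonglongrightarrow> 0 \<and> (\<forall>n. y n r0 \<noteq> 0) \<and>
      (\<forall>s\<in>S. (\<lambda>n. y n s) \<longlonglongrightarrow> z s) \<and> (\<forall>n. (\<Sum>e\<in>E. c e * (\<Prod>i\<in>insert r0 S. y n i ^ e i)) = 0)"
    then have r0: "(\<lambda>n. y n r0) \<longlonglongrightarrow> 0" "\<And>n. y n r0 \<noteq> 0"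
      and lim: "\<And>s. s \<in> S \<Longrightarrow> (\<lambda>n. y n s) \<longlonglongrightarrow> z s"
      and zero: "\<And>n. (\<Sum>e\<in>E. c e * (\<Prod>i\<in>insert r0 S. y n i ^ e i)) = 0" by blast+
    have "(\<Sum>e\<in>E. c e * (y n r0 ^ (e r0 - q) * (\<Prod>i\<in>S. y n i ^ e i))) = 0" for n
    proof -
      have "(\<Prod>i\<in>insert r0 S. y n i ^ e i) = y n r0 ^ q * (y n r0 ^ (e r0 - q) * (\<Prod>i\<in>S. y n i ^ e i))"
        if "e \<in> E" for e
        using assms(1,2) q[OF that] by (simp add: mult.assoc[symmetric] power_add[symmetric])
      then have "0 = y n r0 ^ q * (\<Sum>e\<in>E. c e * (y n r0 ^ (e r0 - q) * (\<Prod>i\<in>S. y n i ^ e i)))"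
        using zero[of n] by (simp add: sum_distrib_left mult.left_commute)
      then show ?thesis using r0(2)[of n] by simp
    qed
    moreover have "(\<lambda>n. \<Sum>e\<in>E. c e * (y n r0 ^ (e r0 - q) * (\<Prod>i\<in>S. y n i ^ e i)))
        \<longlonglongrightarrow> (\<Sum>e\<in>E. c e * (0 ^ (e r0 - q) * (\<Prod>i\<in>S. z i ^ e i)))"
      by (intro tendsto_intros r0 lim)
    ultimately have "(\<Sum>e\<in>E. c e * (0 ^ (e r0 - q) * (\<Prod>i\<in>S. z i ^ e i))) = 0"
      by (simp add: LIMSEQ_const_iff)
    also have "(\<Sum>e\<in>E. c e * (0 ^ (e r0 - q) * (\<Prod>i\<in>S. z i ^ e i))) =
        (\<Sum>e\<in>E0. c e * (\<Prod>i\<in>S. z i ^ e i))"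
    proof (rule sum.mono_neutral_cong_right)
      show "\<forall>e\<in>E - E0. c e * (0 ^ (e r0 - q) * (\<Prod>i\<in>S. z i ^ e i)) = 0"
      proof
        fix e assume "e \<in> E - E0"
        then have "0 < e r0 - q" using q[of e] by (auto simp: E0_def)
        then show "c e * (0 ^ (e r0 - q) * (\<Prod>i\<in>S. z i ^ e i)) = 0" by simp
      qed
    qed (use E in \<open>auto simp: E0_def\<close>)
    also have "\<dots> = (\<Sum>e\<in>E0. c' (g e) * (\<Prod>i\<in>S. z i ^ g e i))"
    proof (intro sum.cong refl)
      fix e assume "e \<in> E0"
      have "(\<Prod>i\<in>S. z i ^ g e i) = (\<Prod>i\<in>S. z i ^ e i)"
        using assms(2) by (intro prod.cong) (auto simp: g_def)
      then show "c e * (\<Prod>i\<in>S. z i ^ e i) = c' (g e) * (\<Prod>i\<in>S. z i ^ g e i)"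
        using c'g[OF \<open>e \<in> E0\<close>] by simp
    qed
    also have "\<dots> = (\<Sum>e\<in>g ` E0. c' e * (\<Prod>i\<in>S. z i ^ e i))"
      by (simp add: sum.reindex[OF inj])
    finally show "(\<Sum>e\<in>g ` E0. c' e * (\<Prod>i\<in>S. z i ^ e i)) = 0" .
  qed
qed

lemma monom_at_subset:
  assumes "finite I" "J \<subseteq> I" "e \<in> exponents J"
  shows "monom_at J \<xi> e p = monom_at I \<xi> e p"
  unfolding monom_at_def using assms by (intro prod.mono_neutral_left) (auto simp: exponents_def)

text \<open>Freezing the coordinates outside J at those of a leaves a polynomial in the coordinates
  in J.\<close>

lemma rpf_restr_poly_deg:
  fixes p :: "'a::euclidean_space \<Rightarrow> real"
  assumes p: "real_polynomial_function p" and J: "J \<subseteq> Basis"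
  shows "\<exists>m. poly_deg UNIV J (\<lambda>b z. z \<bullet> b) m (\<lambda>z. p (a + restr J (z - a)))"
  using p
proof (induction rule: real_polynomial_function.induct)
  case (linear f)
  interpret f: bounded_linear f by fact
  have fin: "finite J" using J finite_subset finite_Basis by blast
  have eq: "f (a + restr J (z - a)) = f a + (\<Sum>b\<in>J. f b * (z \<bullet> b - a \<bullet> b))" for z
    by (simp add: restr_def f.add f.sum f.scaleR inner_diff_left mult.commute)
  show ?case unfolding eq
    by (intro exI[of _ 1] poly_deg_add poly_deg_sum poly_deg_scale poly_deg_diff poly_deg_const fin)
      (rule poly_deg_gen[OF fin], auto)
next
  case (const c)
  have "finite J" using J finite_subset finite_Basis by blast
  then show ?case using poly_deg_const by blast
next
  case (add f g)
  have fin: "finite J" using J finite_subset finite_Basis by blast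
  from add obtain m n where "poly_deg UNIV J (\<lambda>b z. z \<bullet> b) m (\<lambda>z. f (a + restr J (z - a)))"
    "poly_deg UNIV J (\<lambda>b z. z \<bullet> b) n (\<lambda>z. g (a + restr J (z - a)))" by blast
  then show ?case
    by (intro exI[of _ "max m n"] poly_deg_add) (auto intro: poly_deg_mono[OF fin])
next
  case (mult f g)
  have fin: "finite J" using J finite_subset finite_Basis by blast
  from mult obtain m n where "poly_deg UNIV J (\<lambda>b z. z \<bullet> b) m (\<lambda>z. f (a + restr J (z - a)))"
    "poly_deg UNIV J (\<lambda>b z. z \<bullet> b) n (\<lambda>z. g (a + restr J (z - a)))" by blast
  from poly_deg_mult[OF fin this] show ?case by blast
qed

text \<open>If the projection to k + 1 coordinates had interior, A would contain a cell of dimension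
  k + 1. So the cylinder over the graph lies in the zeros of some nonzero P, and freezing the other
  coordinates at a point a with P a \<noteq> 0 gives a nontrivial relation between the k + 1
  coordinates.\<close>

lemma graph_alg_dim_le:
  fixes X :: "(real ^ 'n::finite) set" and f :: "real ^ 'n \<Rightarrow> 'b::euclidean_space"
  assumes X: "compact X" "X \<subseteq> A" and f: "continuous_on X f" "semialgebraic_map X f"
    and k: "semialgebraic_dim A \<le> k" "k < CARD('n)"
  shows "alg_dim_le ((\<lambda>x. (x, f x)) ` X) Basis (\<lambda>b z. z \<bullet> b) k"
  unfolding alg_dim_le_def
proof (intro allI impI)
  fix J :: "((real ^ 'n) \<times> 'b) set" assume J: "J \<subseteq> Basis" "card J = Suc k"
  let ?\<Gamma> = "(\<lambda>x. (x, f x)) ` X"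
  have fin: "finite J" using J finite_subset finite_Basis by blast
  obtain I :: "'n set" where I: "card I = Suc k"
    by (metis Suc_leI k(2) obtain_subset_with_card_n)
  have "interior (cyl J ?\<Gamma>) = {}"
  proof (rule ccontr)
    assume "interior (cyl J ?\<Gamma>) \<noteq> {}"
    from semialgebraic_dim_ge[OF X f J(1) _ this, of I] show False using I J(2) k(1) by simp
  qed
  moreover have "semialgebraic (cyl J ?\<Gamma>)"
  proof -
    have s: "semialgebraic ?\<Gamma>" using f(2) by (simp add: semialgebraic_map_def)
    have "semialgebraic {z. \<exists>w. w \<in> ?\<Gamma> \<and> (\<forall>b\<in>J. w \<bullet> b = z \<bullet> b)}"
      by (intro semialgebraic_exI semialgebraic_conj semialgebraic_vimage[OF s] semialgebraic_eq
          semialgebraic_all_finite[OF fin] poly_intros)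
    then show ?thesis by (simp only: cyl_def Bex_def)
  qed
  ultimately obtain P where P: "real_polynomial_function P" "\<exists>x. P x \<noteq> 0" "\<forall>x\<in>cyl J ?\<Gamma>. P x = 0"
    using semialgebraic_thin by blast
  then obtain a where a: "P a \<noteq> 0" by blast
  obtain m where "poly_deg UNIV J (\<lambda>b z. z \<bullet> b) m (\<lambda>z. P (a + restr J (z - a)))"
    using rpf_restr_poly_deg[OF P(1) J(1)] by blast
  then obtain c where c: "\<And>z. P (a + restr J (z - a)) =
      (\<Sum>e\<in>{e \<in> exponents J. sum e J \<le> m}. c e * monom_at J (\<lambda>b z. z \<bullet> b) e z)"
    unfolding poly_deg_def spanned_def by blast
  define E where "E = {e \<in> exponents J. sum e J \<le> m \<and> c e \<noteq> 0}"
  have fE: "finite {e \<in> exponents J. sum e J \<le> m}" by (rule finite_exponents_degree[OF fin])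
  have cE: "P (a + restr J (z - a)) = (\<Sum>e\<in>E. c e * monom_at Basis (\<lambda>b z. z \<bullet> b) e z)" for z
    unfolding c using monom_at_subset[OF finite_Basis J(1)]
    by (intro sum.mono_neutral_cong_right fE) (auto simp: E_def)
  have "finite E" by (rule finite_subset[OF _ fE]) (auto simp: E_def)
  moreover have "E \<noteq> {}" using cE[of a] a by (auto simp: restr_def)
  moreover have "E \<subseteq> exponents J" "\<forall>e\<in>E. c e \<noteq> 0" by (auto simp: E_def)
  moreover have "(\<Sum>e\<in>E. c e * monom_at Basis (\<lambda>b z. z \<bullet> b) e z) = 0" if "z \<in> ?\<Gamma>" for z
  proof -
    have "z \<bullet> b = (a + restr J (z - a)) \<bullet> b" if "b \<in> J" for b
      using inner_restr[OF J(1), of b "z - a"] that J(1) by (auto simp: inner_add_left inner_diff_left)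
    then have "a + restr J (z - a) \<in> cyl J ?\<Gamma>" unfolding cyl_def using that by blast
    then have "P (a + restr J (z - a)) = 0" using P(3) by blast
    then show ?thesis unfolding cE .
  qed
  ultimately show "\<exists>E c. finite E \<and> E \<noteq> {} \<and> E \<subseteq> exponents J \<and> (\<forall>e\<in>E. c e \<noteq> 0) \<and>
      (\<forall>p\<in>?\<Gamma>. (\<Sum>e\<in>E. c e * monom_at Basis (\<lambda>b z. z \<bullet> b) e p) = 0)" by blast
qed

text \<open>Allows the bound for the graph to be used twice, once for each end of a secant.\<close>

lemma alg_dim_le_reindex:
  fixes I :: "'i set"
  assumes dim: "alg_dim_le A I \<xi> d" and \<phi>: "inj_on \<phi> I" and fin: "finite I"
    and g: "\<And>t. t \<in> T \<Longrightarrow> g t \<in> A" "\<And>t i. t \<in> T \<Longrightarrow> i \<in> I \<Longrightarrow> \<eta> (\<phi> i) t = \<xi> i (g t)"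
  shows "alg_dim_le T (\<phi> ` I) \<eta> d"
  unfolding alg_dim_le_def
proof (intro allI impI)
  fix J' assume J': "J' \<subseteq> \<phi> ` I" "card J' = Suc d"
  then obtain J where J: "J \<subseteq> I" "J' = \<phi> ` J" by (meson subset_imageE)
  have "card J = Suc d" using J J'(2) \<phi> by (metis card_image inj_on_subset)
  with dim J(1) have "\<exists>E c. finite E \<and> E \<noteq> {} \<and> E \<subseteq> exponents J \<and> (\<forall>e\<in>E. c e \<noteq> 0) \<and>
      (\<forall>p\<in>A. (\<Sum>e\<in>E. c e * monom_at I \<xi> e p) = 0)"
    unfolding alg_dim_le_def by simp
  then obtain E c where E: "finite E" "E \<noteq> {}" "E \<subseteq> exponents J" "\<forall>e\<in>E. c e \<noteq> 0"
    "\<forall>p\<in>A. (\<Sum>e\<in>E. c e * monom_at I \<xi> e p) = 0" by (elim exE conjE) (rule that)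
  define h where "h e i' = (if i' \<in> \<phi> ` I then e (inv_into I \<phi> i') else 0)" for e :: "'i \<Rightarrow> nat" and i'
  have h\<phi>: "h e (\<phi> i) = e i" if "i \<in> I" for e i using that \<phi> by (simp add: h_def)
  have inj: "inj_on h E"
  proof (rule inj_onI)
    fix e e' assume ee: "e \<in> E" "e' \<in> E" "h e = h e'"
    have "e i = e' i" for i
    proof (cases "i \<in> I")
      case True
      then show ?thesis using h\<phi>[OF True, of e] h\<phi>[OF True, of e'] ee(3) by simp
    next
      case False
      have "e \<in> exponents J" "e' \<in> exponents J" using ee E(3) by blast+
      moreover have "i \<notin> J" using False J(1) by blast
      ultimately show ?thesis unfolding exponents_def by simp
    qed
    then show "e = e'" by blast
  qed
  define c' where "c' e = c (inv_into E h e)" for e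
  have c'h: "c' (h e) = c e" if "e \<in> E" for e using inj that by (simp add: c'_def)
  have "h e \<in> exponents J'" if "e \<in> E" for e
  proof -
    have "e \<in> exponents J" using E(3) that by blast
    have "h e i' = 0" if "i' \<notin> J'" for i'
    proof (cases "i' \<in> \<phi> ` I")
      case True
      then obtain i where i: "i \<in> I" "i' = \<phi> i" by blast
      then have "i \<notin> J" using \<open>i' \<notin> J'\<close> J by blast
      then show ?thesis using i h\<phi> \<open>e \<in> exponents J\<close> by (simp add: exponents_def)
    qed (simp add: h_def)
    then show ?thesis by (simp add: exponents_def)
  qed
  moreover have "(\<Sum>e\<in>h ` E. c' e * monom_at (\<phi> ` I) \<eta> e t) = 0" if t: "t \<in> T" for t
  proof -
    have "monom_at (\<phi> ` I) \<eta> (h e) t = monom_at I \<xi> e (g t)" for e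
      unfolding monom_at_def using \<phi> g(2)[OF t] h\<phi>
      by (subst prod.reindex) (auto intro!: prod.cong)
    then have "(\<Sum>e\<in>h ` E. c' e * monom_at (\<phi> ` I) \<eta> e t) = (\<Sum>e\<in>E. c e * monom_at I \<xi> e (g t))"
      using c'h by (subst sum.reindex[OF inj]) simp
    then show ?thesis using E(5) g(1)[OF t] by simp
  qed
  ultimately show "\<exists>E c. finite E \<and> E \<noteq> {} \<and> E \<subseteq> exponents J' \<and> (\<forall>e\<in>E. c e \<noteq> 0) \<and>
      (\<forall>p\<in>T. (\<Sum>e\<in>E. c e * monom_at (\<phi> ` I) \<eta> e p) = 0)"
    using E c'h by (intro exI[of _ "h ` E"] exI[of _ c']) auto
qed

section \<open>Triangular coordinate changes in general position\<close>

text \<open>Below the diagonal, the matrix \<open>c\<close> gives a change of the coordinates \<open>u\<close>, above the diagonal one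
  of the coordinates \<open>v\<close>. For \<open>j \<noteq> i\<close>, \<open>mixed idx c i j\<close> is the \<open>j\<close>-th of the coordinates that are kept
  while the \<open>i\<close>-th coordinate is changed.\<close>

definition lower :: "('n \<Rightarrow> nat) \<Rightarrow> real ^ 'n ^ 'n \<Rightarrow> 'n::finite \<Rightarrow> real ^ 'n \<Rightarrow> real" where
  "lower idx c j u = u $ j + (\<Sum>m\<in>{m. idx m < idx j}. c $ j $ m * u $ m)"

definition upper :: "('n \<Rightarrow> nat) \<Rightarrow> real ^ 'n ^ 'n \<Rightarrow> 'n::finite \<Rightarrow> real ^ 'n \<Rightarrow> real" where
  "upper idx c j v = v $ j + (\<Sum>m\<in>{m. idx j < idx m}. c $ j $ m * v $ m)"

definition mixed :: "('n \<Rightarrow> nat) \<Rightarrow> real ^ 'n ^ 'n \<Rightarrow> 'n::finite \<Rightarrow> 'n \<Rightarrow> real ^ 'n \<Rightarrow> real ^ 'n \<Rightarrow> real" where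
  "mixed idx c i j u v = (if idx i < idx j then lower idx c j u else upper idx c j v)"


lemma mixed_scale: "mixed idx c i j (s *\<^sub>R u) (s *\<^sub>R v) = s * mixed idx c i j u v"
  by (simp add: mixed_def lower_def upper_def sum_distrib_left algebra_simps)

text \<open>Solves the equations \<open>mixed idx c i j u v = 0\<close> for one entry in each of the rows \<open>j \<noteq> i\<close>.\<close>

definition solve :: "('n \<Rightarrow> nat) \<Rightarrow> 'n \<Rightarrow> 'n \<Rightarrow> 'n \<Rightarrow> real ^ 'n ^ 'n \<Rightarrow> real ^ 'n \<Rightarrow> real ^ 'n::finite \<Rightarrow> real ^ 'n ^ 'n" where
  "solve idx i \<alpha> \<beta> c u v = (\<chi> j m.
     if j = i then c $ j $ m
     else if idx i < idx j then
       (if m = \<alpha> then - (u $ j + (\<Sum>m\<in>{m. idx m < idx j} - {\<alpha>}. c $ j $ m * u $ m)) / u $ \<alpha> else c $ j $ m)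
     else
       (if m = \<beta> then - (v $ j + (\<Sum>m\<in>{m. idx j < idx m} - {\<beta>}. c $ j $ m * v $ m)) / v $ \<beta> else c $ j $ m))"

text \<open>A \<open>point\<close> holds x and f x, a \<open>config\<close> two such points and a
  matrix of entries; \<open>source\<close> labels the coordinates of a
  \<open>config\<close>.\<close>

type_synonym 'n point = "(real ^ 'n) \<times> (real ^ 'n)"
type_synonym 'n config = "'n point \<times> 'n point \<times> (real ^ 'n ^ 'n)"
type_synonym 'n source = "('n point + 'n point) + ('n \<times> 'n)"

text \<open>\<alpha> and \<beta> will mark nonzero coordinates of u and v. Among the rows other than
  i, column \<alpha> occurs in every row treated by \<open>lower\<close> and column \<beta> in every
  row treated by \<open>upper\<close>, so each equation can be solved for its entry in that
  column.\<close>

locale pivots =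
  fixes idx :: "'n::finite \<Rightarrow> nat" and i \<alpha> \<beta> :: 'n
  assumes inj: "inj idx" and \<alpha>: "idx \<alpha> \<le> idx i" and \<beta>: "idx i \<le> idx \<beta>"
begin

lemma lower_split:
  assumes "idx i < idx j"
  shows "mixed idx c i j u v = u $ j + (c $ j $ \<alpha> * u $ \<alpha> + (\<Sum>m\<in>{m. idx m < idx j} - {\<alpha>}. c $ j $ m * u $ m))"
proof -
  have "\<alpha> \<in> {m. idx m < idx j}" using assms \<alpha> by simp
  then show ?thesis using assms by (simp add: mixed_def lower_def sum.remove)
qed

lemma upper_split:
  assumes "\<not> idx i < idx j" "j \<noteq> i"
  shows "mixed idx c i j u v = v $ j + (c $ j $ \<beta> * v $ \<beta> + (\<Sum>m\<in>{m. idx j < idx m} - {\<beta>}. c $ j $ m * v $ m))"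
proof -
  have "idx j \<noteq> idx i" using inj assms(2) by (simp add: inj_eq)
  then have "\<beta> \<in> {m. idx j < idx m}" using assms \<beta> by simp
  then show ?thesis using assms by (simp add: mixed_def upper_def sum.remove)
qed

lemma mixed_solve:
  assumes "u $ \<alpha> \<noteq> 0" "v $ \<beta> \<noteq> 0" "j \<noteq> i"
  shows "mixed idx (solve idx i \<alpha> \<beta> c u v) i j u v = 0"
proof (cases "idx i < idx j")
  case True
  have "(\<Sum>m\<in>{m. idx m < idx j} - {\<alpha>}. solve idx i \<alpha> \<beta> c u v $ j $ m * u $ m) =
      (\<Sum>m\<in>{m. idx m < idx j} - {\<alpha>}. c $ j $ m * u $ m)"
    using True assms(3) by (intro sum.cong) (auto simp: solve_def)
  then show ?thesis unfolding lower_split[OF True] using True assms by (simp add: solve_def)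
next
  case False
  have "(\<Sum>m\<in>{m. idx j < idx m} - {\<beta>}. solve idx i \<alpha> \<beta> c u v $ j $ m * v $ m) =
      (\<Sum>m\<in>{m. idx j < idx m} - {\<beta>}. c $ j $ m * v $ m)"
    using False assms(3) by (intro sum.cong) (auto simp: solve_def)
  then show ?thesis unfolding upper_split[OF False assms(3)] using False assms by (simp add: solve_def)
qed

text \<open>The equations determine the pivot entries, so correcting a matrix that already satisfies
  them changes nothing. With \<open>tendsto_solve\<close>, the matrices corrected for nearby secants
  tend to c.\<close>

lemma solve_eq:
  assumes "u $ \<alpha> \<noteq> 0" "v $ \<beta> \<noteq> 0" "\<And>j. j \<noteq> i \<Longrightarrow> mixed idx c i j u v = 0"
  shows "solve idx i \<alpha> \<beta> c u v $ j $ m = c $ j $ m"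
proof (cases "j = i")
  case False
  show ?thesis
  proof (cases "idx i < idx j")
    case True
    from assms(3)[OF False] have "- (u $ j + (\<Sum>m\<in>{m. idx m < idx j} - {\<alpha>}. c $ j $ m * u $ m)) = c $ j $ \<alpha> * u $ \<alpha>"
      unfolding lower_split[OF True] by linarith
    then show ?thesis using True False assms(1) by (simp add: solve_def)
  next
    case F: False
    from assms(3)[OF False] have "- (v $ j + (\<Sum>m\<in>{m. idx j < idx m} - {\<beta>}. c $ j $ m * v $ m)) = c $ j $ \<beta> * v $ \<beta>"
      unfolding upper_split[OF F False] by linarith
    then show ?thesis using F False assms(2) by (simp add: solve_def)
  qed
qed (simp add: solve_def)

lemma tendsto_solve:
  assumes "(U \<longlongrightarrow> u) F" "(V \<longlongrightarrow> v) F" "u $ \<alpha> \<noteq> 0" "v $ \<beta> \<noteq> 0"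
  shows "((\<lambda>n. solve idx i \<alpha> \<beta> c (U n) (V n) $ j $ m) \<longlongrightarrow> solve idx i \<alpha> \<beta> c u v $ j $ m) F"
  using assms by (simp add: solve_def) (auto intro!: tendsto_intros)

text \<open>Secants close to (u, v) need not satisfy the equations for c, but they do so after the
  pivot entries are corrected, and the corrected matrices tend to c. A relation between the entries
  and \<open>r\<close> on the set T of exact solutions thus passes to the limit, where it becomes
  \<open>H c = 0\<close>.\<close>

lemma bad_polynomial:
  fixes \<Gamma> :: "'n point set"
  assumes dim: "alg_dim_le \<Gamma> Basis (\<lambda>b z. z \<bullet> b) k" and k: "2 * k + 1 \<le> CARD('n)"
  shows "\<exists>H. real_polynomial_function H \<and> (\<exists>c. H c \<noteq> 0) \<and>
    (\<forall>c w w' s u v. (\<forall>n :: nat. w n \<in> \<Gamma> \<and> w' n \<in> \<Gamma> \<and> s n \<noteq> 0) \<and>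
      (\<lambda>n. fst (w n)) \<longlonglongrightarrow> 0 \<and> (\<lambda>n. fst (w' n)) \<longlonglongrightarrow> 0 \<and>
      (\<lambda>n. s n *\<^sub>R (fst (w n) - fst (w' n))) \<longlonglongrightarrow> u \<and> (\<lambda>n. s n *\<^sub>R (snd (w n) - snd (w' n))) \<longlonglongrightarrow> v \<and>
      u $ \<alpha> \<noteq> 0 \<and> v $ \<beta> \<noteq> 0 \<and> (\<forall>j. j \<noteq> i \<longrightarrow> mixed idx c i j u v = 0) \<longrightarrow> H c = 0)"
proof -
  define u0 where "u0 t = fst (fst t) - fst (fst (snd t))"
    for t :: "'n config"
  define v0 where "v0 t = snd (fst t) - snd (fst (snd t))"
    for t :: "'n config"
  \<comment> \<open>As \<open>mixed\<close> is homogeneous, plain differences can replace the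
    rescaled secants.\<close>
  define T where "T = {t. fst t \<in> \<Gamma> \<and> fst (snd t) \<in> \<Gamma> \<and> u0 t $ \<alpha> \<noteq> 0 \<and> v0 t $ \<beta> \<noteq> 0 \<and>
    (\<forall>j. j \<noteq> i \<longrightarrow> mixed idx (snd (snd t)) i j (u0 t) (v0 t) = 0)}"
  define \<xi> where "\<xi> x t = (case x of Inl (Inl b) \<Rightarrow> fst t \<bullet> b | Inl (Inr b) \<Rightarrow> fst (snd t) \<bullet> b
    | Inr (j, m) \<Rightarrow> snd (snd t) $ j $ m)"
    for x :: "'n source"
      and t :: "'n config"
  \<comment> \<open>\<open>None\<close> stands for the sum of the squared norms of the two base
    points: nonzero on T, where these differ, and tending to 0 in the limit.\<close>
  define \<tau> where "\<tau> x t = (case x of None \<Rightarrow> fst (fst t) \<bullet> fst (fst t) + fst (fst (snd t)) \<bullet> fst (fst (snd t))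
    | Some (j, m) \<Rightarrow> snd (snd t) $ j $ m)"
    for x :: "('n \<times> 'n) option"
      and t :: "'n config"
  define piv where "piv j = (if idx i < idx j then \<alpha> else \<beta>)" for j
  \<comment> \<open>The free entries are all but the pivot in each row j \<noteq> i.\<close>
  define Fr where "Fr = - (\<lambda>j. (j, piv j)) ` (- {i})"
  define I1 :: "'n source set"
    where "I1 = (\<lambda>b. Inl (Inl b)) ` Basis"
  define I2 :: "'n source set"
    where "I2 = (\<lambda>b. Inl (Inr b)) ` Basis"
  define I3 :: "'n source set"
    where "I3 = Inr ` Fr"
  define I where "I = I1 \<union> I2 \<union> I3"
  have fin: "finite I1" "finite I2" "finite I3" by (auto simp: I1_def I2_def I3_def)
  then have finI: "finite I" by (simp add: I_def)
  have disj: "I1 \<inter> I2 = {}" "(I1 \<union> I2) \<inter> I3 = {}" by (auto simp: I1_def I2_def I3_def)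
  have dim1: "alg_dim_le T I1 \<xi> k" unfolding I1_def
    by (rule alg_dim_le_reindex[OF dim _ finite_Basis, where g = fst]) (auto simp: inj_on_def T_def \<xi>_def)
  have dim2: "alg_dim_le T I2 \<xi> k" unfolding I2_def
    by (rule alg_dim_le_reindex[OF dim _ finite_Basis, where g = "\<lambda>t. fst (snd t)"])
      (auto simp: inj_on_def T_def \<xi>_def)
  have B: "(axis a 1, 0) \<in> (Basis :: 'n point set)"
    "(0, axis a 1) \<in> (Basis :: 'n point set)" for a
    by (auto simp: Basis_prod_def Basis_vec_def)
  have gen: "poly_deg T I \<xi> 1 f" if "x \<in> I" "\<And>t. f t = \<xi> x t" for f x
    by (rule poly_deg_cong[OF poly_deg_gen[OF finI that(1)]]) (use that(2) in auto)
  have I12: "Inl (Inl b) \<in> I" "Inl (Inr b) \<in> I" if "b \<in> Basis" for b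
    using that by (simp_all add: I_def I1_def I2_def)
  have px: "poly_deg T I \<xi> 1 (\<lambda>t. fst (fst t) $ a)" for a
    by (rule gen[OF I12(1)[OF B(1)[of a]]]) (simp add: \<xi>_def inner_prod_def inner_axis)
  have py: "poly_deg T I \<xi> 1 (\<lambda>t. snd (fst t) $ a)" for a
    by (rule gen[OF I12(1)[OF B(2)[of a]]]) (simp add: \<xi>_def inner_prod_def inner_axis)
  have px': "poly_deg T I \<xi> 1 (\<lambda>t. fst (fst (snd t)) $ a)" for a
    by (rule gen[OF I12(2)[OF B(1)[of a]]]) (simp add: \<xi>_def inner_prod_def inner_axis)
  have py': "poly_deg T I \<xi> 1 (\<lambda>t. snd (fst (snd t)) $ a)" for a
    by (rule gen[OF I12(2)[OF B(2)[of a]]]) (simp add: \<xi>_def inner_prod_def inner_axis)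
  have pu: "poly_deg T I \<xi> 1 (\<lambda>t. u0 t $ a)" and pv: "poly_deg T I \<xi> 1 (\<lambda>t. v0 t $ a)" for a
    unfolding u0_def v0_def vector_minus_component by (intro poly_deg_diff px px' py py')+
  have pc: "poly_deg T I \<xi> 1 (\<lambda>t. snd (snd t) $ j $ m)" if "(j, m) \<in> Fr" for j m
    by (rule gen[of "Inr (j, m)"]) (use that in \<open>simp_all add: I_def I3_def \<xi>_def\<close>)
  define \<delta> where "\<delta> t = u0 t $ \<alpha> * v0 t $ \<beta>" for t
  have p\<delta>: "poly_deg T I \<xi> 2 \<delta>" unfolding \<delta>_def by (rule poly_deg_mult'[OF finI pu pv]) simp
  \<comment> \<open>Times \<delta>, an entry has degree at most 3 and the coordinate
    \<open>None\<close> degree at most 4; hence the common bound 4.\<close>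
  have p\<tau>: "poly_deg T I \<xi> 4 (\<lambda>t. \<delta> t * \<tau> s t)" for s
  proof (cases s)
    case None
    have "poly_deg T I \<xi> 2 (\<lambda>t. \<Sum>a\<in>UNIV. fst (fst t) $ a * fst (fst t) $ a)"
      "poly_deg T I \<xi> 2 (\<lambda>t. \<Sum>a\<in>UNIV. fst (fst (snd t)) $ a * fst (fst (snd t)) $ a)"
      by (intro poly_deg_sum poly_deg_mult'[OF finI px px] poly_deg_mult'[OF finI px' px']; simp)+
    from poly_deg_add[OF this] have "poly_deg T I \<xi> 2 (\<tau> None)"
      by (rule poly_deg_cong) (simp add: \<tau>_def inner_vec_def)
    with None show ?thesis using poly_deg_mult'[OF finI p\<delta>, of 2 _ 4] by simp
  next
    case (Some jm)
    obtain j m where jm: "jm = (j, m)" by (cases jm)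
    have \<tau>: "\<tau> s t = snd (snd t) $ j $ m" for t by (simp add: Some jm \<tau>_def)
    show ?thesis
    proof (cases "(j, m) \<in> Fr")
      case True
      from poly_deg_mult'[OF finI p\<delta> pc[OF True], of 4] show ?thesis by (simp add: \<tau>)
    next
      case False
      then have j: "j \<noteq> i" "m = piv j" by (auto simp: Fr_def)
      have fr: "(j, a) \<in> Fr" if "a \<noteq> m" for a using that j by (auto simp: Fr_def)
      show ?thesis
      proof (cases "idx i < idx j")
        case True
        then have m: "m = \<alpha>" using j by (simp add: piv_def)
        have "poly_deg T I \<xi> 2 (\<lambda>t. u0 t $ j + (\<Sum>m\<in>{m. idx m < idx j} - {\<alpha>}. snd (snd t) $ j $ m * u0 t $ m))"
          using fr by (intro poly_deg_add poly_deg_sum poly_deg_mult'[OF finI pc pu] poly_deg_mono[OF finI pu]) (auto simp: m)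
        from poly_deg_mult'[OF finI poly_deg_scale[OF this, of "- 1"] pv, of 4 \<beta>]
        have "poly_deg T I \<xi> 4 (\<lambda>t. - 1 * (u0 t $ j + (\<Sum>m\<in>{m. idx m < idx j} - {\<alpha>}. snd (snd t) $ j $ m * u0 t $ m)) * v0 t $ \<beta>)"
          by simp
        then show ?thesis
        proof (rule poly_deg_cong)
          fix t assume "t \<in> T"
          then have "mixed idx (snd (snd t)) i j (u0 t) (v0 t) = 0" using j(1) by (simp add: T_def)
          then have *: "snd (snd t) $ j $ \<alpha> * u0 t $ \<alpha> =
              - (u0 t $ j + (\<Sum>m\<in>{m. idx m < idx j} - {\<alpha>}. snd (snd t) $ j $ m * u0 t $ m))"
            unfolding lower_split[OF True] by linarith
          have "\<delta> t * \<tau> s t = (snd (snd t) $ j $ \<alpha> * u0 t $ \<alpha>) * v0 t $ \<beta>"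
            unfolding \<tau> m \<delta>_def by (simp only: mult_ac)
          then show "\<delta> t * \<tau> s t = - 1 * (u0 t $ j + (\<Sum>m\<in>{m. idx m < idx j} - {\<alpha>}. snd (snd t) $ j $ m * u0 t $ m)) * v0 t $ \<beta>"
            unfolding * by simp
        qed
      next
        case F: False
        then have m: "m = \<beta>" using j by (simp add: piv_def)
        have "poly_deg T I \<xi> 2 (\<lambda>t. v0 t $ j + (\<Sum>m\<in>{m. idx j < idx m} - {\<beta>}. snd (snd t) $ j $ m * v0 t $ m))"
          using fr by (intro poly_deg_add poly_deg_sum poly_deg_mult'[OF finI pc pv] poly_deg_mono[OF finI pv]) (auto simp: m)
        from poly_deg_mult'[OF finI poly_deg_scale[OF this, of "- 1"] pu, of 4 \<alpha>]
        have "poly_deg T I \<xi> 4 (\<lambda>t. - 1 * (v0 t $ j + (\<Sum>m\<in>{m. idx j < idx m} - {\<beta>}. snd (snd t) $ j $ m * v0 t $ m)) * u0 t $ \<alpha>)"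
          by simp
        then show ?thesis
        proof (rule poly_deg_cong)
          fix t assume "t \<in> T"
          then have "mixed idx (snd (snd t)) i j (u0 t) (v0 t) = 0" using j(1) by (simp add: T_def)
          then have *: "snd (snd t) $ j $ \<beta> * v0 t $ \<beta> =
              - (v0 t $ j + (\<Sum>m\<in>{m. idx j < idx m} - {\<beta>}. snd (snd t) $ j $ m * v0 t $ m))"
            unfolding upper_split[OF F j(1)] by linarith
          have "\<delta> t * \<tau> s t = (snd (snd t) $ j $ \<beta> * v0 t $ \<beta>) * u0 t $ \<alpha>"
            unfolding \<tau> m \<delta>_def by (simp only: mult_ac)
          then show "\<delta> t * \<tau> s t = - 1 * (v0 t $ j + (\<Sum>m\<in>{m. idx j < idx m} - {\<beta>}. snd (snd t) $ j $ m * v0 t $ m)) * u0 t $ \<alpha>"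
            unfolding * by simp
        qed
      qed
    qed
  qed
  \<comment> \<open>Each of the n - 1 equations removes one of the n * n entries. The source
    dimension 2k + n * n - (n - 1) is below the number n * n + 1 of target coordinates exactly if 2k
    + 1 \<le> n.\<close>
  have "card I3 + (CARD('n) - 1) = CARD('n) * CARD('n)"
  proof -
    have "card ((\<lambda>j. (j, piv j)) ` (- {i})) = CARD('n) - 1"
      by (subst card_image) (auto simp: inj_on_def Compl_eq_Diff_UNIV card_Diff_subset)
    moreover have "card Fr = CARD('n \<times> 'n) - card ((\<lambda>j. (j, piv j)) ` (- {i}))"
      unfolding Fr_def Compl_eq_Diff_UNIV by (rule card_Diff_subset) auto
    moreover have "card ((\<lambda>j. (j, piv j)) ` (- {i})) \<le> CARD('n \<times> 'n)" by (rule card_mono) auto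
    moreover have "card I3 = card Fr" unfolding I3_def by (rule card_image) simp
    ultimately show ?thesis by (simp add: card_prod)
  qed
  then have card: "2 * k + card I3 < card (insert None (range Some) :: ('n \<times> 'n) option set)"
    using k by (simp add: card_image card_prod)
  obtain E a where E: "finite E" "E \<noteq> {}" "E \<subseteq> exponents (insert None (range Some))" "\<forall>e\<in>E. a e \<noteq> 0"
    "\<forall>t\<in>T. (\<Sum>e\<in>E. a e * monom_at (insert None (range Some)) \<tau> e t) = 0"
    using elimination[OF fin _ disj dim1 dim2, of "insert None (range Some)" \<delta> 4 \<tau>] card
      poly_deg_mono[OF finI p\<delta>, of 4] p\<tau> unfolding I_def[symmetric]
    by (auto simp: \<delta>_def T_def)
  have "\<exists>E' c'. finite E' \<and> E' \<noteq> {} \<and> E' \<subseteq> exponents (range Some) \<and> (\<forall>e\<in>E'. c' e \<noteq> (0::real)) \<and>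
    (\<forall>y z. (\<lambda>n :: nat. y n None) \<longlonglongrightarrow> 0 \<and> (\<forall>n. y n None \<noteq> 0) \<and>
      (\<forall>s\<in>range Some. (\<lambda>n. y n s) \<longlonglongrightarrow> z s) \<and>
      (\<forall>n. (\<Sum>e\<in>E. a e * (\<Prod>i\<in>insert None (range Some). y n i ^ e i)) = 0) \<longrightarrow>
      (\<Sum>e\<in>E'. c' e * (\<Prod>i\<in>range Some. z i ^ e i)) = 0)"
    by (rule relation_in_limit) (use E in auto)
  then obtain E' a' where E': "finite E'" "E' \<noteq> {}" "E' \<subseteq> exponents (range Some)" "\<forall>e\<in>E'. a' e \<noteq> (0::real)"
    and limit: "\<forall>y z. (\<lambda>n :: nat. y n None) \<longlonglongrightarrow> 0 \<and> (\<forall>n. y n None \<noteq> 0) \<and>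
      (\<forall>s\<in>range Some. (\<lambda>n. y n s) \<longlonglongrightarrow> z s) \<and>
      (\<forall>n. (\<Sum>e\<in>E. a e * (\<Prod>i\<in>insert None (range Some). y n i ^ e i)) = 0) \<longrightarrow>
      (\<Sum>e\<in>E'. a' e * (\<Prod>i\<in>range Some. z i ^ e i)) = 0"
    by (elim exE conjE) (rule that)
  define val where "val c s = (case s of None \<Rightarrow> 0 | Some (j, m) \<Rightarrow> c $ j $ m)"
    for c :: "real ^ 'n ^ 'n" and s
  define H where "H c = (\<Sum>e\<in>E'. a' e * (\<Prod>s\<in>range Some. val c s ^ e s))" for c
  have "real_polynomial_function (\<lambda>c. val c s)" for s
  proof (cases s)
    case (Some jm)
    have "polynomial_function (\<lambda>c :: real ^ 'n ^ 'n. c $ j)" for j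
      by (rule polynomial_function_bounded_linear) (rule bounded_linear_vec_nth)
    then have "real_polynomial_function (\<lambda>c :: real ^ 'n ^ 'n. c $ j $ m)" for j m by (rule rpf_nth)
    then show ?thesis using Some by (cases jm) (simp add: val_def)
  qed (simp add: val_def rpf_const)
  then have "real_polynomial_function H" unfolding H_def using E'(1)
    by (intro poly_intros) auto
  moreover have "\<exists>c. H c \<noteq> 0"
  proof (rule ccontr)
    assume 0: "\<nexists>c. H c \<noteq> 0"
    have "(\<Sum>e\<in>E'. a' e * (\<Prod>s\<in>range Some. x s ^ e s)) = 0" for x
    proof -
      have "H (\<chi> j m. x (Some (j, m))) = 0" using 0 by blast
      also have "H (\<chi> j m. x (Some (j, m))) = (\<Sum>e\<in>E'. a' e * (\<Prod>s\<in>range Some. x s ^ e s))"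
        unfolding H_def by (intro sum.cong refl arg_cong2[where f="(*)"] prod.cong) (auto simp: val_def)
      finally show ?thesis .
    qed
    moreover obtain e where "e \<in> E'" using E'(2) by blast
    ultimately have "a' e = 0" using monomials_independent[OF _ E'(1) E'(3), of a' e] by simp
    then show False using E'(4) \<open>e \<in> E'\<close> by blast
  qed
  moreover have Hzero: "H c = 0"
    if mem: "\<And>n :: nat. w n \<in> \<Gamma> \<and> w' n \<in> \<Gamma> \<and> s n \<noteq> 0"
      and w0: "(\<lambda>n. fst (w n)) \<longlonglongrightarrow> 0" "(\<lambda>n. fst (w' n)) \<longlonglongrightarrow> 0"
      and lim: "(\<lambda>n. s n *\<^sub>R (fst (w n) - fst (w' n))) \<longlonglongrightarrow> u" "(\<lambda>n. s n *\<^sub>R (snd (w n) - snd (w' n))) \<longlonglongrightarrow> v"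
      and nz: "u $ \<alpha> \<noteq> 0" "v $ \<beta> \<noteq> 0" and mx: "\<And>j. j \<noteq> i \<Longrightarrow> mixed idx c i j u v = 0"
    for c w w' s u v
  proof -
    define U where "U n = s n *\<^sub>R (fst (w n) - fst (w' n))" for n
    define V where "V n = s n *\<^sub>R (snd (w n) - snd (w' n))" for n
    note lim = lim[folded U_def V_def]
    have "\<forall>\<^sub>F n in sequentially. U n $ \<alpha> \<noteq> 0 \<and> V n $ \<beta> \<noteq> 0"
      using tendsto_imp_eventually_ne[OF tendsto_vec_nth[OF lim(1)] nz(1)]
        tendsto_imp_eventually_ne[OF tendsto_vec_nth[OF lim(2)] nz(2)] by eventually_elim simp
    then obtain N where N: "\<And>n. N \<le> n \<Longrightarrow> U n $ \<alpha> \<noteq> 0 \<and> V n $ \<beta> \<noteq> 0"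
      unfolding eventually_sequentially by blast
    \<comment> \<open>The shift by N makes both pivots nonzero; the corrected matrix then satisfies
      all equations for this secant.\<close>
    define t where "t n = (w (n + N), w' (n + N), solve idx i \<alpha> \<beta> c (U (n + N)) (V (n + N)))" for n
    have tT: "t n \<in> T" for n
    proof -
      have u: "U (n + N) = s (n + N) *\<^sub>R u0 (t n)" and v: "V (n + N) = s (n + N) *\<^sub>R v0 (t n)"
        by (simp_all add: U_def V_def t_def u0_def v0_def)
      have nN: "U (n + N) $ \<alpha> \<noteq> 0" "V (n + N) $ \<beta> \<noteq> 0" using N[of "n + N"] by auto
      have "mixed idx (snd (snd (t n))) i j (u0 (t n)) (v0 (t n)) = 0" if "j \<noteq> i" for j
      proof -
        have "mixed idx (snd (snd (t n))) i j (U (n + N)) (V (n + N)) = 0"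
          using mixed_solve[OF nN that] by (simp add: t_def)
        then show ?thesis unfolding u v mixed_scale using mem by simp
      qed
      then show ?thesis using nN mem unfolding T_def u v by (simp add: t_def)
    qed
    define y where "y n x = \<tau> x (t n)" for n x
    have "(\<Sum>e\<in>E'. a' e * (\<Prod>i\<in>range Some. val c i ^ e i)) = 0"
    proof (rule limit[rule_format, of y], intro conjI allI ballI)
      have "(\<lambda>n. fst (w (n + N)) \<bullet> fst (w (n + N)) + fst (w' (n + N)) \<bullet> fst (w' (n + N))) \<longlonglongrightarrow> (0 :: real ^ 'n) \<bullet> 0 + (0 :: real ^ 'n) \<bullet> 0"
        by (intro tendsto_add tendsto_inner LIMSEQ_ignore_initial_segment[OF w0(1)]
            LIMSEQ_ignore_initial_segment[OF w0(2)])
      then show "(\<lambda>n. y n None) \<longlonglongrightarrow> 0" by (simp add: y_def \<tau>_def t_def)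
      show "y n None \<noteq> 0" for n
      proof
        assume "y n None = 0"
        then have "fst (fst (t n)) = 0" "fst (fst (snd (t n))) = 0"
          using inner_ge_zero[of "fst (fst (t n))"] inner_ge_zero[of "fst (fst (snd (t n)))"]
          by (auto simp: y_def \<tau>_def add_nonneg_eq_0_iff)
        then have "u0 (t n) = 0" by (simp add: u0_def)
        then show False using tT[of n] by (simp add: T_def)
      qed
      show "(\<lambda>n. y n x) \<longlonglongrightarrow> val c x" if x: "x \<in> range Some" for x
      proof -
        obtain j m where x: "x = Some (j, m)" using x by auto
        have "(\<lambda>n. solve idx i \<alpha> \<beta> c (U (n + N)) (V (n + N)) $ j $ m) \<longlonglongrightarrow> solve idx i \<alpha> \<beta> c u v $ j $ m"
          by (intro tendsto_solve LIMSEQ_ignore_initial_segment[OF lim(1)]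
              LIMSEQ_ignore_initial_segment[OF lim(2)] nz)
        then show ?thesis using solve_eq[OF nz mx] by (simp add: y_def \<tau>_def val_def x t_def)
      qed
      show "(\<Sum>e\<in>E. a e * (\<Prod>i\<in>insert None (range Some). y n i ^ e i)) = 0" for n
        using E(5) tT[of n] unfolding monom_at_def y_def by blast
    qed
    then show ?thesis by (simp only: H_def)
  qed
  ultimately show ?thesis
    by (intro exI[of _ H] conjI allI impI)
      (assumption, assumption, elim conjE, rule Hzero, erule spec, assumption+, blast)
qed

end

lemma tendsto_mixed:
  assumes "(U \<longlongrightarrow> u) F" "(V \<longlongrightarrow> v) F"
  shows "((\<lambda>n. mixed idx c i j (U n) (V n)) \<longlongrightarrow> mixed idx c i j u v) F"
  using assms by (cases "idx i < idx j") (simp_all add: mixed_def lower_def upper_def tendsto_intros)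

text \<open>\<alpha> is the first nonzero coordinate of u and \<beta> the last of v. If \<alpha>
  came after i, row \<alpha> of \<open>lower\<close> would reduce to \<open>u $ \<alpha>\<close> and
  contradict its equation; \<beta> is symmetric.\<close>

lemma mixed_leading_entries:
  fixes idx :: "'n::finite \<Rightarrow> nat"
  assumes "u \<noteq> 0" "v \<noteq> 0" and mixed: "\<And>j. j \<noteq> i \<Longrightarrow> mixed idx c i j u v = 0"
  obtains \<alpha> \<beta> where "idx \<alpha> \<le> idx i" "idx i \<le> idx \<beta>" "u $ \<alpha> \<noteq> 0" "v $ \<beta> \<noteq> 0"
proof -
  obtain a where a: "u $ a \<noteq> 0" using assms(1) by (auto simp: vec_eq_iff)
  obtain \<alpha> where \<alpha>: "u $ \<alpha> \<noteq> 0" "\<And>j. u $ j \<noteq> 0 \<Longrightarrow> idx \<alpha> \<le> idx j"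
    using ex_has_least_nat[of "\<lambda>j. u $ j \<noteq> 0" a idx] a by blast
  obtain b where b: "v $ b \<noteq> 0" using assms(2) by (auto simp: vec_eq_iff)
  have "\<exists>\<beta>. v $ \<beta> \<noteq> 0 \<and> (\<forall>j. v $ j \<noteq> 0 \<longrightarrow> idx j \<le> idx \<beta>)"
  proof -
    have "Max (idx ` {j. v $ j \<noteq> 0}) \<in> idx ` {j. v $ j \<noteq> 0}" using b by (intro Max_in) auto
    then obtain \<beta> where "v $ \<beta> \<noteq> 0" "Max (idx ` {j. v $ j \<noteq> 0}) = idx \<beta>" by auto
    moreover have "idx j \<le> Max (idx ` {j. v $ j \<noteq> 0})" if "v $ j \<noteq> 0" for j
      using that by (intro Max_ge) auto
    ultimately show ?thesis by metis
  qed
  then obtain \<beta> where \<beta>: "v $ \<beta> \<noteq> 0" "\<And>j. v $ j \<noteq> 0 \<Longrightarrow> idx j \<le> idx \<beta>" by blast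
  have "idx \<alpha> \<le> idx i"
  proof (rule ccontr)
    assume i: "\<not> idx \<alpha> \<le> idx i"
    have "(\<Sum>m\<in>{m. idx m < idx \<alpha>}. c $ \<alpha> $ m * u $ m) = 0"
      by (intro sum.neutral) (use \<alpha>(2) in \<open>force simp: not_le\<close>)
    then have "mixed idx c i \<alpha> u v = u $ \<alpha>" using i by (simp add: mixed_def lower_def)
    moreover have "mixed idx c i \<alpha> u v = 0" using i by (intro mixed) auto
    ultimately show False using \<alpha>(1) by simp
  qed
  moreover have "idx i \<le> idx \<beta>"
  proof (rule ccontr)
    assume i: "\<not> idx i \<le> idx \<beta>"
    have "(\<Sum>m\<in>{m. idx \<beta> < idx m}. c $ \<beta> $ m * v $ m) = 0"
      by (intro sum.neutral) (use \<beta>(2) in \<open>force simp: not_le\<close>)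
    then have "mixed idx c i \<beta> u v = v $ \<beta>" using i by (simp add: mixed_def upper_def)
    moreover have "mixed idx c i \<beta> u v = 0" using i by (intro mixed) auto
    ultimately show False using \<beta>(1) by simp
  qed
  ultimately show ?thesis using \<alpha>(1) \<beta>(1) that by blast
qed

text \<open>Each of the finitely many triples (i, \<alpha>, \<beta>) excludes only zeros of a
  nonzero polynomial, so some c avoids them all. If the bound failed for c and i, secants with
  almost vanishing kept coordinates would, after normalisation, have a limit (u, v) that makes c
  bad.\<close>

lemma general_position:
  fixes X :: "(real ^ 'n::finite) set" and idx :: "'n \<Rightarrow> nat"
  assumes idx: "inj idx" and k: "2 * k + 1 \<le> CARD('n)"
    and dim: "alg_dim_le ((\<lambda>x. (x, f x)) ` X) Basis (\<lambda>b z. z \<bullet> b) k"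
    and f: "\<And>x y. x \<in> X \<Longrightarrow> y \<in> X \<Longrightarrow> norm (f x - f y) \<le> C * norm (x - y)"
      "\<And>x y. x \<in> X \<Longrightarrow> y \<in> X \<Longrightarrow> norm (x - y) \<le> D * norm (f x - f y)"
  shows "\<exists>c. \<forall>i. \<exists>r>0. \<exists>\<kappa>>0. \<forall>x\<in>X \<inter> ball 0 r. \<forall>y\<in>X \<inter> ball 0 r.
    \<kappa> * norm (x - y) \<le> (\<Sum>j\<in>- {i}. \<bar>mixed idx c i j (x - y) (f x - f y)\<bar>)"
proof -
  let ?\<Gamma> = "(\<lambda>x. (x, f x)) ` X"
  define P where "P = {(i, \<alpha>, \<beta>). idx \<alpha> \<le> idx i \<and> idx i \<le> idx \<beta>}"
  define bad where "bad = (\<lambda>(i, \<alpha>, \<beta>) c. \<exists>w w' s u v. (\<forall>n :: nat. w n \<in> ?\<Gamma> \<and> w' n \<in> ?\<Gamma> \<and> s n \<noteq> (0::real)) \<and>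
      (\<lambda>n. fst (w n)) \<longlonglongrightarrow> 0 \<and> (\<lambda>n. fst (w' n)) \<longlonglongrightarrow> 0 \<and>
      (\<lambda>n. s n *\<^sub>R (fst (w n) - fst (w' n))) \<longlonglongrightarrow> u \<and> (\<lambda>n. s n *\<^sub>R (snd (w n) - snd (w' n))) \<longlonglongrightarrow> v \<and>
      u $ \<alpha> \<noteq> 0 \<and> v $ \<beta> \<noteq> 0 \<and> (\<forall>j. j \<noteq> i \<longrightarrow> mixed idx c i j u v = 0))"
  have "\<forall>p\<in>P. \<exists>H. real_polynomial_function H \<and> (\<exists>c. H c \<noteq> 0) \<and> (\<forall>c. bad p c \<longrightarrow> H c = 0)"
  proof
    fix p assume "p \<in> P"
    then obtain i \<alpha> \<beta> where p: "p = (i, \<alpha>, \<beta>)" "idx \<alpha> \<le> idx i" "idx i \<le> idx \<beta>" by (auto simp: P_def)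
    interpret pivots idx i \<alpha> \<beta> by unfold_locales (use idx p in auto)
    from bad_polynomial[OF dim k] obtain H where *: "real_polynomial_function H \<and> (\<exists>c. H c \<noteq> 0) \<and>
      (\<forall>c w w' s u v. (\<forall>n :: nat. w n \<in> ?\<Gamma> \<and> w' n \<in> ?\<Gamma> \<and> s n \<noteq> (0::real)) \<and>
      (\<lambda>n. fst (w n)) \<longlonglongrightarrow> 0 \<and> (\<lambda>n. fst (w' n)) \<longlonglongrightarrow> 0 \<and>
      (\<lambda>n. s n *\<^sub>R (fst (w n) - fst (w' n))) \<longlonglongrightarrow> u \<and> (\<lambda>n. s n *\<^sub>R (snd (w n) - snd (w' n))) \<longlonglongrightarrow> v \<and>
      u $ \<alpha> \<noteq> 0 \<and> v $ \<beta> \<noteq> 0 \<and> (\<forall>j. j \<noteq> i \<longrightarrow> mixed idx c i j u v = 0) \<longrightarrow> H c = 0)"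
      by (rule exE)
    note H = conjunct1[OF *] conjunct1[OF conjunct2[OF *]]
    note 0 = conjunct2[OF conjunct2[OF *]]
    have "H c = 0" if "bad p c" for c
      using that unfolding bad_def p(1) prod.case
      by (elim exE) (erule 0[rule_format])
    with H show "\<exists>H. real_polynomial_function H \<and> (\<exists>c. H c \<noteq> 0) \<and> (\<forall>c. bad p c \<longrightarrow> H c = 0)" by blast
  qed
  from bchoice[OF this] obtain H where
    H: "\<forall>p\<in>P. real_polynomial_function (H p) \<and> (\<exists>c. H p c \<noteq> 0) \<and> (\<forall>c. bad p c \<longrightarrow> H p c = 0)"
    by (rule exE)
  have "\<exists>c. \<forall>h\<in>H ` P. h c \<noteq> 0"
    by (rule prod_nonzero) (use H in auto)
  then obtain c where c: "\<And>p. p \<in> P \<Longrightarrow> \<not> bad p c" using H by blast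
  show ?thesis
  proof (intro exI[of _ c] allI)
    fix i
    show "\<exists>r>0. \<exists>\<kappa>>0. \<forall>x\<in>X \<inter> ball 0 r. \<forall>y\<in>X \<inter> ball 0 r.
        \<kappa> * norm (x - y) \<le> (\<Sum>j\<in>- {i}. \<bar>mixed idx c i j (x - y) (f x - f y)\<bar>)"
    proof (rule ccontr)
      assume neg: "\<not> ?thesis"
      define e where "e n = inverse (real (Suc n))" for n
      have e: "0 < e n" for n by (simp add: e_def)
      have elim: "e \<longlonglongrightarrow> 0" unfolding e_def by (rule LIMSEQ_inverse_real_of_nat)
      have "\<forall>n. \<exists>xy. fst xy \<in> X \<inter> ball 0 (e n) \<and> snd xy \<in> X \<inter> ball 0 (e n) \<and>
        (\<Sum>j\<in>- {i}. \<bar>mixed idx c i j (fst xy - snd xy) (f (fst xy) - f (snd xy))\<bar>) < e n * norm (fst xy - snd xy)"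
        using neg e unfolding not_le[symmetric] by (metis fst_conv snd_conv)
      from choice[OF this] obtain xy where xy: "\<And>n. fst (xy n) \<in> X \<inter> ball 0 (e n)"
        "\<And>n. snd (xy n) \<in> X \<inter> ball 0 (e n)"
        "\<And>n. (\<Sum>j\<in>- {i}. \<bar>mixed idx c i j (fst (xy n) - snd (xy n)) (f (fst (xy n)) - f (snd (xy n)))\<bar>)
          < e n * norm (fst (xy n) - snd (xy n))" by blast
      define x where "x n = fst (xy n)" for n
      define y where "y n = snd (xy n)" for n
      have X: "x n \<in> X" "y n \<in> X" for n using xy(1,2)[of n] by (auto simp: x_def y_def)
      have small: "norm (x n) < e n" "norm (y n) < e n" for n using xy(1,2)[of n] by (auto simp: x_def y_def)
      have less: "(\<Sum>j\<in>- {i}. \<bar>mixed idx c i j (x n - y n) (f (x n) - f (y n))\<bar>) < e n * norm (x n - y n)" for n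
        using xy(3)[of n] by (simp add: x_def y_def)
      have ne: "x n \<noteq> y n" for n
      proof
        assume "x n = y n"
        then have "(\<Sum>j\<in>- {i}. \<bar>mixed idx c i j (x n - y n) (f (x n) - f (y n))\<bar>) < 0" using less[of n] by simp
        then show False by (simp add: not_le[symmetric] sum_nonneg)
      qed
      \<comment> \<open>Normalising by the distance in X makes U a unit vector; the two Lipschitz
        bounds keep V bounded and away from 0.\<close>
      define s where "s n = inverse (norm (x n - y n))" for n
      have s: "0 < s n" "s n * norm (x n - y n) = 1" for n using ne[of n] by (simp_all add: s_def)
      define U where "U n = s n *\<^sub>R (x n - y n)" for n
      define V where "V n = s n *\<^sub>R (f (x n) - f (y n))" for n
      have nU: "norm (U n) = 1" for n using s[of n] by (simp add: U_def)
      have nV: "norm (V n) \<le> C" "1 \<le> D * norm (V n)" for n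
      proof -
        have "norm (V n) = s n * norm (f (x n) - f (y n))" using s(1)[of n] by (simp add: V_def)
        moreover have "s n * norm (f (x n) - f (y n)) \<le> s n * (C * norm (x n - y n))"
          using s(1)[of n] f(1)[OF X] by (simp add: mult_left_mono)
        moreover have "s n * norm (x n - y n) \<le> s n * (D * norm (f (x n) - f (y n)))"
          using s(1)[of n] f(2)[OF X] by (simp add: mult_left_mono)
        ultimately show "norm (V n) \<le> C" "1 \<le> D * norm (V n)"
          using s(2)[of n] by (simp_all add: mult.left_commute)
      qed
      have cpt: "compact (cball (0 :: real ^ 'n) 1 \<times> cball (0 :: real ^ 'n) C)" by (intro compact_Times compact_cball)
      have mem: "\<forall>n. (U n, V n) \<in> cball 0 1 \<times> cball 0 C" using nU nV by simp
      obtain l \<rho> where \<rho>: "strict_mono (\<rho> :: nat \<Rightarrow> nat)" and l: "((\<lambda>n. (U n, V n)) \<circ> \<rho>) \<longlonglongrightarrow> l"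
        by (rule seq_compactE[OF compact_imp_seq_compact[OF cpt] mem])
      define u where "u = fst l"
      define v where "v = snd l"
      have lim: "(\<lambda>n. U (\<rho> n)) \<longlonglongrightarrow> u" "(\<lambda>n. V (\<rho> n)) \<longlonglongrightarrow> v"
        using tendsto_fst[OF l] tendsto_snd[OF l] by (simp_all add: u_def v_def o_def)
      have e\<rho>: "(\<lambda>n. e (\<rho> n)) \<longlonglongrightarrow> 0" using LIMSEQ_subseq_LIMSEQ[OF elim \<rho>] by (simp add: o_def)
      have "norm u = 1" using tendsto_norm[OF lim(1)] nU by (simp add: LIMSEQ_const_iff)
      then have "u \<noteq> 0" by auto
      have "1 \<le> D * norm v"
        by (rule tendsto_lowerbound[OF tendsto_mult[OF tendsto_const tendsto_norm[OF lim(2)]]])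
          (use nV in auto)
      then have "v \<noteq> 0" by auto
      have mx: "mixed idx c i j u v = 0" if j: "j \<noteq> i" for j
      proof -
        have "\<bar>mixed idx c i j (U n) (V n)\<bar> \<le> e n" for n
        proof -
          have "\<bar>mixed idx c i j (U n) (V n)\<bar> = s n * \<bar>mixed idx c i j (x n - y n) (f (x n) - f (y n))\<bar>"
            unfolding U_def V_def mixed_scale using s(1)[of n] by (simp add: abs_mult)
          also have "\<dots> \<le> s n * (\<Sum>j\<in>- {i}. \<bar>mixed idx c i j (x n - y n) (f (x n) - f (y n))\<bar>)"
            using s(1)[of n] j by (intro mult_left_mono member_le_sum) auto
          also have "\<dots> \<le> s n * (e n * norm (x n - y n))"
            using s(1)[of n] less[of n] by (intro mult_left_mono) auto
          also have "\<dots> = e n" using s(2)[of n] by (simp add: mult.left_commute)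
          finally show ?thesis .
        qed
        then have "(\<lambda>n. mixed idx c i j (U (\<rho> n)) (V (\<rho> n))) \<longlonglongrightarrow> 0"
          by (intro Lim_null_comparison[OF _ e\<rho>] always_eventually allI) simp
        with tendsto_mixed[OF lim] show ?thesis using LIMSEQ_unique by blast
      qed
      obtain \<alpha> \<beta> where \<alpha>\<beta>: "idx \<alpha> \<le> idx i" "idx i \<le> idx \<beta>" "u $ \<alpha> \<noteq> 0" "v $ \<beta> \<noteq> 0"
        using mixed_leading_entries[OF \<open>u \<noteq> 0\<close> \<open>v \<noteq> 0\<close> mx] by blast
      have x0: "(\<lambda>n. x (\<rho> n)) \<longlonglongrightarrow> 0" "(\<lambda>n. y (\<rho> n)) \<longlonglongrightarrow> 0"
        by (rule Lim_null_comparison[OF _ e\<rho>]; use small in \<open>simp add: less_imp_le\<close>)+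
      have "bad (i, \<alpha>, \<beta>) c"
        unfolding bad_def prod.case
        by (intro exI[of _ "\<lambda>n. (x (\<rho> n), f (x (\<rho> n)))"] exI[of _ "\<lambda>n. (y (\<rho> n), f (y (\<rho> n)))"]
            exI[of _ "\<lambda>n. s (\<rho> n)"] exI[of _ u] exI[of _ v])
          (use X s(1) x0 lim \<alpha>\<beta> mx in \<open>simp add: U_def V_def less_imp_neq[symmetric]\<close>)
      moreover have "(i, \<alpha>, \<beta>) \<in> P" using \<alpha>\<beta> by (simp add: P_def)
      ultimately show False using c by blast
    qed
  qed
qed

section \<open>Families of shears\<close>

text \<open>Its norm measures the kept coordinates without leaving the ambient space.\<close>

definition omit :: "'n \<Rightarrow> real ^ 'n \<Rightarrow> real ^ 'n::finite" where
  "omit i z = (\<chi> j. if j = i then 0 else z $ j)"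

lemma omit_nth: "omit i z $ j = (if j = i then 0 else z $ j)"
  by (simp add: omit_def)

lemma norm_omit_le: "norm (omit i z) \<le> norm z"
  by (rule norm_le_componentwise_cart) (simp add: omit_nth)

lemma abs_nth_le_norm_omit: "j \<noteq> i \<Longrightarrow> \<bar>z $ j\<bar> \<le> norm (omit i z)"
  using component_le_norm_cart[of "omit i z" j] by (simp add: omit_nth)

lemma polynomial_function_omit [poly_intros]:
  fixes f :: "'a::euclidean_space \<Rightarrow> real ^ 'n::finite"
  assumes "polynomial_function f"
  shows "polynomial_function (\<lambda>x. omit i (f x))"
proof (rule polynomial_function_vecI)
  show "real_polynomial_function (\<lambda>x. omit i (f x) $ j)" for j
    unfolding omit_nth by (cases "j = i") (simp_all add: rpf_const rpf_nth assms)
qed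

text \<open>The bound by \<open>omit i\<close> says at once that p is Lipschitz and that it does not
  depend on coordinate i.\<close>

definition shear_function :: "'n \<Rightarrow> (real ^ 'n::finite \<Rightarrow> real) \<Rightarrow> bool" where
  "shear_function i p \<longleftrightarrow> p 0 = 0 \<and> semialgebraic_map UNIV p \<and>
     (\<exists>L. \<forall>x y. \<bar>p x - p y\<bar> \<le> L * norm (omit i (x - y)))"

definition shear :: "'n \<Rightarrow> (real ^ 'n::finite \<Rightarrow> real) \<Rightarrow> real \<Rightarrow> real ^ 'n \<Rightarrow> real ^ 'n" where
  "shear i p t x = x + axis i (t * p x)"

text \<open>All factors share the parameter t, so the whole composition is the identity at t =
  0.\<close>

inductive shear_family :: "(real \<Rightarrow> real ^ 'n::finite \<Rightarrow> real ^ 'n) \<Rightarrow> bool" where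
  id: "shear_family (\<lambda>t x. x)"
| step: "shear_family F \<Longrightarrow> shear_function i p \<Longrightarrow> shear_family (\<lambda>t x. shear i p t (F t x))"

lemma shear_family_compose:
  "shear_family F' \<Longrightarrow> shear_family F \<Longrightarrow> shear_family (\<lambda>t x. F' t (F t x))"
proof (induction rule: shear_family.induct)
  case (step F' i p)
  from shear_family.step[OF step(3)[OF step(4)] step(2)] show ?case .
qed

lemma shear_family_0: "shear_family F \<Longrightarrow> F 0 x = x"
  by (induction rule: shear_family.induct) (simp_all add: shear_def axis_def vec_eq_iff)

lemma continuous_on_axis [continuous_intros]:
  "continuous_on S f \<Longrightarrow> continuous_on S (\<lambda>x. axis i (f x) :: real ^ 'n::finite)"
proof -
  assume "continuous_on S f"
  then have "continuous_on S (\<lambda>x. if j = i then f x else 0)" for j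
    by (cases "j = i") (auto intro: continuous_on_const)
  then show ?thesis unfolding axis_def by (rule continuous_on_vec_lambda)
qed

lemma norm_axis: "norm (axis i x :: real ^ 'n::finite) = \<bar>x\<bar>"
proof -
  have "(axis i x :: real ^ 'n) = x *\<^sub>R axis i 1" by (simp add: axis_def vec_eq_iff)
  then show ?thesis by (simp add: norm_axis_1)
qed

lemma shear_function_continuous:
  assumes "shear_function i p"
  shows "continuous_on S p"
proof -
  obtain L where L: "\<And>x y. \<bar>p x - p y\<bar> \<le> L * norm (omit i (x - y))"
    using assms unfolding shear_function_def by blast
  have "dist (p x) (p y) \<le> \<bar>L\<bar> * dist x y" for x y
  proof -
    have "\<bar>p x - p y\<bar> \<le> \<bar>L\<bar> * norm (omit i (x - y))"
      using L[of x y] by (meson abs_ge_self mult_right_mono norm_ge_zero order.trans)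
    also have "\<dots> \<le> \<bar>L\<bar> * norm (x - y)" by (intro mult_left_mono norm_omit_le) auto
    finally show ?thesis by (simp add: dist_norm)
  qed
  then have "\<bar>L\<bar>-lipschitz_on S p" by (intro lipschitz_onI) auto
  then show ?thesis by (rule lipschitz_on_continuous_on)
qed

lemma shear_family_continuous:
  "shear_family F \<Longrightarrow> continuous_on UNIV (\<lambda>z. F (snd z) (fst z))"
proof (induction rule: shear_family.induct)
  case id
  show ?case by (intro continuous_intros)
next
  case (step F i p)
  have "continuous_on UNIV (\<lambda>z. p (F (snd z) (fst z)))"
    by (rule continuous_on_compose2[OF shear_function_continuous[OF step(2), of UNIV] step(3)]) simp
  with step(3) show ?case unfolding shear_def by (intro continuous_intros)
qed

lemma semialgebraic_map_Pair:
  assumes "semialgebraic_map S f" "semialgebraic_map S g"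
  shows "semialgebraic_map S (\<lambda>x. (f x, g x))"
proof -
  have "semialgebraic {z. (fst z, fst (snd z)) \<in> {z. fst z \<in> S \<and> snd z = f (fst z)} \<and>
      (fst z, snd (snd z)) \<in> {z. fst z \<in> S \<and> snd z = g (fst z)}}"
    by (intro semialgebraic_conj semialgebraic_vimage[OF assms(1)[unfolded semialgebraic_map_iff]]
        semialgebraic_vimage[OF assms(2)[unfolded semialgebraic_map_iff]] poly_intros)
  moreover have "{z. (fst z, fst (snd z)) \<in> {z. fst z \<in> S \<and> snd z = f (fst z)} \<and>
      (fst z, snd (snd z)) \<in> {z. fst z \<in> S \<and> snd z = g (fst z)}} =
      {z. fst z \<in> S \<and> snd z = (f (fst z), g (fst z))}" by (auto simp: prod_eq_iff)
  ultimately show ?thesis by (simp add: semialgebraic_map_iff)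
qed

lemma polynomial_function_axis [poly_intros]:
  fixes f :: "'a::euclidean_space \<Rightarrow> real"
  assumes "real_polynomial_function f"
  shows "polynomial_function (\<lambda>x. axis i (f x) :: real ^ 'n::finite)"
proof (rule polynomial_function_vecI)
  show "real_polynomial_function (\<lambda>x. (axis i (f x) :: real ^ 'n) $ j)" for j
    using assms by (cases "j = i") (simp_all add: axis_def rpf_const)
qed

lemma shear_family_semialgebraic:
  "shear_family F \<Longrightarrow> semialgebraic_map UNIV (\<lambda>z. F (snd z) (fst z))"
proof (induction rule: shear_family.induct)
  case id
  show ?case by (intro semialgebraic_map_polynomial semialgebraic_UNIV poly_intros)
next
  case (step F i p)
  have p: "semialgebraic_map UNIV p" using step(2) by (simp add: shear_function_def)
  have 1: "semialgebraic_map UNIV (\<lambda>z. p (F (snd z) (fst z)))"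
    by (rule semialgebraic_map_compose[OF step(3) p]) simp
  have 2: "semialgebraic_map UNIV (\<lambda>z :: (real ^ 'a) \<times> real. snd z)"
    by (intro semialgebraic_map_polynomial semialgebraic_UNIV poly_intros)
  have 3: "semialgebraic_map UNIV (\<lambda>w :: (real ^ 'a) \<times> real \<times> real. fst w + axis i (fst (snd w) * snd (snd w)))"
    by (intro semialgebraic_map_polynomial semialgebraic_UNIV poly_intros)
  from semialgebraic_map_compose[OF semialgebraic_map_Pair[OF step(3) semialgebraic_map_Pair[OF 2 1]] 3]
  show ?case by (simp add: shear_def)
qed

lemma shear_family_slice:
  assumes "shear_family F"
  shows "semialgebraic_map UNIV (F t)"
proof -
  have "semialgebraic_map UNIV (\<lambda>x :: real ^ 'a. (x, t))"
    by (intro semialgebraic_map_polynomial semialgebraic_UNIV poly_intros)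
  from semialgebraic_map_compose[OF this shear_family_semialgebraic[OF assms]] show ?thesis by simp
qed

section \<open>Bi-Lipschitz and tame germs from shears\<close>

definition bilipschitz :: "('a::euclidean_space \<Rightarrow> 'a) \<Rightarrow> ('a \<Rightarrow> 'a) \<Rightarrow> bool" where
  "bilipschitz F G \<longleftrightarrow> F 0 = 0 \<and> (\<forall>x. G (F x) = x) \<and> (\<forall>y. F (G y) = y) \<and>
     (\<exists>C. C-lipschitz_on UNIV F) \<and> (\<exists>D. D-lipschitz_on UNIV G)"

lemma bilipschitz_imp_germ:
  assumes "bilipschitz F G"
  shows "bilipschitz_homeo_germ F"
proof -
  obtain C D where CD: "C-lipschitz_on UNIV F" "D-lipschitz_on UNIV G" using assms unfolding bilipschitz_def by blast
  have "homeomorphism UNIV UNIV F G"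
    by (rule homeomorphismI) (use assms CD in \<open>auto simp: bilipschitz_def intro: lipschitz_on_continuous_on\<close>)
  then show ?thesis
    using assms CD unfolding bilipschitz_homeo_germ_def bilipschitz_germs_def bilipschitz_def
    by (intro exI[of _ G] conjI exI[of _ UNIV] exI[of _ C] exI[of _ D]) auto
qed

lemma bilipschitz_id: "bilipschitz (\<lambda>x. x) (\<lambda>x. x)"
  unfolding bilipschitz_def by (auto intro!: exI[of _ 1] lipschitz_onI)

lemma bilipschitz_compose:
  assumes "bilipschitz F G" "bilipschitz F' G'"
  shows "bilipschitz (\<lambda>x. F' (F x)) (\<lambda>y. G (G' y))"
proof -
  obtain C D C' D' where CD: "C-lipschitz_on UNIV F" "D-lipschitz_on UNIV G" "C'-lipschitz_on UNIV F'" "D'-lipschitz_on UNIV G'"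
    using assms unfolding bilipschitz_def by blast
  have "(C' * C)-lipschitz_on UNIV (\<lambda>x. F' (F x))"
    by (rule lipschitz_on_compose2[OF CD(1)]) (rule lipschitz_on_subset[OF CD(3)], simp)
  moreover have "(D * D')-lipschitz_on UNIV (\<lambda>x. G (G' x))"
    by (rule lipschitz_on_compose2[OF CD(4)]) (rule lipschitz_on_subset[OF CD(2)], simp)
  ultimately show ?thesis using assms unfolding bilipschitz_def by auto
qed

text \<open>As p does not see coordinate i, the shear with -t undoes the shear with t.\<close>

lemma bilipschitz_shear:
  assumes p: "p 0 = 0" "\<And>x y. \<bar>p x - p y\<bar> \<le> L * norm (omit i (x - y))"
  shows "bilipschitz (shear i p t) (shear i p (- t))"
proof -
  have lip: "(1 + \<bar>s\<bar> * \<bar>L\<bar>)-lipschitz_on UNIV (shear i p s)" for s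
  proof (rule lipschitz_onI)
    fix x y :: "real ^ 'a"
    have "\<bar>p x - p y\<bar> \<le> \<bar>L\<bar> * norm (omit i (x - y))"
      using p(2)[of x y] by (meson abs_ge_self mult_right_mono norm_ge_zero order.trans)
    also have "\<dots> \<le> \<bar>L\<bar> * norm (x - y)" by (intro mult_left_mono norm_omit_le) auto
    finally have le: "\<bar>p x - p y\<bar> \<le> \<bar>L\<bar> * norm (x - y)" .
    have "shear i p s x - shear i p s y = (x - y) + axis i (s * (p x - p y))"
      by (simp add: shear_def vec_eq_iff axis_def algebra_simps)
    then have "norm (shear i p s x - shear i p s y) \<le> norm (x - y) + norm (axis i (s * (p x - p y)) :: real ^ 'a)"
      by (metis norm_triangle_ineq)
    also have "\<dots> = norm (x - y) + \<bar>s\<bar> * \<bar>p x - p y\<bar>" by (simp add: norm_axis abs_mult)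
    also have "\<dots> \<le> norm (x - y) + \<bar>s\<bar> * (\<bar>L\<bar> * norm (x - y))" using le by (simp add: mult_left_mono)
    finally show "dist (shear i p s x) (shear i p s y) \<le> (1 + \<bar>s\<bar> * \<bar>L\<bar>) * dist x y"
      by (simp add: dist_norm algebra_simps)
  qed simp
  have inv: "shear i p (- s) (shear i p s x) = x" for s x
  proof -
    have "omit i (shear i p s x - x) = 0" by (simp add: vec_eq_iff omit_nth shear_def axis_def)
    then have "p (shear i p s x) = p x" using p(2)[of "shear i p s x" x] by simp
    then show ?thesis by (simp add: shear_def vec_eq_iff axis_def)
  qed
  have "shear i p t 0 = 0" using p(1) by (simp add: shear_def axis_def vec_eq_iff)
  then show ?thesis unfolding bilipschitz_def
    using lip[of t] lip[of "- t"] inv[of t] inv[of "- t"] by (intro conjI allI exI) auto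
qed

lemma shear_family_bilipschitz: "shear_family F \<Longrightarrow> \<exists>G. bilipschitz (F t) G"
proof (induction rule: shear_family.induct)
  case id
  show ?case by (rule exI[of _ "\<lambda>x. x"], rule bilipschitz_id)
next
  case (step F i p)
  then obtain G where "bilipschitz (F t) G" by blast
  moreover obtain L where "p 0 = 0" "\<And>x y. \<bar>p x - p y\<bar> \<le> L * norm (omit i (x - y))"
    using step(2) unfolding shear_function_def by blast
  ultimately show ?case using bilipschitz_compose[OF _ bilipschitz_shear] by blast
qed

text \<open>For i \<noteq> l, a quarter turn in the plane of these coordinates. The sign makes the
  determinant 1, as tameness requires; a plain exchange would have determinant -1.\<close>

definition turn :: "'n \<Rightarrow> 'n \<Rightarrow> real ^ 'n \<Rightarrow> real ^ 'n::finite" where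
  "turn i l x = (\<chi> j. if j = l then x $ i else if j = i then - x $ l else x $ j)"

lemma linear_turn: "linear (turn i l)"
  by (rule linearI) (simp_all add: turn_def vec_eq_iff)

lemma turn_turn: "i \<noteq> l \<Longrightarrow> turn l i (turn i l x) = x"
  by (simp add: turn_def vec_eq_iff)

lemma det_turn:
  assumes "i \<noteq> l"
  shows "det (matrix (turn i l :: real ^ 'n::finite \<Rightarrow> _)) = 1"
proof -
  let ?\<sigma> = "Transposition.transpose i l"
  let ?s = "\<lambda>j. if j = i then - 1 else 1 :: real"
  \<comment> \<open>The matrix is an identity with two rows exchanged and one negated; both
    operations contribute -1.\<close>
  have "matrix (turn i l) = (\<chi> j. ?s j *s (mat 1 :: real ^ 'n ^ 'n) $ ?\<sigma> j)"
    using assms by (auto simp: matrix_def vec_eq_iff turn_def axis_def mat_def Transposition.transpose_def)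
  then have "det (matrix (turn i l)) = prod ?s UNIV * det (\<chi> j. (mat 1 :: real ^ 'n ^ 'n) $ ?\<sigma> j)"
    by (simp only: det_rows_mul)
  also have "det (\<chi> j. (mat 1 :: real ^ 'n ^ 'n) $ ?\<sigma> j) = of_int (sign ?\<sigma>) * det (mat 1 :: real ^ 'n ^ 'n)"
    by (rule det_permute_rows) (simp add: permutes_swap_id)
  also have "prod ?s UNIV = - 1" by (simp add: prod.delta)
  finally show ?thesis using assms by (simp add: sign_swap_id)
qed

lemma shear_germ_shear:
  assumes p: "p 0 = 0" "\<And>x y. \<bar>p x - p y\<bar> \<le> L * norm (omit l (x - y))"
  shows "shear_germ l (shear l p t)"
proof -
  have "p x = p y" if "\<forall>i. i \<noteq> l \<longrightarrow> x $ i = y $ i" for x y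
  proof -
    have "omit l (x - y) = 0" using that by (simp add: vec_eq_iff omit_nth)
    then show ?thesis using p(2)[of x y] by simp
  qed
  then have "\<forall>x y. (\<forall>i. i \<noteq> l \<longrightarrow> x $ i = y $ i) \<longrightarrow> t * p x = t * p y" by metis
  moreover have "shear l p t x = (\<chi> i. if i = l then x $ l + t * p x else x $ i)" for x
    by (simp add: shear_def vec_eq_iff axis_def)
  ultimately show ?thesis unfolding shear_germ_def
    using bilipschitz_imp_germ[OF bilipschitz_shear[OF p]] by (intro conjI exI[of _ "\<lambda>x. t * p x"]) auto
qed

lemma shear_conjugate:
  assumes "i \<noteq> l"
  shows "shear i p t x = turn l i (shear l (\<lambda>y. p (turn l i y)) t (turn i l x))"
  unfolding shear_def turn_turn[OF assms] using assms
  by (simp add: turn_def vec_eq_iff axis_def)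

text \<open>Tameness admits only shears in coordinate l; a shear in another coordinate is one of
  these conjugated by quarter turns.\<close>

lemma shear_tame:
  assumes "shear_function i p"
  shows "\<exists>Hs. (\<forall>H\<in>set Hs. shear_germ l H \<or> (linear H \<and> det (matrix H) = 1)) \<and> shear i p t = foldr (\<circ>) Hs id"
proof -
  obtain L where p: "p 0 = 0" "\<And>x y. \<bar>p x - p y\<bar> \<le> L * norm (omit i (x - y))"
    using assms unfolding shear_function_def by blast
  show ?thesis
  proof (cases "i = l")
    case True
    then show ?thesis using shear_germ_shear[of p L l t] p by (intro exI[of _ "[shear i p t]"]) auto
  next
    case False
    define q where "q y = p (turn l i y)" for y
    have "omit i (turn l i x - turn l i y) $ j = omit i (turn l i (omit l (x - y))) $ j" for x y j
      using False by (auto simp: omit_nth turn_def)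
    then have eq: "omit i (turn l i x - turn l i y) = omit i (turn l i (omit l (x - y)))" for x y
      by (simp add: vec_eq_iff)
    \<comment> \<open>A crude bound suffices, since any Lipschitz constant will do.\<close>
    have nt: "norm (turn l i z) \<le> real CARD('a) * norm z" for z
    proof -
      have "norm (turn l i z) \<le> (\<Sum>j\<in>UNIV. \<bar>turn l i z $ j\<bar>)" by (rule norm_le_l1_cart)
      also have "\<dots> \<le> (\<Sum>j\<in>(UNIV::'a set). norm z)"
        by (intro sum_mono) (auto simp: turn_def component_le_norm_cart)
      finally show ?thesis by simp
    qed
    have "\<bar>q x - q y\<bar> \<le> (\<bar>L\<bar> * real CARD('a)) * norm (omit l (x - y))" for x y
    proof -
      have "\<bar>q x - q y\<bar> \<le> \<bar>L\<bar> * norm (omit i (turn l i (omit l (x - y))))"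
        unfolding q_def using p(2)[of "turn l i x" "turn l i y"] unfolding eq
        by (meson abs_ge_self mult_right_mono norm_ge_zero order.trans)
      also have "\<dots> \<le> \<bar>L\<bar> * (real CARD('a) * norm (omit l (x - y)))"
        by (intro mult_left_mono order.trans[OF norm_omit_le nt]) auto
      finally show ?thesis by (simp add: mult.assoc)
    qed
    moreover have "q 0 = 0" using p(1) by (simp add: q_def linear_0[OF linear_turn])
    ultimately have "shear_germ l (shear l q t)" by (intro shear_germ_shear)
    moreover have "shear i p t = foldr (\<circ>) [turn l i, shear l q t, turn i l] id"
      using shear_conjugate[OF False, of p t] unfolding q_def[abs_def] by (simp add: fun_eq_iff)
    ultimately show ?thesis using False det_turn[of l i] det_turn[of i l] linear_turn
      by (intro exI[of _ "[turn l i, shear l q t, turn i l]"]) auto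
  qed
qed

lemma foldr_comp_append: "foldr (\<circ>) (xs @ ys) id = foldr (\<circ>) xs id \<circ> foldr (\<circ>) ys id"
  by (induction xs) auto

lemma shear_family_tame:
  assumes "shear_family F"
  shows "tame_semialgebraic_homeo_germ l (F t)"
proof -
  have "\<exists>Hs. (\<forall>H\<in>set Hs. shear_germ l H \<or> (linear H \<and> det (matrix H) = 1)) \<and> F t = foldr (\<circ>) Hs id"
    using assms
  proof (induction rule: shear_family.induct)
    case id
    show ?case by (intro exI[of _ "[]"]) (auto simp: fun_eq_iff)
  next
    case (step F i p)
    obtain Hs where Hs: "\<forall>H\<in>set Hs. shear_germ l H \<or> (linear H \<and> det (matrix H) = 1)" "F t = foldr (\<circ>) Hs id"
      using step(3) by blast
    obtain Hs' where Hs': "\<forall>H\<in>set Hs'. shear_germ l H \<or> (linear H \<and> det (matrix H) = 1)"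
      "shear i p t = foldr (\<circ>) Hs' id"
      using shear_tame[OF step(2), of l t] by blast
    have "(\<lambda>x. shear i p t (F t x)) = foldr (\<circ>) (Hs' @ Hs) id"
      unfolding foldr_comp_append Hs(2)[symmetric] Hs'(2)[symmetric] by (simp add: o_def)
    moreover have "\<forall>H\<in>set (Hs' @ Hs). shear_germ l H \<or> (linear H \<and> det (matrix H) = 1)"
      using Hs(1) Hs'(1) by auto
    ultimately show ?case by (intro exI[of _ "Hs' @ Hs"] conjI)
  qed
  then have "tame_germ l (F t)"
    using shear_family_bilipschitz[OF assms, of t] bilipschitz_imp_germ unfolding tame_germ_def by auto
  moreover have "semialgebraic_germ UNIV (F t)"
    unfolding semialgebraic_germ_def using shear_family_slice[OF assms, of t]
    by (intro exI[of _ UNIV]) auto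
  ultimately show ?thesis by (simp add: tame_semialgebraic_homeo_germ_def)
qed


section \<open>Lipschitz extension\<close>

text \<open>McShane's extension; the infimum is attained by compactness, which makes it semialgebraic.\<close>

lemma lipschitz_extension:
  fixes D :: "((real ^ 'n::finite) \<times> real) set"
  assumes D: "compact D" "semialgebraic D" "(0, 0) \<in> D"
    and lip: "\<And>w y w' y'. (w, y) \<in> D \<Longrightarrow> (w', y') \<in> D \<Longrightarrow> \<bar>y - y'\<bar> \<le> C * norm (omit i (w - w'))"
    and "0 \<le> C"
  obtains p where "shear_function i p" "\<And>w y. (w, y) \<in> D \<Longrightarrow> p w = y"
proof -
  \<comment> \<open>The extension is the minimum of \<phi> z over D. Measuring distances by
    \<open>omit i\<close> makes it independent of coordinate i.\<close>
  define \<phi> where "\<phi> z d = snd d + C * norm (omit i (z - fst d))" for z and d :: "(real ^ 'n) \<times> real"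
  have cont_omit: "continuous_on S (\<lambda>x. omit i (h x))" if "continuous_on S h"
    for h :: "(real ^ 'n) \<times> real \<Rightarrow> real ^ 'n" and S
    unfolding omit_def
  proof (rule continuous_on_vec_lambda)
    show "continuous_on S (\<lambda>x. if j = i then 0 else h x $ j)" for j
      by (cases "j = i") (use that in \<open>auto intro: continuous_intros\<close>)
  qed
  have ex: "\<exists>d\<in>D. \<forall>e\<in>D. \<phi> z d \<le> \<phi> z e" for z
  proof (rule continuous_attains_inf[OF D(1)])
    show "continuous_on D (\<phi> z)" unfolding \<phi>_def by (intro continuous_intros cont_omit)
  qed (use D(3) in auto)
  define m where "m z = (SOME d. d \<in> D \<and> (\<forall>e\<in>D. \<phi> z d \<le> \<phi> z e))" for z
  have m: "m z \<in> D" "\<And>e. e \<in> D \<Longrightarrow> \<phi> z (m z) \<le> \<phi> z e" for z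
    using someI_ex[of "\<lambda>d. d \<in> D \<and> (\<forall>e\<in>D. \<phi> z d \<le> \<phi> z e)"] ex[of z] unfolding m_def by blast+
  define p where "p z = \<phi> z (m z)" for z
  have p_le: "p z \<le> \<phi> z e" if "e \<in> D" for z e using m(2)[OF that] by (simp add: p_def)
  have p_val: "p w = y" if "(w, y) \<in> D" for w y
  proof (rule antisym)
    have "omit i (w - w) = 0" by (simp add: vec_eq_iff omit_def)
    then show "p w \<le> y" using p_le[OF that, of w] by (simp add: \<phi>_def)
    obtain w' y' where w': "m w = (w', y')" "(w', y') \<in> D" using m(1)[of w] by (cases "m w") auto
    show "y \<le> p w" using lip[OF that w'(2)] by (simp add: p_def \<phi>_def w'(1))
  qed
  have p_lip: "p z - p z' \<le> C * norm (omit i (z - z'))" for z z'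
  proof -
    have "p z \<le> snd (m z') + C * norm (omit i (z - fst (m z')))" using p_le[OF m(1), of z z'] by (simp add: \<phi>_def)
    also have "omit i (z - fst (m z')) = omit i (z - z') + omit i (z' - fst (m z'))"
      by (simp add: vec_eq_iff omit_def)
    also have "C * norm (omit i (z - z') + omit i (z' - fst (m z'))) \<le>
        C * (norm (omit i (z - z')) + norm (omit i (z' - fst (m z'))))"
      using \<open>0 \<le> C\<close> by (intro mult_left_mono norm_triangle_ineq)
    finally show ?thesis by (simp add: p_def \<phi>_def distrib_left)
  qed
  have "\<bar>p z - p z'\<bar> \<le> C * norm (omit i (z - z'))" for z z'
  proof -
    have "omit i (z' - z) = - omit i (z - z')" by (simp add: vec_eq_iff omit_def)
    then show ?thesis using p_lip[of z z'] p_lip[of z' z] by simp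
  qed
  moreover have "p 0 = 0" using p_val[OF D(3)] .
  moreover have "semialgebraic_map UNIV p"
  proof -
    \<comment> \<open>The norm is not polynomial; its value enters as a quantified s \<ge> 0 subject
      to a polynomial equation.\<close>
    have norm_iff: "s = norm x \<longleftrightarrow> 0 \<le> s \<and> s * s = x \<bullet> x" for s and x :: "real ^ 'n"
    proof
      assume "s = norm x"
      then show "0 \<le> s \<and> s * s = x \<bullet> x" by (simp add: power2_norm_eq_inner[symmetric] power2_eq_square)
    next
      assume *: "0 \<le> s \<and> s * s = x \<bullet> x"
      then have "s\<^sup>2 = (norm x)\<^sup>2" by (simp add: dot_square_norm power2_eq_square)
      with * show "s = norm x" using power2_eq_iff_nonneg[of s "norm x"] by simp
    qed
    let ?le = "\<lambda>z v d. \<exists>s. (0 \<le> s \<and> s * s = omit i (z - fst d) \<bullet> omit i (z - fst d)) \<and> v = snd d + C * s"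
    have eq: "?le z v d \<longleftrightarrow> v = \<phi> z d" for z v d
      unfolding norm_iff[symmetric] \<phi>_def by auto
    have "snd x = p (fst x) \<longleftrightarrow> (\<exists>d. d \<in> D \<and> ?le (fst x) (snd x) d) \<and>
        (\<forall>d. d \<in> D \<longrightarrow> (\<exists>v. ?le (fst x) v d \<and> snd x \<le> v))" for x :: "(real ^ 'n) \<times> real"
      unfolding eq
    proof (intro iffI conjI allI impI)
      assume x: "snd x = p (fst x)"
      show "\<exists>d. d \<in> D \<and> snd x = \<phi> (fst x) d" using m(1)[of "fst x"] x unfolding p_def by blast
      fix d assume "d \<in> D"
      then show "\<exists>v. v = \<phi> (fst x) d \<and> snd x \<le> v" using p_le x by simp
    next
      assume "(\<exists>d. d \<in> D \<and> snd x = \<phi> (fst x) d) \<and> (\<forall>d. d \<in> D \<longrightarrow> (\<exists>v. v = \<phi> (fst x) d \<and> snd x \<le> v))"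
      then obtain d where "d \<in> D" "snd x = \<phi> (fst x) d" "snd x \<le> \<phi> (fst x) (m (fst x))"
        using m(1)[of "fst x"] by blast
      then show "snd x = p (fst x)" using p_le[of d "fst x"] by (simp add: p_def)
    qed
    moreover have "semialgebraic {x :: (real ^ 'n) \<times> real. (\<exists>d. d \<in> D \<and> ?le (fst x) (snd x) d) \<and>
        (\<forall>d. d \<in> D \<longrightarrow> (\<exists>v. ?le (fst x) v d \<and> snd x \<le> v))}"
      by (intro semialgebraic_conj semialgebraic_exI semialgebraic_allI semialgebraic_imp semialgebraic_eq
          semialgebraic_le semialgebraic_vimage[OF D(2)] poly_intros)
    ultimately show ?thesis unfolding semialgebraic_map_iff by simp
  qed
  ultimately have "shear_function i p" unfolding shear_function_def by blast
  then show ?thesis using p_val that by blast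
qed

section \<open>Chains of embeddings joined by shears\<close>

definition reach :: "'a set \<Rightarrow> ('a \<Rightarrow> real ^ 'n::finite) \<Rightarrow> ('a \<Rightarrow> real ^ 'n) \<Rightarrow> bool" where
  "reach K g g' \<longleftrightarrow> (\<exists>F. shear_family F \<and> (\<forall>x\<in>K. F 1 (g x) = g' x))"

lemma reach_refl: "(\<And>x. x \<in> K \<Longrightarrow> g x = g' x) \<Longrightarrow> reach K g g'"
  unfolding reach_def using shear_family.id by blast

lemma reach_trans:
  assumes "reach K g g'" "reach K g' g''"
  shows "reach K g g''"
proof -
  obtain F F' where F: "shear_family F" "\<forall>x\<in>K. F 1 (g x) = g' x" "shear_family F'" "\<forall>x\<in>K. F' 1 (g' x) = g'' x"
    using assms unfolding reach_def by blast
  have "shear_family (\<lambda>t x. F' t (F t x))" by (rule shear_family_compose[OF F(3,1)])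
  moreover have "\<forall>x\<in>K. F' 1 (F 1 (g x)) = g'' x" using F(2,4) by simp
  ultimately show ?thesis unfolding reach_def by (intro exI[of _ "\<lambda>t x. F' t (F t x)"] conjI)
qed

text \<open>By the bound with \<open>omit i\<close>, the required increment of coordinate i is a
  well-defined Lipschitz function of the kept coordinates on the image of K; its extension defines
  the shear.\<close>

lemma reach_step:
  fixes f :: "real ^ 'n::finite \<Rightarrow> real ^ 'n"
  assumes K: "compact K" "0 \<in> K" and f: "continuous_on K f" "semialgebraic_map K f" "f 0 = 0"
    and P: "polynomial_function P" "polynomial_function P'" "P (0, 0) = 0" "P' (0, 0) = 0"
    and other: "\<And>x j. x \<in> K \<Longrightarrow> j \<noteq> i \<Longrightarrow> P' (x, f x) $ j = P (x, f x) $ j"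
    and lip: "\<And>x y. x \<in> K \<Longrightarrow> y \<in> K \<Longrightarrow>
      \<bar>(P' (x, f x) $ i - P (x, f x) $ i) - (P' (y, f y) $ i - P (y, f y) $ i)\<bar> \<le>
        C * norm (omit i (P (x, f x) - P (y, f y)))" and "0 \<le> C"
  shows "reach K (\<lambda>x. P (x, f x)) (\<lambda>x. P' (x, f x))"
proof -
  \<comment> \<open>Q records a position with the increment required there. Its image over K is the
    graph to be extended, compact and semialgebraic like K.\<close>
  define Q where "Q z = (P z, P' z $ i - P z $ i)" for z
  have pQ: "polynomial_function Q" unfolding Q_def by (intro poly_intros P pf_of_rpf)
  have contg: "continuous_on K (\<lambda>x. (x, f x))" by (intro continuous_intros f)
  have cont: "continuous_on K (\<lambda>x. Q (x, f x))"
    by (rule continuous_on_compose2[OF continuous_on_polymonial_function[OF pQ] contg subset_UNIV])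
  have sg: "semialgebraic_map K (\<lambda>x. (x, f x))"
    by (intro semialgebraic_map_Pair semialgebraic_map_polynomial semialgebraic_map_domain[OF f(2)] f poly_intros)
  have sQ: "semialgebraic_map UNIV Q" by (intro semialgebraic_map_polynomial semialgebraic_UNIV pQ)
  have "semialgebraic_map K (\<lambda>x. Q (x, f x))"
    by (rule semialgebraic_map_compose[OF sg sQ subset_UNIV])
  then have sD: "semialgebraic ((\<lambda>x. Q (x, f x)) ` K)" by (rule semialgebraic_map_image)
  have Q0: "Q (0, f 0) = (0, 0)" using P(3,4) f(3) by (simp add: Q_def)
  have 0: "(0, 0) \<in> (\<lambda>x. Q (x, f x)) ` K"
    using imageI[OF K(2), of "\<lambda>x. Q (x, f x)"] unfolding Q0 .
  obtain p where p: "shear_function i p" "\<And>w y. (w, y) \<in> (\<lambda>x. Q (x, f x)) ` K \<Longrightarrow> p w = y"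
    by (rule lipschitz_extension[OF compact_continuous_image[OF cont K(1)] sD 0 _ \<open>0 \<le> C\<close>, of i])
      (use lip in \<open>auto simp: Q_def\<close>)
  have "shear i p 1 (P (x, f x)) = P' (x, f x)" if x: "x \<in> K" for x
  proof -
    have "p (P (x, f x)) = P' (x, f x) $ i - P (x, f x) $ i"
      by (rule p(2)) (use x in \<open>simp add: Q_def\<close>)
    then show ?thesis using other[OF x] by (simp add: shear_def vec_eq_iff axis_def)
  qed
  with shear_family.step[OF shear_family.id p(1)] show ?thesis
    unfolding reach_def by (intro exI[of _ "\<lambda>t. shear i p t"] conjI) auto
qed

lemma abs_sum_le_norm_omit:
  assumes "i \<notin> M"
  shows "\<bar>\<Sum>m\<in>M. a m * z $ m\<bar> \<le> (\<Sum>m\<in>M. \<bar>a m\<bar>) * norm (omit i z)"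
proof -
  have "\<bar>\<Sum>m\<in>M. a m * z $ m\<bar> \<le> (\<Sum>m\<in>M. \<bar>a m * z $ m\<bar>)" by (rule sum_abs)
  also have "\<dots> \<le> (\<Sum>m\<in>M. \<bar>a m\<bar> * norm (omit i z))"
    using assms by (intro sum_mono) (auto simp: abs_mult intro!: mult_left_mono abs_nth_le_norm_omit)
  finally show ?thesis by (simp add: sum_distrib_right)
qed

lemma rpf_lower:
  fixes g :: "'a::euclidean_space \<Rightarrow> real ^ 'n::finite"
  shows "polynomial_function g \<Longrightarrow> real_polynomial_function (\<lambda>z. lower idx c j (g z))"
  unfolding lower_def by (intro poly_intros) auto

lemma rpf_upper:
  fixes g :: "'a::euclidean_space \<Rightarrow> real ^ 'n::finite"
  shows "polynomial_function g \<Longrightarrow> real_polynomial_function (\<lambda>z. upper idx c j (g z))"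
  unfolding upper_def by (intro poly_intros) auto

lemma lower_diff: "lower idx c j (x - y) = lower idx c j x - lower idx c j y"
  by (simp add: lower_def right_diff_distrib sum_subtractf)

lemma upper_diff: "upper idx c j (x - y) = upper idx c j x - upper idx c j y"
  by (simp add: upper_def right_diff_distrib sum_subtractf)

lemma abs_affine_row_le:
  "\<bar>u $ j + (\<Sum>m\<in>M. a m * u $ m)\<bar> \<le> (1 + (\<Sum>m\<in>M. \<bar>a m\<bar>)) * norm u"
proof -
  have "\<bar>u $ j + (\<Sum>m\<in>M. a m * u $ m)\<bar> \<le> \<bar>u $ j\<bar> + (\<Sum>m\<in>M. \<bar>a m * u $ m\<bar>)"
    by (intro order.trans[OF abs_triangle_ineq] add_mono sum_abs order.refl)
  also have "\<dots> \<le> norm u + (\<Sum>m\<in>M. \<bar>a m\<bar> * norm u)"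
    by (intro add_mono sum_mono component_le_norm_cart)
      (auto simp: abs_mult intro!: mult_left_mono component_le_norm_cart)
  finally show ?thesis by (simp add: distrib_right sum_distrib_right)
qed

lemma abs_lower_le: "\<exists>L\<ge>0. \<forall>x. \<bar>lower idx c j x\<bar> \<le> L * norm x"
  unfolding lower_def
  by (intro exI[of _ "1 + (\<Sum>m\<in>{m. idx m < idx j}. \<bar>c $ j $ m\<bar>)"] conjI allI abs_affine_row_le)
    (simp add: sum_nonneg)

lemma abs_upper_le: "\<exists>L\<ge>0. \<forall>x. \<bar>upper idx c j x\<bar> \<le> L * norm x"
  unfolding upper_def
  by (intro exI[of _ "1 + (\<Sum>m\<in>{m. idx j < idx m}. \<bar>c $ j $ m\<bar>)"] conjI allI abs_affine_row_le)
    (simp add: sum_nonneg)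

text \<open>The increment is linear in the kept coordinates, as i \<notin> M, and therefore
  Lipschitz without general position.\<close>

lemma reach_linear_step:
  fixes f :: "real ^ 'n::finite \<Rightarrow> real ^ 'n"
  assumes K: "compact K" "0 \<in> K" and f: "continuous_on K f" "semialgebraic_map K f" "f 0 = 0"
    and P: "polynomial_function P" "polynomial_function P'" "P (0, 0) = 0" "P' (0, 0) = 0"
    and other: "\<And>x j. j \<noteq> i \<Longrightarrow> P' (x, f x) $ j = P (x, f x) $ j" and "i \<notin> M"
    and diff: "\<And>x. P' (x, f x) $ i - P (x, f x) $ i = (\<Sum>l\<in>M. a l * P (x, f x) $ l)"
  shows "reach K (\<lambda>x. P (x, f x)) (\<lambda>x. P' (x, f x))"
proof (rule reach_step[OF K f P, where i = i and C = "\<Sum>l\<in>M. \<bar>a l\<bar>"])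
  fix x y
  have "(P' (x, f x) $ i - P (x, f x) $ i) - (P' (y, f y) $ i - P (y, f y) $ i) =
      (\<Sum>l\<in>M. a l * (P (x, f x) - P (y, f y)) $ l)"
    unfolding diff sum_subtractf[symmetric] by (simp add: right_diff_distrib)
  then show "\<bar>(P' (x, f x) $ i - P (x, f x) $ i) - (P' (y, f y) $ i - P (y, f y) $ i)\<bar> \<le>
      (\<Sum>l\<in>M. \<bar>a l\<bar>) * norm (omit i (P (x, f x) - P (y, f y)))"
    by (simp only:) (rule abs_sum_le_norm_omit[OF \<open>i \<notin> M\<close>])
qed (use other in \<open>simp_all add: sum_nonneg\<close>)

text \<open>The embedding \<open>x\<close> is changed into \<open>lower x\<close>, then into \<open>upper (f x)\<close>, then into \<open>f x\<close>, one
  coordinate at a time. The first and last changes are linear; in between, the coordinates that are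
  kept form a bi-Lipschitz image of \<open>K\<close> by general position.\<close>

lemma reach_embedding:
  fixes f :: "real ^ 'n::finite \<Rightarrow> real ^ 'n" and idx :: "'n \<Rightarrow> nat"
  assumes K: "compact K" "0 \<in> K" and f: "continuous_on K f" "semialgebraic_map K f" "f 0 = 0"
    and lip: "\<And>x y. x \<in> K \<Longrightarrow> y \<in> K \<Longrightarrow> norm (f x - f y) \<le> C * norm (x - y)"
    and idx: "inj idx" and \<kappa>: "\<And>i. 0 < \<kappa> i"
    and general: "\<And>i x y. x \<in> K \<Longrightarrow> y \<in> K \<Longrightarrow>
      \<kappa> i * norm (x - y) \<le> (\<Sum>j\<in>- {i}. \<bar>mixed idx c i j (x - y) (f x - f y)\<bar>)"
  shows "reach K (\<lambda>x. x) f"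
proof -
  \<comment> \<open>Row i of \<open>lower\<close> involves smaller indices, so A proceeds from large
    to small indices and finds these coordinates still unchanged.\<close>
  define A where "A m z = (\<chi> j. if m \<le> idx j then lower idx c j (fst z) else fst z $ j)"
    for m and z :: "(real ^ 'n) \<times> (real ^ 'n)"
  \<comment> \<open>B proceeds upwards, so that the coordinates kept while i is changed are those of
    \<open>mixed idx c i\<close>: already \<open>upper\<close> of f x before i, still
    \<open>lower\<close> of x after i.\<close>
  define B where "B m z = (\<chi> j. if idx j < m then upper idx c j (snd z) else lower idx c j (fst z))"
    for m and z :: "(real ^ 'n) \<times> (real ^ 'n)"
  \<comment> \<open>Undoing row i of \<open>upper\<close> uses f x at larger indices, so E proceeds
    downwards, with these already restored.\<close>
  define E where "E m z = (\<chi> j. if m \<le> idx j then snd z $ j else upper idx c j (snd z))"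
    for m and z :: "(real ^ 'n) \<times> (real ^ 'n)"
  have pA: "polynomial_function (A m)" for m
  proof (rule polynomial_function_vecI)
    show "real_polynomial_function (\<lambda>z. A m z $ j)" for j
      by (cases "m \<le> idx j") (simp_all add: A_def rpf_lower poly_intros)
  qed
  have pB: "polynomial_function (B m)" for m
  proof (rule polynomial_function_vecI)
    show "real_polynomial_function (\<lambda>z. B m z $ j)" for j
      by (cases "idx j < m") (simp_all add: B_def rpf_lower rpf_upper poly_intros)
  qed
  have pE: "polynomial_function (E m)" for m
  proof (rule polynomial_function_vecI)
    show "real_polynomial_function (\<lambda>z. E m z $ j)" for j
      by (cases "m \<le> idx j") (simp_all add: E_def rpf_upper poly_intros)
  qed
  have zero: "A m (0, 0) = 0" "B m (0, 0) = 0" "E m (0, 0) = 0" for m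
    by (simp_all add: A_def B_def E_def vec_eq_iff lower_def upper_def)
  have A: "reach K (\<lambda>x. A (Suc m) (x, f x)) (\<lambda>x. A m (x, f x))" for m
  proof (cases "m \<in> range idx")
    case False
    then have "m \<noteq> idx j" for j by blast
    then have "m \<le> idx j \<longleftrightarrow> Suc m \<le> idx j" for j by (metis Suc_leD Suc_leI le_neq_implies_less)
    then show ?thesis by (intro reach_refl) (simp add: A_def)
  next
    case True
    then obtain i where i: "m = idx i" by blast
    have other: "m \<le> idx j \<longleftrightarrow> Suc m \<le> idx j" if "j \<noteq> i" for j
      using idx that unfolding i by (auto simp: inj_eq Suc_le_eq le_less)
    show ?thesis
    proof (rule reach_linear_step[OF K f pA pA zero(1) zero(1), where i = i])
      show "A m (x, f x) $ j = A (Suc m) (x, f x) $ j" if "j \<noteq> i" for x j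
        using other[OF that] by (simp add: A_def)
      show "A m (x, f x) $ i - A (Suc m) (x, f x) $ i =
          (\<Sum>l\<in>{l. idx l < idx i}. c $ i $ l * A (Suc m) (x, f x) $ l)" for x
        by (simp add: A_def i lower_def)
    qed simp
  qed
  have E: "reach K (\<lambda>x. E (Suc m) (x, f x)) (\<lambda>x. E m (x, f x))" for m
  proof (cases "m \<in> range idx")
    case False
    then have "m \<noteq> idx j" for j by blast
    then have "m \<le> idx j \<longleftrightarrow> Suc m \<le> idx j" for j by (metis Suc_leD Suc_leI le_neq_implies_less)
    then show ?thesis by (intro reach_refl) (simp add: E_def)
  next
    case True
    then obtain i where i: "m = idx i" by blast
    have other: "m \<le> idx j \<longleftrightarrow> Suc m \<le> idx j" if "j \<noteq> i" for j
      using idx that unfolding i by (auto simp: inj_eq Suc_le_eq le_less)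
    show ?thesis
    proof (rule reach_linear_step[OF K f pE pE zero(3) zero(3), where i = i])
      show "E m (x, f x) $ j = E (Suc m) (x, f x) $ j" if "j \<noteq> i" for x j
        using other[OF that] by (simp add: E_def)
      show "E m (x, f x) $ i - E (Suc m) (x, f x) $ i =
          (\<Sum>l\<in>{l. idx i < idx l}. - c $ i $ l * E (Suc m) (x, f x) $ l)" for x
        by (simp add: E_def i upper_def sum_negf)
    qed simp
  qed
  have B: "reach K (\<lambda>x. B m (x, f x)) (\<lambda>x. B (Suc m) (x, f x))" for m
  proof (cases "m \<in> range idx")
    case False
    then have "m \<noteq> idx j" for j by blast
    then have "idx j < m \<longleftrightarrow> idx j < Suc m" for j by (metis less_antisym less_SucI)
    then show ?thesis by (intro reach_refl) (simp add: B_def)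
  next
    case True
    then obtain i where i: "m = idx i" by blast
    have other: "idx j < m \<longleftrightarrow> idx j < Suc m" if "j \<noteq> i" for j
      using idx that unfolding i by (auto simp: inj_eq less_Suc_eq)
    obtain L where L: "0 \<le> L" "\<And>x. \<bar>lower idx c i x\<bar> \<le> L * norm x" using abs_lower_le by blast
    obtain M where M: "0 \<le> M" "\<And>x. \<bar>upper idx c i x\<bar> \<le> M * norm x" using abs_upper_le by blast
    \<comment> \<open>The increment is Lipschitz in x with constant M * \<bar>C\<bar> + L, and
      general position bounds distances in K by the kept coordinates with factor CARD('n) / \<kappa>
      i.\<close>
    define C' where "C' = (M * \<bar>C\<bar> + L) * (real CARD('n) / \<kappa> i)"
    have diff: "B (Suc m) (x, f x) $ i - B m (x, f x) $ i = upper idx c i (f x) - lower idx c i x" for x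
      by (simp add: B_def i)
    have mixed: "mixed idx c i j (x - y) (f x - f y) = (B m (x, f x) - B m (y, f y)) $ j" if "j \<noteq> i" for x y j
    proof -
      have "idx j \<noteq> idx i" using idx that by (simp add: inj_eq)
      then show ?thesis by (auto simp: mixed_def B_def i lower_diff upper_diff)
    qed
    show ?thesis
    proof (rule reach_step[OF K f pB pB zero(2) zero(2), where i = i and C = C'])
      show "B (Suc m) (x, f x) $ j = B m (x, f x) $ j" if "j \<noteq> i" for x j
        using other[OF that] by (simp add: B_def)
      show "0 \<le> C'" using L M \<kappa>[of i] by (simp add: C'_def)
      fix x y assume xy: "x \<in> K" "y \<in> K"
      have "\<kappa> i * norm (x - y) \<le> (\<Sum>j\<in>- {i}. \<bar>(B m (x, f x) - B m (y, f y)) $ j\<bar>)"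
        using general[OF xy, of i] mixed by simp
      also have "\<dots> \<le> (\<Sum>j\<in>- {i}. norm (omit i (B m (x, f x) - B m (y, f y))))"
        by (intro sum_mono abs_nth_le_norm_omit) simp
      also have "\<dots> \<le> real CARD('n) * norm (omit i (B m (x, f x) - B m (y, f y)))"
        by (simp add: mult_right_mono card_mono)
      finally have le: "norm (x - y) \<le> real CARD('n) / \<kappa> i * norm (omit i (B m (x, f x) - B m (y, f y)))"
        using \<kappa>[of i] by (simp add: field_simps)
      have "\<bar>(B (Suc m) (x, f x) $ i - B m (x, f x) $ i) - (B (Suc m) (y, f y) $ i - B m (y, f y) $ i)\<bar> =
          \<bar>upper idx c i (f x - f y) - lower idx c i (x - y)\<bar>"
        unfolding diff upper_diff lower_diff by (simp add: algebra_simps)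
      also have "\<dots> \<le> M * norm (f x - f y) + L * norm (x - y)"
        using L(2)[of "x - y"] M(2)[of "f x - f y"] by linarith
      also have "\<dots> \<le> M * (\<bar>C\<bar> * norm (x - y)) + L * norm (x - y)"
        using lip[OF xy] M(1) by (intro add_mono mult_left_mono order.refl order.trans[OF lip[OF xy]] mult_right_mono) auto
      also have "\<dots> = (M * \<bar>C\<bar> + L) * norm (x - y)" by (simp add: algebra_simps)
      also have "\<dots> \<le> (M * \<bar>C\<bar> + L) * (real CARD('n) / \<kappa> i * norm (omit i (B m (x, f x) - B m (y, f y))))"
        using L(1) M(1) by (intro mult_left_mono le) auto
      finally show "\<bar>(B (Suc m) (x, f x) $ i - B m (x, f x) $ i) - (B (Suc m) (y, f y) $ i - B m (y, f y) $ i)\<bar> \<le>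
          C' * norm (omit i (B m (x, f x) - B m (y, f y)))"
        by (simp add: C'_def mult.assoc)
    qed
  qed
  define N where "N = Suc (Max (range idx))"
  have N: "idx j < N" "\<not> N \<le> idx j" for j by (simp_all add: N_def less_Suc_eq_le not_le)
  have "reach K (\<lambda>x. A m (x, f x)) (\<lambda>x. A 0 (x, f x))" for m
    by (induction m) (auto intro: reach_refl reach_trans[OF A])
  moreover have "reach K (\<lambda>x. x) (\<lambda>x. A N (x, f x))"
    by (rule reach_refl) (simp add: A_def vec_eq_iff N)
  ultimately have 1: "reach K (\<lambda>x. x) (\<lambda>x. A 0 (x, f x))" by (blast intro: reach_trans)
  have "reach K (\<lambda>x. B 0 (x, f x)) (\<lambda>x. B m (x, f x))" for m
    by (induction m) (auto intro: reach_refl reach_trans[OF _ B])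
  moreover have "reach K (\<lambda>x. A 0 (x, f x)) (\<lambda>x. B 0 (x, f x))"
    by (rule reach_refl) (simp add: A_def B_def)
  ultimately have 2: "reach K (\<lambda>x. A 0 (x, f x)) (\<lambda>x. B N (x, f x))" by (blast intro: reach_trans)
  have "reach K (\<lambda>x. E m (x, f x)) (\<lambda>x. E 0 (x, f x))" for m
    by (induction m) (auto intro: reach_refl reach_trans[OF E])
  moreover have "reach K (\<lambda>x. B N (x, f x)) (\<lambda>x. E N (x, f x))"
    by (rule reach_refl) (simp add: B_def E_def vec_eq_iff N)
  moreover have "reach K (\<lambda>x. E 0 (x, f x)) f"
    by (rule reach_refl) (simp add: E_def vec_eq_iff)
  ultimately have "reach K (\<lambda>x. B N (x, f x)) f" by (blast intro: reach_trans)
  with 1 2 show ?thesis by (blast intro: reach_trans)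
qed

theorem theorem5p9:
  fixes X :: "(real ^ 'n::finite) set" and f :: "real ^ 'n \<Rightarrow> real ^ 'n" and k :: nat and l :: 'n
  assumes "closed X" and "semialgebraic X" and "0 \<in> X"
    and "has_germ_dim X k"
    and "semialgebraic_bilipschitz_embedding X f"
    and "CARD('n) \<ge> 2 * k + 1"
  shows "(\<exists>F. tame_semialgebraic_homeo_germ l F \<and> (\<forall>\<^sub>F x in nhds 0. x \<in> X \<longrightarrow> F x = f x)) \<and>
         (\<exists>F :: real \<Rightarrow> real ^ 'n \<Rightarrow> real ^ 'n.
            continuous_semialgebraic_family F \<and>
            (\<forall>t. tame_semialgebraic_homeo_germ l (F t)) \<and>
            (\<forall>\<^sub>F x in nhds 0. F 0 x = x) \<and>
            (\<forall>\<^sub>F x in nhds 0. x \<in> X \<longrightarrow> F 1 x = f x))"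
proof -
  obtain Y g where f: "bilipschitz_germs X Y f g" "semialgebraic_germ X f"
    using assms(5) unfolding semialgebraic_bilipschitz_embedding_def by blast
  obtain U V C D where U: "open U" "0 \<in> U" and hom: "homeomorphism (X \<inter> U) (Y \<inter> V) f g"
    and lip: "C-lipschitz_on (X \<inter> U) f" "D-lipschitz_on (Y \<inter> V) g" and f0: "f 0 = 0"
    using f(1) unfolding bilipschitz_germs_def by blast
  obtain U' where U': "open U'" "0 \<in> U'" "semialgebraic_map (X \<inter> U') f"
    using f(2) unfolding semialgebraic_germ_def by blast
  have "\<forall>\<^sub>F r in at_right 0. ball (0 :: real ^ 'n) r \<subseteq> U \<inter> U'"
  proof -
    obtain e where "0 < e" "ball 0 e \<subseteq> U \<inter> U'" using U U' by (meson IntI open_Int openE)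
    then show ?thesis unfolding eventually_at_right_field by (intro exI[of _ e]) auto
  qed
  then have "\<forall>\<^sub>F r in at_right 0. 0 < r \<and> ball (0 :: real ^ 'n) r \<subseteq> U \<inter> U' \<and>
      semialgebraic_dim (X \<inter> ball 0 r) = k"
    using assms(4) unfolding has_germ_dim_def
    by (intro eventually_conj eventually_at_right_less)
  \<comment> \<open>On the ball of radius r both germs of maps are represented and the dimension is
    already k.\<close>
  then obtain r where r: "0 < r" "ball (0 :: real ^ 'n) r \<subseteq> U \<inter> U'" "semialgebraic_dim (X \<inter> ball 0 r) = k"
    using eventually_happens'[OF trivial_limit_at_right_real] by blast
  have semi: "semialgebraic_map (X \<inter> cball 0 s) f" if "s < r" for s
  proof (rule semialgebraic_map_subset[OF U'(3)])
    have "cball 0 s = {x :: real ^ 'n. 0 \<le> s \<and> x \<bullet> x \<le> s\<^sup>2}"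
      by (auto simp: power2_norm_eq_inner[symmetric] intro: power_mono power2_le_imp_le order.trans[OF norm_ge_zero])
    moreover have "semialgebraic {x :: real ^ 'n. 0 \<le> s \<and> x \<bullet> x \<le> s\<^sup>2}"
      by (intro semialgebraic_conj semialgebraic_le poly_intros)
    ultimately show "semialgebraic (X \<inter> cball 0 s)" using assms(2) semialgebraic.Int by metis
    show "X \<inter> cball 0 s \<subseteq> X \<inter> U'" using r(2) that by force
  qed
  have sub: "X \<inter> cball 0 s \<subseteq> X \<inter> U" if "s < r" for s using r(2) that by force
  have cont: "continuous_on (X \<inter> cball 0 s) f" if "s < r" for s
    using lipschitz_on_continuous_on[OF lip(1)] sub[OF that] continuous_on_subset by blast
  have comp: "compact (X \<inter> cball 0 s)" for s using assms(1) by (intro closed_Int_compact compact_cball)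
  have lip1: "norm (f x - f y) \<le> C * norm (x - y)" if "x \<in> X \<inter> U" "y \<in> X \<inter> U" for x y
    using lipschitz_onD[OF lip(1) that] by (simp add: dist_norm)
  have lip2: "norm (x - y) \<le> D * norm (f x - f y)" if "x \<in> X \<inter> U" "y \<in> X \<inter> U" for x y
  proof -
    have "f x \<in> Y \<inter> V" "f y \<in> Y \<inter> V" using homeomorphism_image1[OF hom] that by blast+
    then have "dist (g (f x)) (g (f y)) \<le> D * dist (f x) (f y)" by (rule lipschitz_onD[OF lip(2)])
    then show ?thesis using homeomorphism_apply1[OF hom] that by (simp add: dist_norm)
  qed
  \<comment> \<open>The dimension is known on an open ball, while the selection of cells needs a
    compact set; half the radius reconciles the two.\<close>
  have r2: "r / 2 < r" using r(1) by simp
  have dim: "alg_dim_le ((\<lambda>x. (x, f x)) ` (X \<inter> cball 0 (r / 2))) Basis (\<lambda>b z. z \<bullet> b) k"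
    by (rule graph_alg_dim_le[OF comp _ cont[OF r2] semi[OF r2], of "X \<inter> ball 0 r"])
      (use r assms(6) in auto)
  obtain idx :: "'n \<Rightarrow> nat" where idx: "inj idx"
    using finite_imp_inj_to_nat_seg[of "UNIV :: 'n set"] by auto
  have "\<exists>c. \<forall>i. \<exists>s>0. \<exists>\<kappa>>0. \<forall>x\<in>X \<inter> cball 0 (r / 2) \<inter> ball 0 s. \<forall>y\<in>X \<inter> cball 0 (r / 2) \<inter> ball 0 s.
      \<kappa> * norm (x - y) \<le> (\<Sum>j\<in>- {i}. \<bar>mixed idx c i j (x - y) (f x - f y)\<bar>)"
    by (rule general_position[OF idx assms(6) dim, of C D]) (use lip1 lip2 sub[OF r2] in blast)+
  then obtain c where "\<forall>i. \<exists>s>0. \<exists>\<kappa>>0. \<forall>x\<in>X \<inter> cball 0 (r / 2) \<inter> ball 0 s.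
      \<forall>y\<in>X \<inter> cball 0 (r / 2) \<inter> ball 0 s.
      \<kappa> * norm (x - y) \<le> (\<Sum>j\<in>- {i}. \<bar>mixed idx c i j (x - y) (f x - f y)\<bar>)" by (rule exE)
  from choice[OF this] obtain s where s: "\<forall>i. 0 < s i \<and> (\<exists>\<kappa>>0. \<forall>x\<in>X \<inter> cball 0 (r / 2) \<inter> ball 0 (s i).
      \<forall>y\<in>X \<inter> cball 0 (r / 2) \<inter> ball 0 (s i).
      \<kappa> * norm (x - y) \<le> (\<Sum>j\<in>- {i}. \<bar>mixed idx c i j (x - y) (f x - f y)\<bar>))" by (rule exE)
  then have "\<forall>i. \<exists>\<kappa>>0. \<forall>x\<in>X \<inter> cball 0 (r / 2) \<inter> ball 0 (s i).
      \<forall>y\<in>X \<inter> cball 0 (r / 2) \<inter> ball 0 (s i).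
      \<kappa> * norm (x - y) \<le> (\<Sum>j\<in>- {i}. \<bar>mixed idx c i j (x - y) (f x - f y)\<bar>)" by simp
  from choice[OF this] obtain \<kappa> where \<kappa>: "\<forall>i. 0 < \<kappa> i \<and> (\<forall>x\<in>X \<inter> cball 0 (r / 2) \<inter> ball 0 (s i).
      \<forall>y\<in>X \<inter> cball 0 (r / 2) \<inter> ball 0 (s i).
      \<kappa> i * norm (x - y) \<le> (\<Sum>j\<in>- {i}. \<bar>mixed idx c i j (x - y) (f x - f y)\<bar>))" by (rule exE)
  \<comment> \<open>Each coordinate i has its own radius s i. Halving the minimum places a closed
    ball inside all these open balls.\<close>
  define \<rho> where "\<rho> = min (r / 2) (Min (range s) / 2)"
  have Ms: "0 < Min (range s)" "Min (range s) \<le> s i" for i using s by auto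
  have \<rho>: "0 < \<rho>" "\<rho> \<le> r / 2" "\<rho> < r" using r(1) Ms(1) by (auto simp: \<rho>_def)
  have \<rho>s: "\<rho> < s i" for i
    using Ms(1) Ms(2)[of i] min.cobounded2[of "r / 2" "Min (range s) / 2"] unfolding \<rho>_def by linarith
  define K where "K = X \<inter> cball 0 \<rho>"
  have "reach K (\<lambda>x. x) f"
  proof (rule reach_embedding)
    show "compact K" "0 \<in> K" using comp assms(3) \<rho>(1) by (simp_all add: K_def)
    show "continuous_on K f" "semialgebraic_map K f" using cont semi \<rho>(3) by (simp_all add: K_def)
    show "norm (f x - f y) \<le> C * norm (x - y)" if "x \<in> K" "y \<in> K" for x y
      using lip1 sub[OF \<rho>(3)] that unfolding K_def by blast
    have K: "K \<subseteq> X \<inter> cball 0 (r / 2) \<inter> ball 0 (s i)" for i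
      using \<rho>(2) \<rho>s[of i] by (auto simp: K_def)
    show "\<kappa> i * norm (x - y) \<le> (\<Sum>j\<in>- {i}. \<bar>mixed idx c i j (x - y) (f x - f y)\<bar>)" if "x \<in> K" "y \<in> K" for i x y
      using \<kappa> K[of i] that by (meson subsetD)
  qed (use f0 idx \<kappa> in auto)
  \<comment> \<open>One family serves both claims: \<open>F 1\<close> is the homeomorphism of the
    first.\<close>
  then obtain F where F: "shear_family F" "\<And>x. x \<in> K \<Longrightarrow> F 1 x = f x" unfolding reach_def by blast
  have tame: "tame_semialgebraic_homeo_germ l (F t)" for t by (rule shear_family_tame[OF F(1)])
  have ext: "\<forall>\<^sub>F x in nhds 0. x \<in> X \<longrightarrow> F 1 x = f x"
    unfolding eventually_nhds
    by (intro exI[of _ "ball 0 \<rho>"]) (use \<rho>(1) F(2) in \<open>auto simp: K_def\<close>)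
  have "continuous_semialgebraic_family F"
    unfolding continuous_semialgebraic_family_def case_prod_unfold
    using shear_family_continuous[OF F(1)] shear_family_semialgebraic[OF F(1)]
    by (intro exI[of _ UNIV]) auto
  moreover have "\<forall>\<^sub>F x in nhds 0. F 0 x = x" using shear_family_0[OF F(1)] by simp
  ultimately show ?thesis using tame ext by blast
qed

end
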